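(* Under assumptions (i)–(vii) of the context, for any $n\in\mathbb{N}$ one has $\mathcal{T}_n(t)=\overline{\mathcal{T}}_n(t)$ for any $t\ge 0$.
   Context: $\mathcal{E}$ is a real ordered Banach space with (closed) positive cone $\mathcal{E}_+$ that is generating, $\mathcal{E}=\mathcal{E}_+-\mathcal{E}_+$, and on which the norm is additive: $\|u+v\|=\|u\|+\|v\|$ for $u,v\in\mathcal{E}_+$. An evolution family in $\mathcal{E}$ is a family $(\mathbf{U}(t,s))_{t\ge s\ge 0}$ of bounded linear operators on $\mathcal{E}$ such that (a) for each $u\in\mathcal{E}$ the map $(t,s)\mapsto\mathbf{U}(t,s)u$ is continuous on $t\ge s\ge 0$; (b) $\mathbf{U}(t,s)=\mathbf{U}(t,r)\mathbf{U}(r,s)$ and $\mathbf{U}(t,t)=\mathbf{I}$ for $t\ge r\ge s$; (c) $\|\mathbf{U}(t,s)\|\le Ce^{\beta(t-s)}$ for $t\ge s$, for some constants $C,\beta>0$. Assumptions: $(\mathbf{U}(t,s))_{t\ge s\ge0}$ is a given evolution family in $\mathcal{E}$ and $(\mathbf{B}(t))_{t\ge 0}$ is a family of (possibly unbounded) linear operators $\mathbf{B}(t):\mathscr{D}(\mathbf{B}(t))\subset\mathcal{E}\to\mathcal{E}$ such that: (i) $\mathbf{U}(t,s)u\in\mathcal{E}_+$ for $u\in\mathcal{E}_+$, $t\ge s\ge 0$; (ii) $\|\mathbf{U}(t,s)u\|_{\mathcal{E}}\le\|u\|_{\mathcal{E}}$ for $u\in\mathcal{E}_+$, $t\ge s\ge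 0$; (iii) $\mathbf{B}(t)u\in\mathcal{E}_+$ for $u\in\mathscr{D}(\mathbf{B}(t))\cap\mathcal{E}_+$, $t\ge 0$; (iv) for any $u\in\mathcal{E}$ and $s\ge 0$, $\mathbf{U}(t,s)u\in\mathscr{D}(\mathbf{B}(t))$ for a.e. $t\ge s$ and the mapping $t\in[s,\infty)\mapsto\mathbf{B}(t)\mathbf{U}(t,s)u$ is measurable; moreover, for any $t\ge s\ge 0$ and $u\in\mathcal{E}_+$, $\int_s^t\|\mathbf{B}(\tau)\mathbf{U}(\tau,s)u\|_{\mathcal{E}}\,\mathrm{d}\tau\le\|u\|_{\mathcal{E}}-\|\mathbf{U}(t,s)u\|_{\mathcal{E}}$; (v) with $\Delta=\{(t,s):0\le s\le t<\infty\}$ and $\mathfrak{X}=L^1(\mathbb{R}_+,\mathcal{E})$, for any $f\in\mathfrak{X}$ the mapping $(t,s)\in\Delta\mapsto\mathbf{B}(t)\mathbf{U}(t,s)f(s)\in\mathcal{E}$ is well-defined for almost every $(t,s)\in\Delta$ and is measurable; (vi) for any $t\ge0$, $\mathbf{B}(t)$ is "increasingly closed": if $(u_n)_n\subset\mathscr{D}(\mathbf{B}(t))\cap\mathcal{E}_+$ is increasing with $\lim_nu_n=u\in\mathcal{E}_+$ and $\sup_n\|\mathbf{B}(t)u_n\|_{\mathcal{E}}<\infty$, then $u\in\mathscr{D}(\mathbf{B}(t))$ and $\lim_n\mathbf{B}(t)u_n=\mathbf{B}(t)u$; (vii) with $\Delta_2=\{(t,s,r):0\le r\le s\le t<\infty\}$,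 for any $f\in L^1(\Delta,\mathcal{E})$ the mapping $(t,s,r)\in\Delta_2\mapsto\mathbf{B}(t)\mathbf{U}(t,s)f(s,r)\in\mathcal{E}$ is measurable. Two families of iterates are defined for $t\ge s\ge0$, $u\in\mathcal{E}$: $\mathbf{V}_0(t,s)=\overline{\mathbf{V}}_0(t,s)=\mathbf{U}(t,s)$ and, for $n\ge 1$, $$\mathbf{V}_n(t,s)u=\int_s^t\mathbf{V}_{n-1}(t,r)\mathbf{B}(r)\mathbf{U}(r,s)u\,\mathrm{d}r,\qquad\overline{\mathbf{V}}_n(t,s)u=\int_s^t\mathbf{U}(t,r)\mathbf{B}(r)\overline{\mathbf{V}}_{n-1}(r,s)u\,\mathrm{d}r.$$ (Under these assumptions, $\overline{\mathbf{V}}_{n}(r,s)u\in\mathscr{D}(\mathbf{B}(r))$ for a.e. $r\ge s$ and $r\mapsto\mathbf{B}(r)\overline{\mathbf{V}}_n(r,s)u$ is integrable on $[s,\infty)$, so the definition makes sense.) For $f\in\mathfrak{X}$, $t\ge0$, $n\in\mathbb{N}$ (including $0$), the bounded operators $\mathcal{T}_n(t),\overline{\mathcal{T}}_n(t)$ on $\mathfrak{X}$ are $$[\mathcal{T}_n(t)f](r)=\chi_+(r-t)\mathbf{V}_n(r,r-t)f(r-t),\qquad[\overline{\mathcal{T}}_n(t)f](r)=\chi_+(r-t)\overline{\mathbf{V}}_n(r,r-t)f(r-t),\quad r\ge0,$$ where $\chi_+$ is the indicator function of $\mathbb{R}_+=[0,\infty)$. *)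

theory Defs
  imports "HOL-Analysis.Analysis"
begin

text \<open>
  The library's Bochner integral is restricted to second countable spaces, whereas the Banach
  space here need not be separable.  Below, measurability of vector-valued functions is strong
  (Bochner) measurability, and the integral repeats the construction of
  \<open>has_bochner_integral\<close> with strong in place of Borel measurability.  The measures used are
  Lebesgue measures on Lebesgue measurable sets, which are complete, so that functions only need
  to be defined almost everywhere.  The lemmas \<open>strongly_measurable_iff_borel\<close> and
  \<open>has_Bochner_int_iff\<close> show that on second countable spaces the library notions are recovered.
\<close>

definition strongly_measurable :: "'b measure \<Rightarrow> ('b \<Rightarrow> 'a::real_normed_vector) \<Rightarrow> bool" where
  "strongly_measurable M f \<longleftrightarrow>
     (\<exists>\<sigma>. (\<forall>i::nat. simple_function M (\<sigma> i)) \<and> (AE x in M. (\<lambda>i. \<sigma> i x) \<longlonglongrightarrow> f x))"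

definition has_Bochner_int :: "'b measure \<Rightarrow> ('b \<Rightarrow> 'a::real_normed_vector) \<Rightarrow> 'a \<Rightarrow> bool" where
  "has_Bochner_int M f v \<longleftrightarrow> strongly_measurable M f \<and>
     (\<exists>\<sigma>. (\<forall>i::nat. Bochner_Integration.simple_bochner_integrable M (\<sigma> i)) \<and>
          (\<lambda>i. \<integral>\<^sup>+x. ennreal (norm (f x - \<sigma> i x)) \<partial>M) \<longlonglongrightarrow> 0 \<and>
          (\<lambda>i. Bochner_Integration.simple_bochner_integral M (\<sigma> i)) \<longlonglongrightarrow> v)"

definition Bochner_integrable :: "'b measure \<Rightarrow> ('b \<Rightarrow> 'a::real_normed_vector) \<Rightarrow> bool" where
  "Bochner_integrable M f \<longleftrightarrow> (\<exists>v. has_Bochner_int M f v)"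

definition Bochner_int :: "'b measure \<Rightarrow> ('b \<Rightarrow> 'a::real_normed_vector) \<Rightarrow> 'a" where
  "Bochner_int M f = (if Bochner_integrable M f then THE v. has_Bochner_int M f v else 0)"

lemma strongly_measurable_iff_borel:
  fixes f :: "'b \<Rightarrow> 'a::{real_normed_vector, second_countable_topology}"
  assumes "complete_measure M"
  shows "strongly_measurable M f \<longleftrightarrow> f \<in> borel_measurable M"
proof
  assume "f \<in> borel_measurable M"
  from borel_measurable_implies_sequence_metric[OF this, of 0]
  obtain F where "\<And>i::nat. simple_function M (F i)" "\<And>x. x \<in> space M \<Longrightarrow> (\<lambda>i. F i x) \<longlonglongrightarrow> f x"
    by blast
  then show "strongly_measurable M f"
    unfolding strongly_measurable_def by (intro exI[of _ F]) auto
next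
  assume "strongly_measurable M f"
  then obtain s where s: "\<And>i::nat. simple_function M (s i)"
    and lim: "AE x in M. (\<lambda>i. s i x) \<longlonglongrightarrow> f x"
    unfolding strongly_measurable_def by blast
  from AE_E3[OF lim] obtain N where N: "N \<in> null_sets M"
    "\<And>x. x \<in> space M - N \<Longrightarrow> (\<lambda>i. s i x) \<longlonglongrightarrow> f x"
    by blast
  have Nm[measurable]: "N \<in> sets M" using N by auto
  have [measurable]: "s i \<in> borel_measurable M" for i
    using s by (rule borel_measurable_simple_function)
  define g where "g x = (if x \<in> N then 0 else f x)" for x
  have g: "g \<in> borel_measurable M"
  proof (rule borel_measurable_LIMSEQ_metric)
    show "(\<lambda>x. if x \<in> N then 0 else s i x) \<in> borel_measurable M" for i
      by measurable
    show "(\<lambda>i. if x \<in> N then 0 else s i x) \<longlonglongrightarrow> g x" if "x \<in> space M" for x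
      using that N(2) by (auto simp: g_def)
  qed
  show "f \<in> borel_measurable M"
  proof (rule measurableI)
    fix A :: "'a set" assume A: "A \<in> sets borel"
    have "f -` A \<inter> space M = (g -` A \<inter> space M - N) \<union> (f -` A \<inter> space M \<inter> N)"
      by (auto simp: g_def)
    moreover have "g -` A \<inter> space M - N \<in> sets M"
      using g A Nm by (intro sets.Diff measurable_sets) auto
    moreover have "f -` A \<inter> space M \<inter> N \<in> sets M"
      using complete_measure.complete[OF assms, of "f -` A \<inter> space M \<inter> N" N] N(1) by auto
    ultimately show "f -` A \<inter> space M \<in> sets M" by (metis sets.Un)
  qed auto
qed

lemma has_Bochner_int_iff:
  fixes f :: "'b \<Rightarrow> 'a::{real_normed_vector, second_countable_topology}"
  assumes "complete_measure M"
  shows "has_Bochner_int M f v \<longleftrightarrow> has_bochner_integral M f v"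
  unfolding has_Bochner_int_def has_bochner_integral.simps strongly_measurable_iff_borel[OF assms]
  by blast

definition generating_cone :: "'a::ordered_real_vector itself \<Rightarrow> bool" where
  "generating_cone _ \<longleftrightarrow> (\<forall>w::'a. \<exists>u v. 0 \<le> u \<and> 0 \<le> v \<and> w = u - v)"

definition evolution_family :: "(real \<Rightarrow> real \<Rightarrow> 'a \<Rightarrow> 'a::real_normed_vector) \<Rightarrow> bool" where
  "evolution_family U \<longleftrightarrow>
     (\<forall>t s. 0 \<le> s \<and> s \<le> t \<longrightarrow> bounded_linear (U t s)) \<and>
     (\<forall>u. continuous_on {(t, s). 0 \<le> s \<and> s \<le> t} (\<lambda>(t, s). U t s u)) \<and>
     (\<forall>t r s. 0 \<le> s \<and> s \<le> r \<and> r \<le> t \<longrightarrow> (\<forall>u. U t s u = U t r (U r s u))) \<and>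
     (\<forall>t u. 0 \<le> t \<longrightarrow> U t t u = u) \<and>
     (\<exists>C \<beta>. 0 < C \<and> 0 < \<beta> \<and>
        (\<forall>t s. 0 \<le> s \<and> s \<le> t \<longrightarrow> onorm (U t s) \<le> C * exp (\<beta> * (t - s))))"

text \<open>
  An unbounded operator is a pair of its domain \<open>D\<close> and a total function \<open>B\<close> whose values outside
  \<open>D\<close> are irrelevant.
\<close>

definition linear_operator_on :: "'a set \<Rightarrow> ('a \<Rightarrow> 'a::real_vector) \<Rightarrow> bool" where
  "linear_operator_on D B \<longleftrightarrow> subspace D \<and>
     (\<forall>u\<in>D. \<forall>v\<in>D. B (u + v) = B u + B v) \<and> (\<forall>c. \<forall>u\<in>D. B (c *\<^sub>R u) = c *\<^sub>R B u)"

definition increasingly_closed ::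
    "'a set \<Rightarrow> ('a \<Rightarrow> 'a::{real_normed_vector, ordered_real_vector}) \<Rightarrow> bool" where
  "increasingly_closed D B \<longleftrightarrow>
     (\<forall>w u. (\<forall>n::nat. w n \<in> D \<and> 0 \<le> w n) \<and> incseq w \<and> 0 \<le> u \<and> w \<longlonglongrightarrow> u \<and>
        bdd_above (range (\<lambda>n. norm (B (w n)))) \<longrightarrow>
        u \<in> D \<and> (\<lambda>n. B (w n)) \<longlonglongrightarrow> B u)"

definition Delta :: "(real \<times> real) set" where
  "Delta = {(t, s). 0 \<le> s \<and> s \<le> t}"

definition Delta2 :: "(real \<times> real \<times> real) set" where
  "Delta2 = {(t, s, r). 0 \<le> r \<and> r \<le> s \<and> s \<le> t}"

primrec V :: "(real \<Rightarrow> real \<Rightarrow> 'a \<Rightarrow> 'a) \<Rightarrow> (real \<Rightarrow> 'a \<Rightarrow> 'a::real_normed_vector) \<Rightarrow>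
    nat \<Rightarrow> real \<Rightarrow> real \<Rightarrow> 'a \<Rightarrow> 'a" where
  "V U B 0 = U"
| "V U B (Suc n) = (\<lambda>t s u. Bochner_int (lebesgue_on {s..t}) (\<lambda>r. V U B n t r (B r (U r s u))))"

primrec Vbar :: "(real \<Rightarrow> real \<Rightarrow> 'a \<Rightarrow> 'a) \<Rightarrow> (real \<Rightarrow> 'a \<Rightarrow> 'a::real_normed_vector) \<Rightarrow>
    nat \<Rightarrow> real \<Rightarrow> real \<Rightarrow> 'a \<Rightarrow> 'a" where
  "Vbar U B 0 = U"
| "Vbar U B (Suc n) = (\<lambda>t s u. Bochner_int (lebesgue_on {s..t}) (\<lambda>r. U t r (B r (Vbar U B n r s u))))"

text \<open>
  Elements of \<open>L\<^sup>1(\<real>\<^sub>+, E)\<close> are represented by integrable functions on \<open>{0..}\<close> (values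
  at negative arguments are irrelevant), their equality being equality almost everywhere.
\<close>

definition L1 :: "'b measure \<Rightarrow> ('b \<Rightarrow> 'a::real_normed_vector) set" where
  "L1 M = {f. Bochner_integrable M f}"

definition T :: "(real \<Rightarrow> real \<Rightarrow> 'a \<Rightarrow> 'a) \<Rightarrow> (real \<Rightarrow> 'a \<Rightarrow> 'a::real_normed_vector) \<Rightarrow>
    nat \<Rightarrow> real \<Rightarrow> (real \<Rightarrow> 'a) \<Rightarrow> real \<Rightarrow> 'a" where
  "T U B n t f = (\<lambda>r. indicat_real {0..} (r - t) *\<^sub>R V U B n r (r - t) (f (r - t)))"

definition Tbar :: "(real \<Rightarrow> real \<Rightarrow> 'a \<Rightarrow> 'a) \<Rightarrow> (real \<Rightarrow> 'a \<Rightarrow> 'a::real_normed_vector) \<Rightarrow>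
    nat \<Rightarrow> real \<Rightarrow> (real \<Rightarrow> 'a) \<Rightarrow> real \<Rightarrow> 'a" where
  "Tbar U B n t f = (\<lambda>r. indicat_real {0..} (r - t) *\<^sub>R Vbar U B n r (r - t) (f (r - t)))"

end

theory Submission
  imports Defs
begin

text \<open>
  The operators \<open>T\<close> and \<open>Tbar\<close> are built pointwise from the iterates \<open>V\<close> and \<open>Vbar\<close>, so it is enough
  that \<open>V U B n t s x = Vbar U B n t s x\<close> for all \<open>0 \<le> s \<le> t\<close> and all \<open>x\<close>.  This follows by induction
  on \<open>n\<close> from the fact that \<open>Vbar\<close> also satisfies the recursion that defines \<open>V\<close>, that is
  \<open>Vbar (n+1) t s x = \<integral>\<^bsub>s\<^esub>\<^bsup>t\<^esup> Vbar n t r (B r (U r s x)) dr\<close> (\<open>Vb_Suc_eq_right_integral\<close>).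

  Exchanging integrals directly would require moving \<open>B\<close> under a Bochner integral, although \<open>B\<close> is
  only increasingly closed.  The proof therefore uses no double integral and takes the following route.

  \<^item> For an integrable \<open>g \<ge> 0\<close> put \<open>J \<tau> = \<integral>\<^bsub>s\<^esub>\<^bsup>\<tau>\<^esup> U \<tau> r (g r) dr\<close>.  Stopping the integration at the
    dyadic point \<open>d\<close> before \<open>\<tau>\<close> gives \<open>U \<tau> d (J d)\<close>, which lies in the domain of \<open>B \<tau>\<close> for almost every
    \<open>\<tau>\<close>, because only countably many pairs \<open>(d, J d)\<close> occur.  These vectors increase to \<open>J \<tau>\<close> when the
    dyadic partition is refined, and the integral bound on \<open>B \<tau> (U \<tau> s u)\<close>, summed over the partition,
    telescopes.  Increasing closedness then yields \<open>J \<tau> \<in> D \<tau>\<close> almost everywhere, together with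
    \<open>\<integral> \<parallel>B \<tau> (J \<tau>)\<parallel> d\<tau> + \<parallel>J t\<parallel> \<le> \<integral> \<parallel>g\<parallel>\<close> (\<open>BJ_dom\<close>, \<open>BJ_bound\<close>).
  \<^item> Hence the iterates \<open>Vbar n\<close> are positive contractions on the cone, and linearity of \<open>B\<close> alone gives
    \<open>Vbar n t s = (\<Sum>j\<le>n. Vbar j t r \<circ> Vbar (n-j) r s)\<close> (\<open>Vb_convolution\<close>).
  \<^item> Let \<open>defect n t s\<close> be the difference of the two sides of the recursion.  If the defects of lower
    order vanish, the convolution identity makes \<open>defect n\<close> additive along a partition of \<open>[s, t]\<close>:
    \<open>defect n t s = U t b \<circ> defect n b s + defect n t b \<circ> U b s\<close>.  On a cell \<open>[a, b]\<close> its norm is at most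
    twice the mass that \<open>U b r\<close> loses on \<open>B r (U r s u)\<close>, integrated over the cell.  Along dyadic partitions
    the sum of these losses tends to \<open>0\<close> by dominated convergence (\<open>defect_zero\<close>).

  Positive vectors suffice throughout: a closed generating cone in a Banach space splits every vector
  into positive parts of comparable norm (\<open>generating_cone_bounded_decomposition\<close>), so that positive
  contractions on the cone are bounded operators with a common bound.
\<close>

section \<open>Strongly measurable functions\<close>

lemma strongly_measurableD_seq:
  assumes "strongly_measurable M f"
  obtains \<sigma> where "\<And>i::nat. simple_function M (\<sigma> i)" "AE x in M. (\<lambda>i. \<sigma> i x) \<longlonglongrightarrow> f x"
  using assms unfolding strongly_measurable_def by blast

lemma strongly_measurable_simple: "simple_function M f \<Longrightarrow> strongly_measurable M f"
  unfolding strongly_measurable_def by (intro exI[of _ "\<lambda>_. f"]) auto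

lemma strongly_measurable_cong_AE:
  assumes "strongly_measurable M f" "AE x in M. f x = g x"
  shows "strongly_measurable M g"
proof -
  obtain \<sigma> where s: "\<And>i::nat. simple_function M (\<sigma> i)" "AE x in M. (\<lambda>i. \<sigma> i x) \<longlonglongrightarrow> f x"
    using assms(1) by (rule strongly_measurableD_seq) blast
  have "AE x in M. (\<lambda>i. \<sigma> i x) \<longlonglongrightarrow> g x"
    using s(2) assms(2) by eventually_elim simp
  then show ?thesis unfolding strongly_measurable_def
    by (intro exI[of _ \<sigma>] conjI allI s(1))
qed

lemma strongly_measurable_compose2:
  fixes p :: "'a::real_normed_vector \<Rightarrow> 'b::real_normed_vector \<Rightarrow> 'c::real_normed_vector"
  assumes "strongly_measurable M f" "strongly_measurable M g"
    and cont: "continuous_on UNIV (\<lambda>z. p (fst z) (snd z))"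
  shows "strongly_measurable M (\<lambda>x. p (f x) (g x))"
proof -
  obtain \<sigma> where s: "\<And>i::nat. simple_function M (\<sigma> i)" "AE x in M. (\<lambda>i. \<sigma> i x) \<longlonglongrightarrow> f x"
    using assms(1) by (rule strongly_measurableD_seq) blast
  obtain \<tau> where t: "\<And>i::nat. simple_function M (\<tau> i)" "AE x in M. (\<lambda>i. \<tau> i x) \<longlonglongrightarrow> g x"
    using assms(2) by (rule strongly_measurableD_seq) blast
  have "AE x in M. (\<lambda>i. p (\<sigma> i x) (\<tau> i x)) \<longlonglongrightarrow> p (f x) (g x)"
    using s(2) t(2)
  proof eventually_elim
    case (elim x)
    have "(\<lambda>i. (\<sigma> i x, \<tau> i x)) \<longlonglongrightarrow> (f x, g x)"
      using elim by (intro tendsto_Pair)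
    from continuous_on_tendsto_compose[OF cont this] show ?case by simp
  qed
  moreover have "simple_function M (\<lambda>x. p (\<sigma> i x) (\<tau> i x))" for i
    using s(1) t(1) by (rule simple_function_compose2)
  ultimately show ?thesis unfolding strongly_measurable_def
    by (intro exI[of _ "\<lambda>i x. p (\<sigma> i x) (\<tau> i x)"] conjI allI)
qed

lemma strongly_measurable_compose:
  fixes p :: "'a::real_normed_vector \<Rightarrow> 'b::real_normed_vector"
  assumes "strongly_measurable M f" "continuous_on UNIV p"
  shows "strongly_measurable M (\<lambda>x. p (f x))"
  by (rule strongly_measurable_compose2[OF assms(1) assms(1), of "\<lambda>x y. p x"])
     (rule continuous_on_compose2[OF assms(2) continuous_on_fst[OF continuous_on_id]], simp)

lemma strongly_measurable_add:
  "strongly_measurable M f \<Longrightarrow> strongly_measurable M g \<Longrightarrow> strongly_measurable M (\<lambda>x. f x + g x)"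
  by (rule strongly_measurable_compose2[where p="(+)"]) (assumption | intro continuous_intros)+

lemma strongly_measurable_diff:
  "strongly_measurable M f \<Longrightarrow> strongly_measurable M g \<Longrightarrow> strongly_measurable M (\<lambda>x. f x - g x)"
  by (rule strongly_measurable_compose2[where p="(-)"]) (assumption | intro continuous_intros)+

lemma strongly_measurable_sum:
  assumes "finite I" "\<And>i. i \<in> I \<Longrightarrow> strongly_measurable M (f i)"
  shows "strongly_measurable M (\<lambda>x. \<Sum>i\<in>I. f i x)"
  using assms
proof (induction I rule: finite_induct)
  case empty
  show ?case by (simp add: strongly_measurable_simple)
next
  case (insert j I)
  then show ?case by (simp add: strongly_measurable_add)
qed

lemma strongly_measurable_indicator:
  assumes "strongly_measurable M f" "A \<in> sets M"
  shows "strongly_measurable M (\<lambda>x. indicat_real A x *\<^sub>R f x)"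
  by (rule strongly_measurable_compose2[where p=scaleR, OF strongly_measurable_simple assms(1)])
     (rule simple_function_indicator[OF assms(2)], intro continuous_intros)

lemma strongly_measurable_norm:
  assumes "complete_measure M" "strongly_measurable M f"
  shows "(\<lambda>x. norm (f x)) \<in> borel_measurable M"
  using strongly_measurable_compose[OF assms(2) continuous_on_norm[OF continuous_on_id]]
  unfolding strongly_measurable_iff_borel[OF assms(1)] .

text \<open>
  This produces strongly measurable functions in a space that need not be separable: the separability
  is taken over from the parameter space.
\<close>

lemma strongly_measurable_borel_comp:
  fixes c :: "'b::{real_normed_vector, second_countable_topology} \<Rightarrow> 'a::real_normed_vector"
  assumes "h \<in> borel_measurable M" "continuous_on UNIV c"
  shows "strongly_measurable M (\<lambda>x. c (h x))"
proof -
  obtain F where F: "\<And>i::nat. simple_function M (F i)" "\<And>x. x \<in> space M \<Longrightarrow> (\<lambda>i. F i x) \<longlonglongrightarrow> h x"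
    using borel_measurable_implies_sequence_metric[OF assms(1), of 0] by blast
  have "simple_function M (\<lambda>x. c (F i x))" for i
    using F(1) by (rule simple_function_compose1)
  moreover have "AE x in M. (\<lambda>i. c (F i x)) \<longlonglongrightarrow> c (h x)"
    using continuous_on_tendsto_compose[OF assms(2) F(2)] by auto
  ultimately show ?thesis unfolding strongly_measurable_def
    by (intro exI[of _ "\<lambda>i x. c (F i x)"]) auto
qed

lemma strongly_measurable_restrict_iff:
  assumes "A \<in> sets M"
  shows "strongly_measurable (restrict_space M A) f \<longleftrightarrow>
    strongly_measurable M (\<lambda>x. indicat_real A x *\<^sub>R f x)"
proof
  have A: "A \<inter> space M \<in> sets M" using assms by auto
  assume "strongly_measurable (restrict_space M A) f"
  then obtain \<sigma> where s: "\<And>i::nat. simple_function (restrict_space M A) (\<sigma> i)"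
      "AE x in restrict_space M A. (\<lambda>i. \<sigma> i x) \<longlonglongrightarrow> f x"
    by (rule strongly_measurableD_seq) blast
  have "AE x in M. (\<lambda>i. indicat_real A x *\<^sub>R \<sigma> i x) \<longlonglongrightarrow> indicat_real A x *\<^sub>R f x"
    using s(2) unfolding AE_restrict_space_iff[OF A]
    by eventually_elim (auto simp: indicator_def)
  then show "strongly_measurable M (\<lambda>x. indicat_real A x *\<^sub>R f x)"
    using s(1) unfolding strongly_measurable_def simple_function_restrict_space[OF A]
    by (intro exI[of _ "\<lambda>i x. indicat_real A x *\<^sub>R \<sigma> i x"]) auto
next
  have A: "A \<inter> space M \<in> sets M" using assms by auto
  assume "strongly_measurable M (\<lambda>x. indicat_real A x *\<^sub>R f x)"
  then obtain \<sigma> where s: "\<And>i::nat. simple_function M (\<sigma> i)"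
      "AE x in M. (\<lambda>i. \<sigma> i x) \<longlonglongrightarrow> indicat_real A x *\<^sub>R f x"
    by (rule strongly_measurableD_seq) blast
  have "AE x in restrict_space M A. (\<lambda>i. \<sigma> i x) \<longlonglongrightarrow> f x"
    using s(2) unfolding AE_restrict_space_iff[OF A]
    by eventually_elim auto
  moreover have "simple_function (restrict_space M A) (\<sigma> i)" for i
    unfolding simple_function_restrict_space[OF A]
    by (rule simple_function_compose2[where h=scaleR, OF simple_function_indicator[OF assms] s(1)])
  ultimately show "strongly_measurable (restrict_space M A) f"
    unfolding strongly_measurable_def by (intro exI[of _ \<sigma>] conjI allI)
qed

text \<open>
  The truncation by \<open>1\<close> turns almost everywhere convergence into convergence in measure on a finite
  measure space, without any integrability of \<open>f\<close>.
\<close>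

lemma strongly_measurable_approx:
  fixes f :: "'b \<Rightarrow> 'a::real_normed_vector"
  assumes "finite_measure M" "complete_measure M" "strongly_measurable M f" "0 < e"
  obtains \<sigma> where "simple_function M \<sigma>" "(\<integral>\<^sup>+x. ennreal (min 1 (norm (\<sigma> x - f x))) \<partial>M) < e"
proof -
  interpret finite_measure M by fact
  obtain \<sigma> where s: "\<And>i::nat. simple_function M (\<sigma> i)" "AE x in M. (\<lambda>i. \<sigma> i x) \<longlonglongrightarrow> f x"
    using assms(3) by (rule strongly_measurableD_seq) blast
  have [measurable]: "(\<lambda>x. norm (\<sigma> i x - f x)) \<in> borel_measurable M" for i
    by (intro strongly_measurable_norm strongly_measurable_diff strongly_measurable_simple s assms)
  have "(\<lambda>i. \<integral>\<^sup>+x. ennreal (min 1 (norm (\<sigma> i x - f x))) \<partial>M) \<longlonglongrightarrow> (\<integral>\<^sup>+x. 0 \<partial>M)"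
  proof (rule nn_integral_dominated_convergence[where w="\<lambda>_. 1"])
    show "AE x in M. (\<lambda>i. ennreal (min 1 (norm (\<sigma> i x - f x)))) \<longlonglongrightarrow> 0"
      using s(2)
    proof eventually_elim
      case (elim x)
      then have "(\<lambda>i. min 1 (norm (\<sigma> i x - f x))) \<longlonglongrightarrow> min 1 (norm (f x - f x))"
        by (intro tendsto_intros)
      then show ?case using tendsto_ennrealI by fastforce
    qed
  qed (auto simp: emeasure_finite less_top[symmetric])
  then have "eventually (\<lambda>i. (\<integral>\<^sup>+x. ennreal (min 1 (norm (\<sigma> i x - f x))) \<partial>M) < e) sequentially"
    using order_tendstoD(2)[of _ "0::ennreal"] assms(4) by simp
  then show ?thesis using s(1) that unfolding eventually_sequentially by blast
qed

text \<open>
  Simple functions within \<open>(1/2)^i\<close> of \<open>f i\<close> in measure differ from \<open>f i\<close> by a null sequence almost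
  everywhere, since these distances are summable, and so they converge to \<open>g\<close>.
\<close>

lemma strongly_measurable_lim:
  fixes f :: "nat \<Rightarrow> 'b \<Rightarrow> 'a::real_normed_vector"
  assumes fin: "finite_measure M" and compl: "complete_measure M"
    and meas: "\<And>i. strongly_measurable M (f i)" and lim: "AE x in M. (\<lambda>i. f i x) \<longlonglongrightarrow> g x"
  shows "strongly_measurable M g"
proof -
  have "\<exists>\<sigma>. simple_function M \<sigma> \<and> (\<integral>\<^sup>+x. ennreal (min 1 (norm (\<sigma> x - f i x))) \<partial>M) < ennreal ((1/2)^i)" for i
  proof -
    have pos: "0 < ennreal ((1/2)^i)" by (simp only: ennreal_less_zero_iff) simp
    obtain \<sigma> where "simple_function M \<sigma>" "(\<integral>\<^sup>+x. ennreal (min 1 (norm (\<sigma> x - f i x))) \<partial>M) < ennreal ((1/2)^i)"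
      by (rule strongly_measurable_approx[OF fin compl meas[of i] pos])
    then show ?thesis by (intro exI conjI)
  qed
  then have "\<exists>\<sigma>. \<forall>i. simple_function M (\<sigma> i) \<and>
      (\<integral>\<^sup>+x. ennreal (min 1 (norm (\<sigma> i x - f i x))) \<partial>M) < ennreal ((1/2)^i)"
    by (intro choice allI)
  then obtain \<sigma> where s: "\<And>i. simple_function M (\<sigma> i)"
    "\<And>i. (\<integral>\<^sup>+x. ennreal (min 1 (norm (\<sigma> i x - f i x))) \<partial>M) < ennreal ((1/2)^i)"
    by blast
  have [measurable]: "(\<lambda>x. norm (\<sigma> i x - f i x)) \<in> borel_measurable M" for i
    by (intro strongly_measurable_norm strongly_measurable_diff strongly_measurable_simple s meas compl)
  have "(\<integral>\<^sup>+x. (\<Sum>i. ennreal (min 1 (norm (\<sigma> i x - f i x)))) \<partial>M) =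
      (\<Sum>i. \<integral>\<^sup>+x. ennreal (min 1 (norm (\<sigma> i x - f i x))) \<partial>M)"
    by (rule nn_integral_suminf) measurable
  also have "\<dots> \<le> (\<Sum>i. ennreal ((1/2)^i))"
    by (intro suminf_le less_imp_le s) auto
  also have "\<dots> = ennreal (\<Sum>i. (1/2)^i)"
    by (rule suminf_ennreal2) (auto intro: summable_geometric)
  also have "\<dots> < \<infinity>" by simp
  finally have "AE x in M. (\<Sum>i. ennreal (min 1 (norm (\<sigma> i x - f i x)))) \<noteq> \<infinity>"
    by (intro nn_integral_PInf_AE) (auto simp: less_top[symmetric])
  then have "AE x in M. (\<lambda>i. \<sigma> i x) \<longlonglongrightarrow> g x"
    using lim
  proof eventually_elim
    case (elim x)
    have "summable (\<lambda>i. min 1 (norm (\<sigma> i x - f i x)))"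
      using elim(1) by (intro summable_suminf_not_top) auto
    then have m: "(\<lambda>i. min 1 (norm (\<sigma> i x - f i x))) \<longlonglongrightarrow> 0"
      by (rule summable_LIMSEQ_zero)
    then have "eventually (\<lambda>i. min 1 (norm (\<sigma> i x - f i x)) < 1) sequentially"
      using order_tendstoD(2) zero_less_one by blast
    then have "eventually (\<lambda>i. min 1 (norm (\<sigma> i x - f i x)) = norm (\<sigma> i x - f i x)) sequentially"
      by eventually_elim auto
    then have "(\<lambda>i. norm (\<sigma> i x - f i x)) \<longlonglongrightarrow> 0"
      using m by (simp cong: tendsto_cong)
    then have "(\<lambda>i. \<sigma> i x - f i x) \<longlonglongrightarrow> 0"
      by (rule tendsto_norm_zero_cancel)
    from tendsto_add[OF this elim(2)] show ?case by simp
  qed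
  then show ?thesis unfolding strongly_measurable_def
    by (intro exI[of _ \<sigma>] conjI allI s(1))
qed

section \<open>The Bochner integral\<close>

lemma norm_diff_simple_integral_le:
  fixes s t :: "'b \<Rightarrow> 'a::real_normed_vector"
  assumes s: "Bochner_Integration.simple_bochner_integrable M s" and t: "Bochner_Integration.simple_bochner_integrable M t"
  shows "ennreal (norm (Bochner_Integration.simple_bochner_integral M s - Bochner_Integration.simple_bochner_integral M t)) \<le>
    (\<integral>\<^sup>+x. ennreal (norm (s x - t x)) \<partial>M)"
proof -
  have st: "Bochner_Integration.simple_bochner_integrable M (\<lambda>x. s x - t x)"
    using Bochner_Integration.simple_bochner_integrable_compose2[of "(-)"] s t by simp
  then have nst: "Bochner_Integration.simple_bochner_integrable M (\<lambda>x. norm (s x - t x))"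
    using Bochner_Integration.simple_bochner_integrable_compose2[of "\<lambda>x y. norm x"] by simp
  have "ennreal (norm (Bochner_Integration.simple_bochner_integral M s - Bochner_Integration.simple_bochner_integral M t)) \<le>
      ennreal (Bochner_Integration.simple_bochner_integral M (\<lambda>x. norm (s x - t x)))"
    using Bochner_Integration.simple_bochner_integral_norm_bound[OF st] s t
    by (simp add: Bochner_Integration.simple_bochner_integral_diff ennreal_leI)
  also have "\<dots> = (\<integral>\<^sup>+x. ennreal (norm (s x - t x)) \<partial>M)"
    using nst by (rule Bochner_Integration.simple_bochner_integral_eq_nn_integral) simp
  finally show ?thesis .
qed

lemma strongly_measurable_simple_bochner:
  "Bochner_Integration.simple_bochner_integrable M s \<Longrightarrow> strongly_measurable M s"
  by (auto elim: Bochner_Integration.simple_bochner_integrable.cases intro: strongly_measurable_simple)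

lemma nn_integral_norm_triangle:
  assumes "complete_measure M" "strongly_measurable M f" "strongly_measurable M g" "strongly_measurable M h"
  shows "(\<integral>\<^sup>+x. ennreal (norm (f x - h x)) \<partial>M) \<le>
    (\<integral>\<^sup>+x. ennreal (norm (g x - f x)) \<partial>M) + (\<integral>\<^sup>+x. ennreal (norm (g x - h x)) \<partial>M)"
proof -
  have [measurable]: "(\<lambda>x. norm (g x - f x)) \<in> borel_measurable M"
    "(\<lambda>x. norm (g x - h x)) \<in> borel_measurable M"
    by (intro strongly_measurable_norm strongly_measurable_diff assms)+
  have "(\<integral>\<^sup>+x. ennreal (norm (f x - h x)) \<partial>M) \<le>
      (\<integral>\<^sup>+x. ennreal (norm (g x - f x)) + ennreal (norm (g x - h x)) \<partial>M)"
  proof (rule nn_integral_mono)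
    fix x
    have "norm (f x - h x) \<le> norm (g x - f x) + norm (g x - h x)"
      using norm_triangle_ineq4[of "g x - h x" "g x - f x"] by simp
    then show "ennreal (norm (f x - h x)) \<le> ennreal (norm (g x - f x)) + ennreal (norm (g x - h x))"
      by (metis ennreal_leI ennreal_plus norm_ge_zero)
  qed
  also have "\<dots> = (\<integral>\<^sup>+x. ennreal (norm (g x - f x)) \<partial>M) + (\<integral>\<^sup>+x. ennreal (norm (g x - h x)) \<partial>M)"
    by (rule nn_integral_add) auto
  finally show ?thesis .
qed

lemma has_Bochner_intD:
  assumes "has_Bochner_int M f v"
  obtains \<sigma> where "\<And>i::nat. Bochner_Integration.simple_bochner_integrable M (\<sigma> i)"
    "(\<lambda>i. \<integral>\<^sup>+x. ennreal (norm (f x - \<sigma> i x)) \<partial>M) \<longlonglongrightarrow> 0"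
    "(\<lambda>i. Bochner_Integration.simple_bochner_integral M (\<sigma> i)) \<longlonglongrightarrow> v"
proof -
  from assms obtain \<sigma> where *: "\<forall>i::nat. Bochner_Integration.simple_bochner_integrable M (\<sigma> i)"
    "(\<lambda>i. \<integral>\<^sup>+x. ennreal (norm (f x - \<sigma> i x)) \<partial>M) \<longlonglongrightarrow> 0"
    "(\<lambda>i. Bochner_Integration.simple_bochner_integral M (\<sigma> i)) \<longlonglongrightarrow> v"
    unfolding has_Bochner_int_def by (elim conjE exE)
  show thesis by (rule that[OF spec[OF *(1)] *(2,3)])
qed

lemma has_Bochner_int_measurable: "has_Bochner_int M f v \<Longrightarrow> strongly_measurable M f"
  by (simp add: has_Bochner_int_def)

lemma has_Bochner_intI:
  assumes "strongly_measurable M f" "\<And>i::nat. Bochner_Integration.simple_bochner_integrable M (\<sigma> i)"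
    "(\<lambda>i. \<integral>\<^sup>+x. ennreal (norm (f x - \<sigma> i x)) \<partial>M) \<longlonglongrightarrow> 0"
    "(\<lambda>i. Bochner_Integration.simple_bochner_integral M (\<sigma> i)) \<longlonglongrightarrow> v"
  shows "has_Bochner_int M f v"
  using assms unfolding has_Bochner_int_def by (intro conjI exI[of _ \<sigma>] allI)

lemma has_Bochner_int_cong_AE:
  assumes "has_Bochner_int M f v" "AE x in M. f x = g x"
  shows "has_Bochner_int M g v"
proof -
  obtain \<sigma> where s: "\<And>i::nat. Bochner_Integration.simple_bochner_integrable M (\<sigma> i)"
    "(\<lambda>i. \<integral>\<^sup>+x. ennreal (norm (f x - \<sigma> i x)) \<partial>M) \<longlonglongrightarrow> 0"
    "(\<lambda>i. Bochner_Integration.simple_bochner_integral M (\<sigma> i)) \<longlonglongrightarrow> v"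
    using assms(1) by (rule has_Bochner_intD) blast
  have "(\<integral>\<^sup>+x. ennreal (norm (f x - \<sigma> i x)) \<partial>M) = (\<integral>\<^sup>+x. ennreal (norm (g x - \<sigma> i x)) \<partial>M)" for i
    using assms(2) by (intro nn_integral_cong_AE) (auto elim!: eventually_mono)
  then show ?thesis
    using s strongly_measurable_cong_AE[OF has_Bochner_int_measurable[OF assms(1)] assms(2)]
    by (intro has_Bochner_intI[of M g \<sigma>]) simp_all
qed

lemma has_Bochner_int_simple:
  assumes "Bochner_Integration.simple_bochner_integrable M f"
  shows "has_Bochner_int M f (Bochner_Integration.simple_bochner_integral M f)"
  by (rule has_Bochner_intI[of _ _ "\<lambda>_. f"])
     (auto intro: assms strongly_measurable_simple_bochner)

lemma has_Bochner_int_zero: "has_Bochner_int M (\<lambda>x. 0) (0::'a::real_normed_vector)"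
proof -
  have "Bochner_Integration.simple_bochner_integrable M (\<lambda>x. 0::'a)"
    by (auto simp: Bochner_Integration.simple_bochner_integrable.simps)
  moreover have "Bochner_Integration.simple_bochner_integral M (\<lambda>x. 0::'a) = 0"
    by (auto simp: Bochner_Integration.simple_bochner_integral_def intro!: sum.neutral)
  ultimately show ?thesis using has_Bochner_int_simple by metis
qed

lemma has_Bochner_int_add:
  assumes M: "complete_measure M" and f: "has_Bochner_int M f v" and g: "has_Bochner_int M g w"
  shows "has_Bochner_int M (\<lambda>x. f x + g x) (v + w)"
proof -
  obtain \<sigma> where s: "\<And>i::nat. Bochner_Integration.simple_bochner_integrable M (\<sigma> i)"
    "(\<lambda>i. \<integral>\<^sup>+x. ennreal (norm (f x - \<sigma> i x)) \<partial>M) \<longlonglongrightarrow> 0"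
    "(\<lambda>i. Bochner_Integration.simple_bochner_integral M (\<sigma> i)) \<longlonglongrightarrow> v"
    using f by (rule has_Bochner_intD) blast
  obtain \<tau> where t: "\<And>i::nat. Bochner_Integration.simple_bochner_integrable M (\<tau> i)"
    "(\<lambda>i. \<integral>\<^sup>+x. ennreal (norm (g x - \<tau> i x)) \<partial>M) \<longlonglongrightarrow> 0"
    "(\<lambda>i. Bochner_Integration.simple_bochner_integral M (\<tau> i)) \<longlonglongrightarrow> w"
    using g by (rule has_Bochner_intD) blast
  note fm = has_Bochner_int_measurable[OF f] and gm = has_Bochner_int_measurable[OF g]
  have [measurable]: "(\<lambda>x. norm (f x - \<sigma> i x)) \<in> borel_measurable M"
    "(\<lambda>x. norm (g x - \<tau> i x)) \<in> borel_measurable M" for i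
    by (intro strongly_measurable_norm strongly_measurable_diff M fm gm
        strongly_measurable_simple_bochner s t)+
  show ?thesis
  proof (rule has_Bochner_intI[of _ _ "\<lambda>i x. \<sigma> i x + \<tau> i x"])
    show "strongly_measurable M (\<lambda>x. f x + g x)" using fm gm by (rule strongly_measurable_add)
    show "Bochner_Integration.simple_bochner_integrable M (\<lambda>x. \<sigma> i x + \<tau> i x)" for i
      using Bochner_Integration.simple_bochner_integrable_compose2[of "(+)", OF _ s(1) t(1)] by simp
    show "(\<lambda>i. Bochner_Integration.simple_bochner_integral M (\<lambda>x. \<sigma> i x + \<tau> i x)) \<longlonglongrightarrow> v + w"
      using s t by (simp add: Bochner_Integration.simple_bochner_integral_add tendsto_add)
    show "(\<lambda>i. \<integral>\<^sup>+x. ennreal (norm (f x + g x - (\<sigma> i x + \<tau> i x))) \<partial>M) \<longlonglongrightarrow> 0"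
    proof (rule tendsto_sandwich[OF _ _ tendsto_const])
      show "\<forall>\<^sub>F i in sequentially. (\<integral>\<^sup>+x. ennreal (norm (f x + g x - (\<sigma> i x + \<tau> i x))) \<partial>M) \<le>
        (\<integral>\<^sup>+x. ennreal (norm (f x - \<sigma> i x)) \<partial>M) + (\<integral>\<^sup>+x. ennreal (norm (g x - \<tau> i x)) \<partial>M)"
      proof (intro always_eventually allI)
        fix i
        have "(\<integral>\<^sup>+x. ennreal (norm (f x + g x - (\<sigma> i x + \<tau> i x))) \<partial>M) \<le>
          (\<integral>\<^sup>+x. ennreal (norm (f x - \<sigma> i x)) + ennreal (norm (g x - \<tau> i x)) \<partial>M)"
          by (intro nn_integral_mono) (simp add: norm_diff_triangle_ineq flip: ennreal_plus)
        also have "\<dots> = (\<integral>\<^sup>+x. ennreal (norm (f x - \<sigma> i x)) \<partial>M) + (\<integral>\<^sup>+x. ennreal (norm (g x - \<tau> i x)) \<partial>M)"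
          by (rule nn_integral_add) auto
        finally show "(\<integral>\<^sup>+x. ennreal (norm (f x + g x - (\<sigma> i x + \<tau> i x))) \<partial>M) \<le>
          (\<integral>\<^sup>+x. ennreal (norm (f x - \<sigma> i x)) \<partial>M) + (\<integral>\<^sup>+x. ennreal (norm (g x - \<tau> i x)) \<partial>M)" .
      qed
      show "(\<lambda>i. (\<integral>\<^sup>+x. ennreal (norm (f x - \<sigma> i x)) \<partial>M) +
          (\<integral>\<^sup>+x. ennreal (norm (g x - \<tau> i x)) \<partial>M)) \<longlonglongrightarrow> 0"
        using tendsto_add[OF s(2) t(2)] by simp
    qed auto
  qed
qed

lemma has_Bochner_int_linear:
  assumes M: "complete_measure M" and L: "bounded_linear L" and f: "has_Bochner_int M f v"
  shows "has_Bochner_int M (\<lambda>x. L (f x)) (L v)"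
proof -
  interpret L: bounded_linear L by fact
  obtain K where K: "0 < K" "\<And>x. norm (L x) \<le> norm x * K"
    using L.pos_bounded by blast
  obtain \<sigma> where s: "\<And>i::nat. Bochner_Integration.simple_bochner_integrable M (\<sigma> i)"
    "(\<lambda>i. \<integral>\<^sup>+x. ennreal (norm (f x - \<sigma> i x)) \<partial>M) \<longlonglongrightarrow> 0"
    "(\<lambda>i. Bochner_Integration.simple_bochner_integral M (\<sigma> i)) \<longlonglongrightarrow> v"
    using f by (rule has_Bochner_intD) blast
  note fm = has_Bochner_int_measurable[OF f]
  have [measurable]: "(\<lambda>x. norm (f x - \<sigma> i x)) \<in> borel_measurable M" for i
    by (intro strongly_measurable_norm strongly_measurable_diff M fm strongly_measurable_simple_bochner s)
  show ?thesis
  proof (rule has_Bochner_intI[of _ _ "\<lambda>i x. L (\<sigma> i x)"])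
    show "strongly_measurable M (\<lambda>x. L (f x))"
      using fm by (rule strongly_measurable_compose) (rule L.continuous_on[OF continuous_on_id])
    show "Bochner_Integration.simple_bochner_integrable M (\<lambda>x. L (\<sigma> i x))" for i
      using Bochner_Integration.simple_bochner_integrable_compose2[of "\<lambda>x y. L x", OF _ s(1) s(1)]
      by (simp add: L.zero)
    show "(\<lambda>i. Bochner_Integration.simple_bochner_integral M (\<lambda>x. L (\<sigma> i x))) \<longlonglongrightarrow> L v"
      using L.tendsto[OF s(3)] Bochner_Integration.simple_bochner_integral_linear[OF L.linear_axioms s(1)] by simp
    show "(\<lambda>i. \<integral>\<^sup>+x. ennreal (norm (L (f x) - L (\<sigma> i x))) \<partial>M) \<longlonglongrightarrow> 0"
    proof (rule tendsto_sandwich[OF _ _ tendsto_const])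
      show "\<forall>\<^sub>F i in sequentially. (\<integral>\<^sup>+x. ennreal (norm (L (f x) - L (\<sigma> i x))) \<partial>M) \<le>
        ennreal K * (\<integral>\<^sup>+x. ennreal (norm (f x - \<sigma> i x)) \<partial>M)"
      proof (intro always_eventually allI)
        fix i
        have "(\<integral>\<^sup>+x. ennreal (norm (L (f x) - L (\<sigma> i x))) \<partial>M) \<le>
          (\<integral>\<^sup>+x. ennreal K * ennreal (norm (f x - \<sigma> i x)) \<partial>M)"
          using K by (intro nn_integral_mono)
            (simp add: L.diff[symmetric] mult.commute flip: ennreal_mult)
        also have "\<dots> = ennreal K * (\<integral>\<^sup>+x. ennreal (norm (f x - \<sigma> i x)) \<partial>M)"
          by (rule nn_integral_cmult) auto
        finally show "(\<integral>\<^sup>+x. ennreal (norm (L (f x) - L (\<sigma> i x))) \<partial>M) \<le>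
          ennreal K * (\<integral>\<^sup>+x. ennreal (norm (f x - \<sigma> i x)) \<partial>M)" .
      qed
      show "(\<lambda>i. ennreal K * (\<integral>\<^sup>+x. ennreal (norm (f x - \<sigma> i x)) \<partial>M)) \<longlonglongrightarrow> 0"
        using ennreal_tendsto_cmult[OF _ s(2), of "ennreal K"] by simp
    qed auto
  qed
qed

lemma has_Bochner_int_diff:
  assumes M: "complete_measure M" and f: "has_Bochner_int M f v" and g: "has_Bochner_int M g w"
  shows "has_Bochner_int M (\<lambda>x. f x - g x) (v - w)"
  using has_Bochner_int_add[OF M f has_Bochner_int_linear[OF M bounded_linear_minus[OF bounded_linear_ident] g]]
  by simp

lemma has_Bochner_int_sum:
  assumes M: "complete_measure M" and "finite I" "\<And>i. i \<in> I \<Longrightarrow> has_Bochner_int M (f i) (v i)"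
  shows "has_Bochner_int M (\<lambda>x. \<Sum>i\<in>I. f i x) (\<Sum>i\<in>I. v i)"
  using assms(2,3)
proof (induction I rule: finite_induct)
  case empty
  show ?case by (simp add: has_Bochner_int_zero)
next
  case (insert j I)
  then show ?case by (simp add: has_Bochner_int_add[OF M])
qed

lemma has_Bochner_int_norm_bound:
  assumes M: "complete_measure M" and f: "has_Bochner_int M f v"
  shows "ennreal (norm v) \<le> (\<integral>\<^sup>+x. ennreal (norm (f x)) \<partial>M)"
proof -
  obtain \<sigma> where s: "\<And>i::nat. Bochner_Integration.simple_bochner_integrable M (\<sigma> i)"
    "(\<lambda>i. \<integral>\<^sup>+x. ennreal (norm (f x - \<sigma> i x)) \<partial>M) \<longlonglongrightarrow> 0"
    "(\<lambda>i. Bochner_Integration.simple_bochner_integral M (\<sigma> i)) \<longlonglongrightarrow> v"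
    using f by (rule has_Bochner_intD) blast
  have z: "Bochner_Integration.simple_bochner_integrable M (\<lambda>x. 0::'b)" "Bochner_Integration.simple_bochner_integral M (\<lambda>x. 0::'b) = 0"
    by (auto simp: Bochner_Integration.simple_bochner_integrable.simps
      Bochner_Integration.simple_bochner_integral_def intro!: sum.neutral)
  note fm = has_Bochner_int_measurable[OF f]
  have "ennreal (norm (Bochner_Integration.simple_bochner_integral M (\<sigma> i))) \<le>
      (\<integral>\<^sup>+x. ennreal (norm (f x - \<sigma> i x)) \<partial>M) + (\<integral>\<^sup>+x. ennreal (norm (f x)) \<partial>M)" for i
    using norm_diff_simple_integral_le[OF s(1)[of i] z(1)] z(2)
      nn_integral_norm_triangle[OF M strongly_measurable_simple_bochner[OF s(1)[of i]] fm
        strongly_measurable_simple_bochner[OF z(1)]]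
    by simp
  moreover have "(\<lambda>i. (\<integral>\<^sup>+x. ennreal (norm (f x - \<sigma> i x)) \<partial>M) + (\<integral>\<^sup>+x. ennreal (norm (f x)) \<partial>M))
      \<longlonglongrightarrow> 0 + (\<integral>\<^sup>+x. ennreal (norm (f x)) \<partial>M)"
    by (intro tendsto_add s tendsto_const)
  moreover have "(\<lambda>i. ennreal (norm (Bochner_Integration.simple_bochner_integral M (\<sigma> i)))) \<longlonglongrightarrow> ennreal (norm v)"
    by (intro tendsto_ennrealI tendsto_norm s)
  ultimately show ?thesis
    using LIMSEQ_le by (metis (no_types, lifting) add_0)
qed

lemma has_Bochner_int_unique:
  assumes M: "complete_measure M" and "has_Bochner_int M f v" "has_Bochner_int M f w"
  shows "v = w"
  using has_Bochner_int_norm_bound[OF M has_Bochner_int_diff[OF assms]] by simp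

lemma Bochner_int_eq:
  assumes M: "complete_measure M" and "has_Bochner_int M f v"
  shows "Bochner_int M f = v"
  unfolding Bochner_int_def Bochner_integrable_def
  using assms has_Bochner_int_unique[OF M] by (auto intro!: the_equality)

lemma has_Bochner_int_Bochner_int:
  assumes M: "complete_measure M" and "Bochner_integrable M f"
  shows "has_Bochner_int M f (Bochner_int M f)"
  using assms Bochner_int_eq[OF M] unfolding Bochner_integrable_def by auto

lemma has_Bochner_int_limit:
  fixes f :: "'b \<Rightarrow> 'a::real_normed_vector"
  assumes M: "complete_measure M" and f: "has_Bochner_int M f v"
    and g: "\<And>i::nat. has_Bochner_int M (g i) (w i)"
    and lim: "(\<lambda>i. \<integral>\<^sup>+x. ennreal (norm (f x - g i x)) \<partial>M) \<longlonglongrightarrow> 0"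
  shows "w \<longlonglongrightarrow> v"
proof -
  have "(\<lambda>i. ennreal (norm (v - w i))) \<longlonglongrightarrow> 0"
    using has_Bochner_int_norm_bound[OF M has_Bochner_int_diff[OF M f g]]
    by (intro tendsto_sandwich[OF _ _ tendsto_const lim]) auto
  then have "(\<lambda>i. ennreal (norm (v - w i))) \<longlonglongrightarrow> ennreal 0" by simp
  then have "(\<lambda>i. norm (v - w i)) \<longlonglongrightarrow> 0"
    by (subst (asm) tendsto_ennreal_iff) auto
  then have "(\<lambda>i. v - w i) \<longlonglongrightarrow> 0" by (rule tendsto_norm_zero_cancel)
  from tendsto_diff[OF tendsto_const[of v] this] show ?thesis by simp
qed

lemma has_Bochner_int_norm_finite:
  assumes M: "complete_measure M" and f: "has_Bochner_int M f v"
  shows "(\<integral>\<^sup>+x. ennreal (norm (f x)) \<partial>M) < \<infinity>"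
proof -
  obtain \<sigma> where s: "\<And>i::nat. Bochner_Integration.simple_bochner_integrable M (\<sigma> i)"
    "(\<lambda>i. \<integral>\<^sup>+x. ennreal (norm (f x - \<sigma> i x)) \<partial>M) \<longlonglongrightarrow> 0"
    using f by (rule has_Bochner_intD) blast
  obtain i where i: "(\<integral>\<^sup>+x. ennreal (norm (f x - \<sigma> i x)) \<partial>M) < \<infinity>"
    using order_tendstoD(2)[OF s(2), of \<infinity>] by (auto simp: eventually_sequentially)
  have z: "Bochner_Integration.simple_bochner_integrable M (\<lambda>x. 0::'b)"
    by (auto simp: Bochner_Integration.simple_bochner_integrable.simps)
  have n: "Bochner_Integration.simple_bochner_integrable M (\<lambda>x. norm (\<sigma> i x))"
    using Bochner_Integration.simple_bochner_integrable_compose2[of "\<lambda>x y. norm x", OF _ s(1) s(1)] by simp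
  have fin: "(\<integral>\<^sup>+x. ennreal (norm (\<sigma> i x)) \<partial>M) < \<infinity>"
    using Bochner_Integration.simple_bochner_integral_eq_nn_integral[OF n] by (metis ennreal_less_top infinity_ennreal_def norm_ge_zero)
  have [simp]: "norm (\<sigma> i x - f x) = norm (f x - \<sigma> i x)" for x by (rule norm_minus_commute)
  have "(\<integral>\<^sup>+x. ennreal (norm (f x)) \<partial>M) \<le>
      (\<integral>\<^sup>+x. ennreal (norm (f x - \<sigma> i x)) \<partial>M) + (\<integral>\<^sup>+x. ennreal (norm (\<sigma> i x)) \<partial>M)"
    using nn_integral_norm_triangle[OF M has_Bochner_int_measurable[OF f]
        strongly_measurable_simple_bochner[OF s(1)[of i]] strongly_measurable_simple_bochner[OF z]]
    by simp
  also have "\<dots> < \<infinity>" using fin i by simp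
  finally show ?thesis .
qed

text \<open>
  Bochner's criterion.  Cutting the simple functions off where they exceed \<open>2 * norm (f x)\<close> keeps
  their pointwise limit and makes them dominated by \<open>f\<close>.
\<close>

lemma Bochner_integrable_iff:
  fixes f :: "'b \<Rightarrow> 'a::banach"
  assumes M: "complete_measure M"
  shows "Bochner_integrable M f \<longleftrightarrow>
    strongly_measurable M f \<and> (\<integral>\<^sup>+x. ennreal (norm (f x)) \<partial>M) < \<infinity>"
proof
  assume "Bochner_integrable M f"
  then show "strongly_measurable M f \<and> (\<integral>\<^sup>+x. ennreal (norm (f x)) \<partial>M) < \<infinity>"
    unfolding Bochner_integrable_def
    using has_Bochner_int_measurable has_Bochner_int_norm_finite[OF M] by blast
next
  assume *: "strongly_measurable M f \<and> (\<integral>\<^sup>+x. ennreal (norm (f x)) \<partial>M) < \<infinity>"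
  then have fm: "strongly_measurable M f" and fin: "(\<integral>\<^sup>+x. ennreal (norm (f x)) \<partial>M) < \<infinity>"
    by auto
  obtain \<tau> where t: "\<And>i::nat. simple_function M (\<tau> i)" "AE x in M. (\<lambda>i. \<tau> i x) \<longlonglongrightarrow> f x"
    using fm by (rule strongly_measurableD_seq) blast
  have fn[measurable]: "(\<lambda>x. norm (f x)) \<in> borel_measurable M"
    using M fm by (rule strongly_measurable_norm)
  have tn[measurable]: "(\<lambda>x. norm (\<tau> i x)) \<in> borel_measurable M" for i
    using M strongly_measurable_simple[OF t(1)] by (rule strongly_measurable_norm)
  (* The factor 2 leaves room for convergence: where f x is nonzero the cut-off is eventually void. *)
  define A where "A i = {x \<in> space M. norm (\<tau> i x) \<le> 2 * norm (f x)}" for i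
  have A[measurable]: "A i \<in> sets M" for i unfolding A_def by measurable
  define \<sigma> where "\<sigma> i x = indicat_real (A i) x *\<^sub>R \<tau> i x" for i x
  have sf: "simple_function M (\<sigma> i)" for i
    unfolding \<sigma>_def by (intro simple_function_compose2[where h=scaleR] simple_function_indicator A t)
  have bd: "norm (\<sigma> i x) \<le> 2 * norm (f x)" for i x
    by (auto simp: \<sigma>_def A_def indicator_def)
  have fin2: "(\<integral>\<^sup>+x. ennreal (3 * norm (f x)) \<partial>M) < \<infinity>"
  proof -
    have "(\<integral>\<^sup>+x. ennreal (3 * norm (f x)) \<partial>M) = 3 * (\<integral>\<^sup>+x. ennreal (norm (f x)) \<partial>M)"
      by (subst nn_integral_cmult[symmetric]) (auto simp: ennreal_mult')
    then show ?thesis using fin by (simp add: ennreal_mult_less_top)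
  qed
  have sb: "Bochner_Integration.simple_bochner_integrable M (\<sigma> i)" for i
  proof (rule Bochner_Integration.simple_bochner_integrableI_bounded[OF sf])
    have "(\<integral>\<^sup>+x. ennreal (norm (\<sigma> i x)) \<partial>M) \<le> (\<integral>\<^sup>+x. ennreal (3 * norm (f x)) \<partial>M)"
      by (intro nn_integral_mono ennreal_leI order_trans[OF bd]) simp
    also note fin2
    finally show "(\<integral>\<^sup>+x. ennreal (norm (\<sigma> i x)) \<partial>M) < \<infinity>" .
  qed
  have lim: "AE x in M. (\<lambda>i. \<sigma> i x) \<longlonglongrightarrow> f x"
    using t(2) AE_space
  proof eventually_elim
    case (elim x)
    show ?case
    proof (cases "f x = 0")
      case True
      then show ?thesis using bd[of _ x] by simp
    next
      case False
      have "(\<lambda>i. norm (\<tau> i x)) \<longlonglongrightarrow> norm (f x)" using elim by (intro tendsto_norm)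
      then have "eventually (\<lambda>i. norm (\<tau> i x) < 2 * norm (f x)) sequentially"
        using False by (intro order_tendstoD(2)) auto
      then have "eventually (\<lambda>i. \<sigma> i x = \<tau> i x) sequentially"
        by eventually_elim (use elim in \<open>auto simp: \<sigma>_def A_def\<close>)
      then show ?thesis using elim(1) by (simp cong: tendsto_cong)
    qed
  qed
  have [measurable]: "(\<lambda>x. norm (f x - \<sigma> i x)) \<in> borel_measurable M" for i
    by (intro strongly_measurable_norm strongly_measurable_diff M fm strongly_measurable_simple_bochner sb)
  have c: "(\<lambda>i. \<integral>\<^sup>+x. ennreal (norm (f x - \<sigma> i x)) \<partial>M) \<longlonglongrightarrow> (\<integral>\<^sup>+x. 0 \<partial>M)"
  proof (rule nn_integral_dominated_convergence[where w="\<lambda>x. ennreal (3 * norm (f x))"])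
    show "AE x in M. ennreal (norm (f x - \<sigma> i x)) \<le> ennreal (3 * norm (f x))" for i
    proof (intro AE_I2 ennreal_leI)
      fix x
      show "norm (f x - \<sigma> i x) \<le> 3 * norm (f x)"
        using norm_triangle_ineq4[of "f x" "\<sigma> i x"] bd[of i x] by linarith
    qed
    show "AE x in M. (\<lambda>i. ennreal (norm (f x - \<sigma> i x))) \<longlonglongrightarrow> 0"
      using lim
    proof eventually_elim
      case (elim x)
      then have "(\<lambda>i. norm (f x - \<sigma> i x)) \<longlonglongrightarrow> norm (f x - f x)" by (intro tendsto_intros)
      then show ?case using tendsto_ennrealI by fastforce
    qed
  qed (use fin2 in auto)
  then have c: "(\<lambda>i. \<integral>\<^sup>+x. ennreal (norm (f x - \<sigma> i x)) \<partial>M) \<longlonglongrightarrow> 0" by simp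
  have "Cauchy (\<lambda>i. Bochner_Integration.simple_bochner_integral M (\<sigma> i))"
  proof (rule metric_CauchyI)
    fix e :: real assume e: "0 < e"
    then have "eventually (\<lambda>i. (\<integral>\<^sup>+x. ennreal (norm (f x - \<sigma> i x)) \<partial>M) < ennreal (e/2)) sequentially"
      using order_tendstoD(2)[OF c, of "ennreal (e/2)"] by simp
    then obtain N where N: "\<And>i. i \<ge> N \<Longrightarrow> (\<integral>\<^sup>+x. ennreal (norm (f x - \<sigma> i x)) \<partial>M) < ennreal (e/2)"
      by (auto simp: eventually_sequentially)
    show "\<exists>N. \<forall>i\<ge>N. \<forall>j\<ge>N. dist (Bochner_Integration.simple_bochner_integral M (\<sigma> i)) (Bochner_Integration.simple_bochner_integral M (\<sigma> j)) < e"
    proof (intro exI[of _ N] allI impI)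
      fix i j assume ij: "i \<ge> N" "j \<ge> N"
      have "ennreal (dist (Bochner_Integration.simple_bochner_integral M (\<sigma> i)) (Bochner_Integration.simple_bochner_integral M (\<sigma> j))) \<le>
          (\<integral>\<^sup>+x. ennreal (norm (f x - \<sigma> i x)) \<partial>M) + (\<integral>\<^sup>+x. ennreal (norm (f x - \<sigma> j x)) \<partial>M)"
        unfolding dist_norm
        by (rule order_trans[OF norm_diff_simple_integral_le[OF sb sb]])
           (intro nn_integral_norm_triangle M strongly_measurable_simple_bochner sb fm)
      also have "\<dots> < ennreal (e/2) + ennreal (e/2)"
        by (intro add_strict_mono N ij)
      also have "\<dots> = ennreal e" using e by (simp flip: ennreal_plus)
      finally show "dist (Bochner_Integration.simple_bochner_integral M (\<sigma> i)) (Bochner_Integration.simple_bochner_integral M (\<sigma> j)) < e"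
        using e by (simp add: ennreal_less_iff)
    qed
  qed
  then obtain v where "(\<lambda>i. Bochner_Integration.simple_bochner_integral M (\<sigma> i)) \<longlonglongrightarrow> v"
    using Cauchy_convergent convergent_def by blast
  then show "Bochner_integrable M f"
    unfolding Bochner_integrable_def using has_Bochner_intI[OF fm sb c] by blast
qed

lemma has_Bochner_int_restrict:
  fixes f :: "'b \<Rightarrow> 'a::real_normed_vector"
  assumes "A \<in> sets M" and f: "has_Bochner_int (restrict_space M A) f v"
  shows "has_Bochner_int M (\<lambda>x. indicat_real A x *\<^sub>R f x) v"
proof -
  have A: "A \<inter> space M \<in> sets M" using assms by auto
  obtain \<sigma> where s: "\<And>i::nat. Bochner_Integration.simple_bochner_integrable (restrict_space M A) (\<sigma> i)"
    "(\<lambda>i. \<integral>\<^sup>+x. ennreal (norm (f x - \<sigma> i x)) \<partial>restrict_space M A) \<longlonglongrightarrow> 0"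
    "(\<lambda>i. Bochner_Integration.simple_bochner_integral (restrict_space M A) (\<sigma> i)) \<longlonglongrightarrow> v"
    using f by (rule has_Bochner_intD) blast
  have "(\<integral>\<^sup>+x. ennreal (norm (f x - \<sigma> i x)) \<partial>restrict_space M A) =
      (\<integral>\<^sup>+x. ennreal (norm (indicat_real A x *\<^sub>R f x - indicat_real A x *\<^sub>R \<sigma> i x)) \<partial>M)" for i
    unfolding nn_integral_restrict_space[OF A]
    by (intro nn_integral_cong) (simp add: indicator_def)
  moreover have "Bochner_Integration.simple_bochner_integral (restrict_space M A) (\<sigma> i) =
      Bochner_Integration.simple_bochner_integral M (\<lambda>x. indicat_real A x *\<^sub>R \<sigma> i x)" for i
    by (rule Bochner_Integration.simple_bochner_integral_restrict_space[OF A s(1)])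
  ultimately show ?thesis
    using s has_Bochner_int_measurable[OF f]
    unfolding strongly_measurable_restrict_iff[OF assms(1)] Bochner_Integration.simple_bochner_integrable_restrict_space[OF A]
    by (intro has_Bochner_intI[of _ _ "\<lambda>i x. indicat_real A x *\<^sub>R \<sigma> i x"]) simp_all
qed

text \<open>
  Simple functions that approximate a positive function need not be positive themselves.  Replacing each
  of their values by a point of the cone at nearly minimal distance costs only a factor \<open>3\<close> in the
  distance to \<open>f\<close>, and integrals of positive simple functions lie in the cone.
\<close>

lemma has_Bochner_int_in_cone:
  fixes f :: "'b \<Rightarrow> 'a::{banach, ordered_real_vector}"
  assumes M: "complete_measure M" and cl: "closed {u::'a. 0 \<le> u}"
    and f: "has_Bochner_int M f v" and pos: "AE x in M. 0 \<le> f x"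
  shows "0 \<le> v"
proof -
  obtain \<sigma> where s: "\<And>i::nat. Bochner_Integration.simple_bochner_integrable M (\<sigma> i)"
    "(\<lambda>i. \<integral>\<^sup>+x. ennreal (norm (f x - \<sigma> i x)) \<partial>M) \<longlonglongrightarrow> 0"
    "(\<lambda>i. Bochner_Integration.simple_bochner_integral M (\<sigma> i)) \<longlonglongrightarrow> v"
    using f by (rule has_Bochner_intD) blast
  have "\<exists>z\<ge>0. norm (y - z) \<le> 2 * infdist y {u. 0 \<le> u}" for y :: 'a
  proof (cases "0 \<le> y")
    case True
    then show ?thesis by (intro exI[of _ y]) (auto simp: infdist_nonneg)
  next
    case False
    have ne: "{u::'a. 0 \<le> u} \<noteq> {}" by blast
    have "infdist y {u. 0 \<le> u} \<noteq> 0"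
      using False in_closed_iff_infdist_zero[OF cl ne, of y] by simp
    then have "infdist y {u. 0 \<le> u} < 2 * infdist y {u. 0 \<le> u}"
      using infdist_nonneg[of y "{u. 0 \<le> u}"] by linarith
    then obtain z where "z \<in> {u. 0 \<le> u}" "dist y z < 2 * infdist y {u. 0 \<le> u}"
      unfolding infdist_notempty[OF ne] using ne
      by (subst (asm) cINF_less_iff) (auto intro: bdd_belowI2[where m=0])
    then show ?thesis by (intro exI[of _ z]) (auto simp: dist_norm)
  qed
  then obtain \<pi> :: "'a \<Rightarrow> 'a" where p: "\<And>y. 0 \<le> \<pi> y" "\<And>y. norm (y - \<pi> y) \<le> 2 * infdist y {u. 0 \<le> u}"
    by metis
  have p0: "\<pi> 0 = 0"
    using p(2)[of 0] infdist_zero[of "0::'a" "{u. 0 \<le> u}"] by simp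
  have p3: "norm (x - \<pi> y) \<le> 3 * norm (x - y)" if "0 \<le> x" for x y :: 'a
  proof -
    have "infdist y {u. 0 \<le> u} \<le> dist y x" using that by (intro infdist_le) simp
    then have "norm (y - \<pi> y) \<le> 2 * norm (x - y)" using p(2)[of y] by (simp add: dist_norm norm_minus_commute)
    moreover have "norm (x - \<pi> y) \<le> norm (x - y) + norm (y - \<pi> y)"
      using norm_triangle_ineq[of "x - y" "y - \<pi> y"] by simp
    ultimately show ?thesis by linarith
  qed
  have sp: "Bochner_Integration.simple_bochner_integrable M (\<lambda>x. \<pi> (\<sigma> i x))" for i
    using Bochner_Integration.simple_bochner_integrable_compose2[of "\<lambda>x y. \<pi> x", OF p0 s(1) s(1)] .
  note fm = has_Bochner_int_measurable[OF f]
  have [measurable]: "(\<lambda>x. norm (f x - \<sigma> i x)) \<in> borel_measurable M" for i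
    by (intro strongly_measurable_norm strongly_measurable_diff M fm strongly_measurable_simple_bochner s)
  have "(\<lambda>i. \<integral>\<^sup>+x. ennreal (norm (f x - \<pi> (\<sigma> i x))) \<partial>M) \<longlonglongrightarrow> 0"
  proof (rule tendsto_sandwich[OF _ _ tendsto_const])
    show "\<forall>\<^sub>F i in sequentially. (\<integral>\<^sup>+x. ennreal (norm (f x - \<pi> (\<sigma> i x))) \<partial>M) \<le>
      3 * (\<integral>\<^sup>+x. ennreal (norm (f x - \<sigma> i x)) \<partial>M)"
    proof (intro always_eventually allI)
      fix i
      have "(\<integral>\<^sup>+x. ennreal (norm (f x - \<pi> (\<sigma> i x))) \<partial>M) \<le>
        (\<integral>\<^sup>+x. 3 * ennreal (norm (f x - \<sigma> i x)) \<partial>M)"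
      proof (rule nn_integral_mono_AE)
        show "AE x in M. ennreal (norm (f x - \<pi> (\<sigma> i x))) \<le> 3 * ennreal (norm (f x - \<sigma> i x))"
          using pos
        proof eventually_elim
          case (elim x)
          have "ennreal (norm (f x - \<pi> (\<sigma> i x))) \<le> ennreal (3 * norm (f x - \<sigma> i x))"
            by (rule ennreal_leI[OF p3[OF elim]])
          then show ?case by (simp add: ennreal_mult')
        qed
      qed
      also have "\<dots> = 3 * (\<integral>\<^sup>+x. ennreal (norm (f x - \<sigma> i x)) \<partial>M)"
        by (rule nn_integral_cmult) auto
      finally show "(\<integral>\<^sup>+x. ennreal (norm (f x - \<pi> (\<sigma> i x))) \<partial>M) \<le>
        3 * (\<integral>\<^sup>+x. ennreal (norm (f x - \<sigma> i x)) \<partial>M)" .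
    qed
    show "(\<lambda>i. 3 * (\<integral>\<^sup>+x. ennreal (norm (f x - \<sigma> i x)) \<partial>M)) \<longlonglongrightarrow> 0"
      using ennreal_tendsto_cmult[OF _ s(2), of 3] by simp
  qed auto
  from has_Bochner_int_limit[OF M f has_Bochner_int_simple[OF sp] this]
  have "(\<lambda>i. Bochner_Integration.simple_bochner_integral M (\<lambda>x. \<pi> (\<sigma> i x))) \<longlonglongrightarrow> v" .
  moreover have "0 \<le> Bochner_Integration.simple_bochner_integral M (\<lambda>x. \<pi> (\<sigma> i x))" for i
    unfolding Bochner_Integration.simple_bochner_integral_def
    by (intro sum_nonneg scaleR_nonneg_nonneg) (auto simp: p)
  ultimately show ?thesis
    using closed_sequentially[OF cl, of "\<lambda>i. Bochner_Integration.simple_bochner_integral M (\<lambda>x. \<pi> (\<sigma> i x))" v] by simp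
qed

section \<open>Banach spaces ordered by a closed generating cone\<close>

lemma closed_cone_sum:
  fixes u :: "nat \<Rightarrow> 'a::{banach, ordered_real_vector}"
  assumes "closed {u::'a. 0 \<le> u}" "summable u" "\<And>k. 0 \<le> u k"
  shows "0 \<le> suminf u"
  using closed_sequentially[OF assms(1), of "\<lambda>n. \<Sum>k<n. u k" "suminf u"]
    summable_LIMSEQ[OF assms(2)] by (simp add: sum_nonneg assms(3))

text \<open>
  The first half of the open mapping argument: the differences of bounded positive vectors exhaust the
  space, so by Baire's theorem one of these sets is dense in some ball, and a translation and a dilation
  give approximate decompositions of every vector with a relative error of one half.
\<close>

lemma generating_cone_approx:
  assumes gen: "generating_cone TYPE('a::{banach, ordered_real_vector})"
  shows "\<exists>K>0. \<forall>x::'a::{banach, ordered_real_vector}. \<exists>u v. 0 \<le> u \<and> 0 \<le> v \<and>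
    norm u \<le> K * norm x \<and> norm v \<le> K * norm x \<and> norm (x - (u - v)) \<le> norm x / 2"
proof -
  define A :: "nat \<Rightarrow> 'a set" where
    "A n = {u - v | u v. 0 \<le> u \<and> 0 \<le> v \<and> norm u \<le> real n \<and> norm v \<le> real n}" for n
  have un: "(\<Union>n. closure (A n)) = UNIV"
  proof -
    have "x \<in> (\<Union>n. closure (A n))" for x :: 'a
    proof -
      obtain u v :: 'a where uv: "0 \<le> u" "0 \<le> v" "x = u - v"
        using gen unfolding generating_cone_def by blast
      obtain n where "max (norm u) (norm v) \<le> real n" using real_arch_simple by blast
      then have "x \<in> A n" unfolding A_def using uv by auto
      then show ?thesis using closure_subset by blast
    qed
    then show ?thesis by blast
  qed
  have "\<exists>n. interior (closure (A n)) \<noteq> {}"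
  proof (rule ccontr)
    assume *: "\<not> ?thesis"
    have mc: "Met_TC.mcomplete TYPE('a)"
      by (simp add: complete_UNIV)
    have "Met_TC.mtopology interior_of \<Union>(range (\<lambda>n. closure (A n))) = {}"
      by (rule Met_TC.metric_Baire_category_alt[OF mc]) (use * in auto)
    then show False using un by simp
  qed
  then obtain n x0 where "x0 \<in> interior (closure (A n))" by auto
  then obtain r where r: "0 < r" "ball x0 r \<subseteq> closure (A n)"
    using mem_interior by metis
  have near: "\<exists>u v. 0 \<le> u \<and> 0 \<le> v \<and> norm u \<le> 2 * real n \<and> norm v \<le> 2 * real n \<and>
      norm (y - (u - v)) < e" if y: "norm y < r" and e: "0 < e" for y :: 'a and e :: real
  proof -
    have "x0 + y \<in> closure (A n)" "x0 \<in> closure (A n)" using r y by (auto simp: dist_norm)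
    then obtain a b where ab: "a \<in> A n" "dist a (x0 + y) < e/2" "b \<in> A n" "dist b x0 < e/2"
      unfolding closure_approachable using e by (meson half_gt_zero)
    obtain u v where uv: "0 \<le> u" "0 \<le> v" "norm u \<le> real n" "norm v \<le> real n" "a = u - v"
      using ab(1) unfolding A_def by auto
    obtain u' v' where uv': "0 \<le> u'" "0 \<le> v'" "norm u' \<le> real n" "norm v' \<le> real n" "b = u' - v'"
      using ab(3) unfolding A_def by auto
    have "norm (y - ((u + v') - (v + u'))) = norm ((b - x0) - (a - (x0 + y)))"
      by (simp add: uv(5) uv'(5) algebra_simps)
    also have "\<dots> \<le> norm (b - x0) + norm (a - (x0 + y))" by (rule norm_triangle_ineq4)
    also have "\<dots> < e" using ab by (simp add: dist_norm)
    finally have "norm (y - ((u + v') - (v + u'))) < e" .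
    moreover have "norm (u + v') \<le> 2 * real n" "norm (v + u') \<le> 2 * real n"
      using norm_triangle_ineq[of u v'] norm_triangle_ineq[of v u'] uv uv' by linarith+
    ultimately show ?thesis using uv uv' by (metis add_nonneg_nonneg)
  qed
  define K where "K = 4 * real n / r + 1"
  have K: "0 < K" using r by (simp add: K_def add_nonneg_pos)
  moreover have "\<exists>u v. 0 \<le> u \<and> 0 \<le> v \<and> norm u \<le> K * norm x \<and> norm v \<le> K * norm x \<and>
      norm (x - (u - v)) \<le> norm x / 2" for x :: 'a
  proof (cases "x = 0")
    case True
    then show ?thesis by (intro exI[of _ 0]) auto
  next
    case False
    then have nx: "0 < norm x" by simp
    \<comment> \<open>the dilation that brings \<open>x\<close> into the ball of radius \<open>r\<close>, where approximations are available\<close>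
    define c where "c = 2 * norm x / r"
    have c: "0 < c" using nx r by (simp add: c_def)
    have "norm ((1/c) *\<^sub>R x) < r" using nx r by (simp add: c_def)
    moreover have "0 < norm x / (2 * c)" using nx c by simp
    ultimately obtain u v where uv: "0 \<le> u" "0 \<le> v" "norm u \<le> 2 * real n" "norm v \<le> 2 * real n"
      "norm ((1/c) *\<^sub>R x - (u - v)) < norm x / (2 * c)" using near by blast
    have "norm (x - (c *\<^sub>R u - c *\<^sub>R v)) = norm (c *\<^sub>R ((1/c) *\<^sub>R x - (u - v)))"
      using c by (simp add: scaleR_diff_right)
    also have "\<dots> = c * norm ((1/c) *\<^sub>R x - (u - v))" using c by simp
    also have "\<dots> \<le> c * (norm x / (2 * c))" using uv(5) c by (intro mult_left_mono) auto
    also have "\<dots> = norm x / 2" using c by simp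
    finally have 1: "norm (x - (c *\<^sub>R u - c *\<^sub>R v)) \<le> norm x / 2" .
    have 2: "c * (2 * real n) \<le> K * norm x"
      unfolding c_def K_def using nx by (simp add: field_simps)
    have 3: "norm (c *\<^sub>R u) \<le> K * norm x" "norm (c *\<^sub>R v) \<le> K * norm x"
      using order_trans[OF mult_left_mono[OF uv(3), of c] 2] order_trans[OF mult_left_mono[OF uv(4), of c] 2] c
      by simp_all
    moreover have "0 \<le> c *\<^sub>R u" "0 \<le> c *\<^sub>R v"
      using uv(1,2) c scaleR_nonneg_nonneg[of c u] scaleR_nonneg_nonneg[of c v] by simp_all
    ultimately show ?thesis using 1 by (intro exI[of _ "c *\<^sub>R u"] exI[of _ "c *\<^sub>R v"] conjI)
  qed
  ultimately show ?thesis by (intro exI[of _ K] conjI allI)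
qed

text \<open>
  The theorem of Klee and Ando.  Iterating the approximate decomposition on the remainders gives two
  geometrically convergent series, whose sums are positive because the cone is closed.
\<close>

lemma generating_cone_bounded_decomposition:
  assumes cl: "closed {u::'a::{banach, ordered_real_vector}. 0 \<le> u}"
    and gen: "generating_cone TYPE('a)"
  shows "\<exists>K>0. \<forall>x::'a::{banach, ordered_real_vector}. \<exists>u v. 0 \<le> u \<and> 0 \<le> v \<and> x = u - v \<and>
    norm u \<le> K * norm x \<and> norm v \<le> K * norm x"
proof -
  obtain K where K: "0 < K" "\<forall>x::'a. \<exists>u v. 0 \<le> u \<and> 0 \<le> v \<and> norm u \<le> K * norm x \<and>
      norm v \<le> K * norm x \<and> norm (x - (u - v)) \<le> norm x / 2"
    using generating_cone_approx[OF gen] by (elim exE conjE)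
  from choice[OF K(2)] obtain p :: "'a \<Rightarrow> 'a" where "\<forall>x::'a. \<exists>v. 0 \<le> p x \<and> 0 \<le> v \<and> norm (p x) \<le> K * norm x \<and>
      norm v \<le> K * norm x \<and> norm (x - (p x - v)) \<le> norm x / 2"
    by (elim exE)
  from choice[OF this] obtain q :: "'a \<Rightarrow> 'a" where "\<forall>x::'a. 0 \<le> p x \<and> 0 \<le> q x \<and>
      norm (p x) \<le> K * norm x \<and> norm (q x) \<le> K * norm x \<and> norm (x - (p x - q x)) \<le> norm x / 2"
    by (elim exE)
  then have pq: "0 \<le> p x" "0 \<le> q x" "norm (p x) \<le> K * norm x" "norm (q x) \<le> K * norm x"
      "norm (x - (p x - q x)) \<le> norm x / 2" for x
    by blast+
  have "\<exists>u v. 0 \<le> u \<and> 0 \<le> v \<and> x = u - v \<and> norm u \<le> (2 * K) * norm x \<and> norm v \<le> (2 * K) * norm x"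
    for x :: 'a
  proof -
    define y where "y k = ((\<lambda>z. z - (p z - q z)) ^^ k) x" for k
    have y0: "y 0 = x" and yS: "y (Suc k) = y k - (p (y k) - q (y k))" for k
      by (simp_all add: y_def)
    have ny: "norm (y k) \<le> norm x * (1/2)^k" for k
    proof (induction k)
      case (Suc k)
      have "norm (y (Suc k)) \<le> norm (y k) / 2" unfolding yS by (rule pq(5))
      then show ?case using Suc by simp
    qed (simp add: y0)
    have geo: "(\<lambda>k. (K * norm x) * (1/2)^k) sums ((K * norm x) * 2)"
      using geometric_sums[of "1/2::real"] by (intro sums_mult) simp
    have np: "norm (p (y k)) \<le> (K * norm x) * (1/2)^k" "norm (q (y k)) \<le> (K * norm x) * (1/2)^k" for k
      using order_trans[OF pq(3) mult_left_mono[OF ny[of k], of K]]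
        order_trans[OF pq(4) mult_left_mono[OF ny[of k], of K]] K(1) by (simp_all add: mult.assoc)
    have sp: "summable (\<lambda>k. norm (p (y k)))" "summable (\<lambda>k. norm (q (y k)))"
      by (rule summable_comparison_test'[OF sums_summable[OF geo], of 0], simp add: np)+
    note sp' = sp[THEN summable_norm_cancel]
    have "norm (\<Sum>k. p (y k)) \<le> (\<Sum>k. norm (p (y k)))" "norm (\<Sum>k. q (y k)) \<le> (\<Sum>k. norm (q (y k)))"
      using sp by (simp_all add: summable_norm)
    moreover have "(\<Sum>k. norm (p (y k))) \<le> (K * norm x) * 2" "(\<Sum>k. norm (q (y k))) \<le> (K * norm x) * 2"
      using suminf_le[OF np(1) sp(1) sums_summable[OF geo]]
        suminf_le[OF np(2) sp(2) sums_summable[OF geo]] sums_unique[OF geo] by simp_all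
    ultimately have b: "norm (\<Sum>k. p (y k)) \<le> (2 * K) * norm x" "norm (\<Sum>k. q (y k)) \<le> (2 * K) * norm x"
      by (simp_all add: algebra_simps)
    have y_lim: "y \<longlonglongrightarrow> 0"
    proof (rule Lim_null_comparison)
      show "\<forall>\<^sub>F k in sequentially. norm (y k) \<le> norm x * (1/2)^k" using ny by simp
      show "(\<lambda>k. norm x * (1/2)^k) \<longlonglongrightarrow> 0"
        by (intro tendsto_mult_right_zero LIMSEQ_power_zero) simp
    qed
    have "(\<Sum>k<m. p (y k) - q (y k)) = x - y m" for m
      by (induction m) (simp_all add: y0 yS)
    then have "(\<lambda>k. p (y k) - q (y k)) sums x"
      unfolding sums_def using tendsto_diff[OF tendsto_const[of x] y_lim] by simp
    then have "x = (\<Sum>k. p (y k)) - (\<Sum>k. q (y k))"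
      using suminf_diff[OF sp'] by (simp add: sums_iff)
    moreover have "0 \<le> (\<Sum>k. p (y k))" "0 \<le> (\<Sum>k. q (y k))"
      by (intro closed_cone_sum[OF cl] sp' pq)+
    ultimately show ?thesis using b by blast
  qed
  then show ?thesis using K(1) by (intro exI[of _ "2 * K"]) simp
qed

text \<open>
  Additivity of the norm on the cone makes \<open>norm u - norm v\<close> depend on \<open>u - v\<close> only.  The resulting
  functional turns norms of integrals of positive functions into integrals of norms.
\<close>

lemma cone_norm_functional:
  assumes gen: "generating_cone TYPE('a::{banach, ordered_real_vector})"
    and add: "\<And>u v::'a::{banach, ordered_real_vector}. 0 \<le> u \<Longrightarrow> 0 \<le> v \<Longrightarrow> norm (u + v) = norm u + norm v"
  obtains \<phi> :: "'a::{banach, ordered_real_vector} \<Rightarrow> real" where "bounded_linear \<phi>" "\<And>u. 0 \<le> u \<Longrightarrow> \<phi> u = norm u"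
proof -
  obtain p q :: "'a \<Rightarrow> 'a" where pq: "\<And>x. 0 \<le> p x" "\<And>x. 0 \<le> q x" "\<And>x. x = p x - q x"
    using gen unfolding generating_cone_def by metis
  define \<phi> where "\<phi> x = norm (p x) - norm (q x)" for x
  have eq: "\<phi> (u - v) = norm u - norm v" if "0 \<le> u" "0 \<le> v" for u v
  proof -
    have "p (u - v) + v = u + q (u - v)" using pq(3)[of "u - v"] by (simp add: algebra_simps)
    then have "norm (p (u - v)) + norm v = norm u + norm (q (u - v))"
      using add pq that by metis
    then show ?thesis by (simp add: \<phi>_def)
  qed
  have "bounded_linear \<phi>"
  proof (rule bounded_linear_intro[where K=1])
    fix x y :: 'a and c :: real
    have "\<phi> (x + y) = \<phi> ((p x + p y) - (q x + q y))"
      using pq(3)[of x] pq(3)[of y] by (metis add_diff_add)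
    also have "\<dots> = \<phi> x + \<phi> y"
      by (subst eq) (auto simp: pq add \<phi>_def)
    finally show "\<phi> (x + y) = \<phi> x + \<phi> y" .
    show "\<phi> (c *\<^sub>R x) = c *\<^sub>R \<phi> x"
    proof (cases "0 \<le> c")
      case True
      have "\<phi> (c *\<^sub>R x) = \<phi> (c *\<^sub>R p x - c *\<^sub>R q x)"
        using pq(3)[of x] by (metis scaleR_diff_right)
      also have "\<dots> = c *\<^sub>R \<phi> x"
        using True by (subst eq) (auto simp: pq \<phi>_def scaleR_nonneg_nonneg algebra_simps)
      finally show ?thesis .
    next
      case False
      have "c *\<^sub>R x = (- c) *\<^sub>R q x - (- c) *\<^sub>R p x"
        by (subst pq(3)[of x]) (simp add: algebra_simps)
      then have "\<phi> (c *\<^sub>R x) = \<phi> ((- c) *\<^sub>R q x - (- c) *\<^sub>R p x)" by simp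
      also have "\<dots> = c *\<^sub>R \<phi> x"
        using False by (subst eq) (auto simp: pq \<phi>_def algebra_simps intro!: scaleR_nonneg_nonneg scaleR_nonpos_nonneg)
      finally show ?thesis .
    qed
    show "norm (\<phi> x) \<le> norm x * 1"
      using norm_triangle_ineq3[of "p x" "q x"] pq(3)[of x] by (simp add: \<phi>_def)
  qed
  moreover have "\<phi> u = norm u" if "0 \<le> u" for u
    using eq[OF that order_refl] by simp
  ultimately show thesis by (rule that)
qed

section \<open>Integration over intervals and dyadic partitions\<close>

text \<open>
  For a simple \<open>g\<close> the function is a finite sum of restrictions of the maps \<open>\<lambda>r. P r x\<close>; the general
  case follows by continuity of each \<open>P r\<close>.
\<close>

lemma strongly_measurable_operator_family:
  fixes P :: "'b \<Rightarrow> 'a::real_normed_vector \<Rightarrow> 'c::real_normed_vector"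
  assumes fin: "finite_measure M" and M: "complete_measure M"
    and lin: "\<And>r. r \<in> space M \<Longrightarrow> bounded_linear (P r)"
    and meas: "\<And>x. strongly_measurable M (\<lambda>r. P r x)"
    and g: "strongly_measurable M g"
  shows "strongly_measurable M (\<lambda>r. P r (g r))"
proof -
  obtain \<sigma> where s: "\<And>i::nat. simple_function M (\<sigma> i)" "AE r in M. (\<lambda>i. \<sigma> i r) \<longlonglongrightarrow> g r"
    using g by (rule strongly_measurableD_seq) blast
  have 1: "strongly_measurable M (\<lambda>r. P r (\<sigma> i r))" for i
  proof -
    have fin: "finite (\<sigma> i ` space M)" using s(1) by (rule simple_functionD)
    have "strongly_measurable M
        (\<lambda>r. \<Sum>y\<in>\<sigma> i ` space M. indicat_real (\<sigma> i -` {y} \<inter> space M) r *\<^sub>R P r y)"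
      by (intro strongly_measurable_sum strongly_measurable_indicator meas fin simple_functionD(2)[OF s(1)])
    then show ?thesis
    proof (rule strongly_measurable_cong_AE)
      show "AE r in M. (\<Sum>y\<in>\<sigma> i ` space M. indicat_real (\<sigma> i -` {y} \<inter> space M) r *\<^sub>R P r y) = P r (\<sigma> i r)"
      proof (rule AE_I2)
        fix r assume r: "r \<in> space M"
        have "(\<Sum>y\<in>\<sigma> i ` space M. indicat_real (\<sigma> i -` {y} \<inter> space M) r *\<^sub>R P r y) =
            (\<Sum>y\<in>\<sigma> i ` space M. if y = \<sigma> i r then P r (\<sigma> i r) else 0)"
          using r by (intro sum.cong) (auto simp: indicator_def)
        also have "\<dots> = P r (\<sigma> i r)" using r fin by (simp add: sum.delta)
        finally show "(\<Sum>y\<in>\<sigma> i ` space M. indicat_real (\<sigma> i -` {y} \<inter> space M) r *\<^sub>R P r y) = P r (\<sigma> i r)" .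
      qed
    qed
  qed
  show ?thesis
  proof (rule strongly_measurable_lim[OF fin M 1])
    show "AE r in M. (\<lambda>i. P r (\<sigma> i r)) \<longlonglongrightarrow> P r (g r)"
      using s(2) AE_space
      by eventually_elim (intro bounded_linear.tendsto[OF lin])
  qed
qed

lemma complete_measure_lebesgue_on:
  fixes S :: "'a::euclidean_space set"
  assumes "S \<in> sets lebesgue"
  shows "complete_measure (lebesgue_on S)"
proof
  fix A B :: "'a set" assume BA: "B \<subseteq> A" and "A \<in> null_sets (lebesgue_on S)"
  then have "A \<subseteq> S" "A \<in> null_sets lebesgue"
    using null_sets_restrict_space[OF assms] by auto
  then have "B \<in> null_sets lebesgue" "B \<subseteq> S"
    using BA null_sets_completion_subset by blast+
  then show "B \<in> sets (lebesgue_on S)"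
    by (auto simp: sets_restrict_space_iff assms)
qed

lemma complete_interval: "complete_measure (lebesgue_on {a..b::real})"
  by (rule complete_measure_lebesgue_on) simp

lemma finite_interval: "finite_measure (lebesgue_on {a..b::real})"
  by (rule finite_measure_lebesgue_on) (metis cbox_interval lmeasurable_cbox)

lemma AE_interval_iff: "(AE x in lebesgue_on {a..b::real}. P x) \<longleftrightarrow> (AE x in lebesgue. x \<in> {a..b} \<longrightarrow> P x)"
  by (rule AE_restrict_space_iff) simp

lemma AE_lebesgue_neq: "AE x in lebesgue. x \<noteq> (c::real)"
  using AE_lborel_singleton[of c] by (rule AE_completion)

lemma AE_interval_neq: "AE x in lebesgue_on {a..b}. x \<noteq> (c::real)"
  using AE_lebesgue_neq[of c] unfolding AE_interval_iff by eventually_elim simp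

lemma AE_interval_subset:
  assumes "AE x in lebesgue_on S. P x" "{a..b::real} \<subseteq> S" "S \<in> sets lebesgue"
  shows "AE x in lebesgue_on {a..b}. P x"
proof -
  have "AE x in lebesgue. x \<in> S \<longrightarrow> P x"
    using assms(1) by (subst (asm) AE_restrict_space_iff) (use assms in auto)
  then show ?thesis unfolding AE_interval_iff by eventually_elim (use assms in auto)
qed

lemma strongly_measurable_interval_subset:
  assumes "strongly_measurable (lebesgue_on S) f" "{a..b::real} \<subseteq> S" "S \<in> sets lebesgue"
  shows "strongly_measurable (lebesgue_on {a..b}) f"
proof -
  have "strongly_measurable lebesgue (\<lambda>x. indicat_real {a..b} x *\<^sub>R (indicat_real S x *\<^sub>R f x))"
    using assms(1) unfolding strongly_measurable_restrict_iff[OF assms(3)]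
    by (rule strongly_measurable_indicator) simp
  moreover have "indicat_real {a..b} x *\<^sub>R (indicat_real S x *\<^sub>R f x) = indicat_real {a..b} x *\<^sub>R f x" for x
    using assms(2) by (auto simp: indicator_def)
  ultimately show ?thesis
    by (subst strongly_measurable_restrict_iff) (simp, simp only:)
qed

lemma indicator_interval_split:
  fixes f :: "real \<Rightarrow> 'a::real_vector"
  assumes "a \<le> b" "b \<le> c"
  shows "AE x in lebesgue. indicat_real {a..b} x *\<^sub>R f x + indicat_real {b..c} x *\<^sub>R f x =
    indicat_real {a..c} x *\<^sub>R f x"
  using AE_lebesgue_neq[of b] by eventually_elim (use assms in \<open>auto simp: indicator_def\<close>)

lemma strongly_measurable_combine:
  assumes "a \<le> b" "b \<le> (c::real)" "strongly_measurable (lebesgue_on {a..b}) f"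
    "strongly_measurable (lebesgue_on {b..c}) f"
  shows "strongly_measurable (lebesgue_on {a..c}) f"
proof -
  have *: "{x..y::real} \<in> sets lebesgue" for x y by simp
  have "strongly_measurable lebesgue (\<lambda>x. indicat_real {a..b} x *\<^sub>R f x + indicat_real {b..c} x *\<^sub>R f x)"
    using assms(3,4) unfolding strongly_measurable_restrict_iff[OF *]
    by (rule strongly_measurable_add)
  then show ?thesis
    unfolding strongly_measurable_restrict_iff[OF *]
    by (rule strongly_measurable_cong_AE[OF _ indicator_interval_split[OF assms(1,2)]])
qed

lemma nn_integral_interval_combine:
  fixes f :: "real \<Rightarrow> ennreal"
  assumes "a \<le> b" "b \<le> c" and f: "f \<in> borel_measurable (lebesgue_on {a..c})"
  shows "(\<integral>\<^sup>+x. f x \<partial>lebesgue_on {a..c}) =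
    (\<integral>\<^sup>+x. f x \<partial>lebesgue_on {a..b}) + (\<integral>\<^sup>+x. f x \<partial>lebesgue_on {b..c})"
proof -
  have *: "{x..y::real} \<inter> space lebesgue \<in> sets lebesgue" for x y by simp
  have f': "(\<lambda>x. f x * indicator {a..c} x) \<in> borel_measurable lebesgue"
    using f by (simp add: borel_measurable_restrict_space_iff_ennreal)
  have m: "(\<lambda>x. f x * indicator {p..q} x) \<in> borel_measurable lebesgue" if "a \<le> p" "q \<le> c" for p q
  proof -
    have "(\<lambda>x. f x * indicator {a..c} x * indicator {p..q} x) \<in> borel_measurable lebesgue"
      by (rule borel_measurable_times_ennreal[OF f' borel_measurable_indicator]) simp
    moreover have "f x * indicator {a..c} x * indicator {p..q} x = f x * indicator {p..q} x" for x
      using that by (auto simp: indicator_def)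
    ultimately show ?thesis by simp
  qed
  have "(\<integral>\<^sup>+x. f x * indicator {a..c} x \<partial>lebesgue) =
      (\<integral>\<^sup>+x. f x * indicator {a..b} x + f x * indicator {b..c} x \<partial>lebesgue)"
    by (rule nn_integral_cong_AE, use AE_lebesgue_neq[of b] in eventually_elim)
       (use assms in \<open>auto simp: indicator_def\<close>)
  also have "\<dots> = (\<integral>\<^sup>+x. f x * indicator {a..b} x \<partial>lebesgue) + (\<integral>\<^sup>+x. f x * indicator {b..c} x \<partial>lebesgue)"
    using assms by (intro nn_integral_add m) auto
  finally show ?thesis by (simp add: nn_integral_restrict_space[OF *])
qed

text \<open>
  Both pieces are extended by \<open>0\<close> to the whole line, where they can be added; the common end point is a
  null set.
\<close>

lemma has_Bochner_int_combine:
  fixes f :: "real \<Rightarrow> 'a::banach"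
  assumes "a \<le> b" "b \<le> c" and f: "has_Bochner_int (lebesgue_on {a..b}) f v"
    and g: "has_Bochner_int (lebesgue_on {b..c}) f w"
  shows "has_Bochner_int (lebesgue_on {a..c}) f (v + w)"
proof -
  have *: "{x..y::real} \<in> sets lebesgue" for x y by simp
  have L: "complete_measure (lebesgue :: real measure)"
    by (rule completion.complete_measure_axioms)
  have fm: "strongly_measurable (lebesgue_on {a..c}) f"
    by (rule strongly_measurable_combine[OF assms(1,2) has_Bochner_int_measurable[OF f]
        has_Bochner_int_measurable[OF g]])
  have "(\<integral>\<^sup>+x. ennreal (norm (f x)) \<partial>lebesgue_on {a..c}) < \<infinity>"
    using nn_integral_interval_combine[OF assms(1,2), of "\<lambda>x. ennreal (norm (f x))"]
      strongly_measurable_norm[OF complete_interval fm]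
      has_Bochner_int_norm_finite[OF complete_interval f] has_Bochner_int_norm_finite[OF complete_interval g]
    by simp
  then obtain z where z: "has_Bochner_int (lebesgue_on {a..c}) f z"
    using fm Bochner_integrable_iff[OF complete_interval, where f=f] unfolding Bochner_integrable_def by blast
  have "has_Bochner_int lebesgue (\<lambda>x. indicat_real {a..c} x *\<^sub>R f x) (v + w)"
    by (rule has_Bochner_int_cong_AE[OF has_Bochner_int_add[OF L
      has_Bochner_int_restrict[OF * f] has_Bochner_int_restrict[OF * g]] indicator_interval_split[OF assms(1,2)]])
  then have "z = v + w"
    using has_Bochner_int_unique[OF L] has_Bochner_int_restrict[OF * z] by blast
  then show ?thesis using z by simp
qed

lemma has_Bochner_int_point: "has_Bochner_int (lebesgue_on {a..a::real}) f (0::'a::banach)"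
proof -
  have "AE x in lebesgue_on {a..a}. 0 = f x"
    using AE_interval_neq[of a a a] AE_space by eventually_elim simp
  then show ?thesis using has_Bochner_int_zero has_Bochner_int_cong_AE by blast
qed

lemma Bochner_integrable_subinterval:
  fixes f :: "real \<Rightarrow> 'a::banach"
  assumes f: "Bochner_integrable (lebesgue_on {a..d}) f" and "a \<le> b" "c \<le> d"
  shows "Bochner_integrable (lebesgue_on {b..c}) f"
  unfolding Bochner_integrable_iff[OF complete_interval]
proof
  have f': "strongly_measurable (lebesgue_on {a..d}) f" "(\<integral>\<^sup>+x. ennreal (norm (f x)) \<partial>lebesgue_on {a..d}) < \<infinity>"
    using f unfolding Bochner_integrable_iff[OF complete_interval] by auto
  show "strongly_measurable (lebesgue_on {b..c}) f"
    using f'(1) by (rule strongly_measurable_interval_subset) (use assms in auto)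
  have "(\<integral>\<^sup>+x. ennreal (norm (f x)) \<partial>lebesgue_on {b..c}) \<le> (\<integral>\<^sup>+x. ennreal (norm (f x)) \<partial>lebesgue_on {a..d})"
    by (subst (1 2) nn_integral_restrict_space)
       (auto intro!: nn_integral_mono simp: indicator_def assms order_trans[OF assms(2)] order_trans[OF _ assms(3)])
  then show "(\<integral>\<^sup>+x. ennreal (norm (f x)) \<partial>lebesgue_on {b..c}) < \<infinity>" using f'(2) by simp
qed

definition dyadic_floor :: "real \<Rightarrow> nat \<Rightarrow> real \<Rightarrow> real" where
  "dyadic_floor s m \<tau> = s + of_int \<lfloor>(\<tau> - s) * 2^m\<rfloor> / 2^m"

lemma dyadic_floor_le: "dyadic_floor s m \<tau> \<le> \<tau>"
proof -
  have "of_int \<lfloor>(\<tau> - s) * 2^m\<rfloor> \<le> (\<tau> - s) * 2^m" by (rule of_int_floor_le)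
  then show ?thesis by (simp add: dyadic_floor_def field_simps)
qed

lemma dyadic_floor_gt: "\<tau> < dyadic_floor s m \<tau> + 1/2^m"
proof -
  have "(\<tau> - s) * 2^m < of_int \<lfloor>(\<tau> - s) * 2^m\<rfloor> + 1" by linarith
  then show ?thesis by (simp add: dyadic_floor_def field_simps)
qed

lemma dyadic_floor_ge: "s \<le> \<tau> \<Longrightarrow> s \<le> dyadic_floor s m \<tau>"
  by (simp add: dyadic_floor_def)

lemma dyadic_floor_mono: "dyadic_floor s m \<tau> \<le> dyadic_floor s (Suc m) \<tau>"
proof -
  have "2 * \<lfloor>(\<tau> - s) * 2^m\<rfloor> \<le> \<lfloor>(\<tau> - s) * 2^Suc m\<rfloor>"
    by (simp add: le_floor_iff)
  then have "2 * (of_int \<lfloor>(\<tau> - s) * 2^m\<rfloor> :: real) \<le> of_int \<lfloor>(\<tau> - s) * 2^Suc m\<rfloor>"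
    by linarith
  then show ?thesis by (simp add: dyadic_floor_def field_simps)
qed

lemma dyadic_floor_eq:
  assumes "s + real k / 2^m \<le> \<tau>" "\<tau> < s + real (Suc k) / 2^m"
  shows "dyadic_floor s m \<tau> = s + real k / 2^m"
proof -
  have "\<lfloor>(\<tau> - s) * 2^m\<rfloor> = int k"
    using assms by (intro floor_unique) (auto simp: field_simps)
  then show ?thesis by (simp add: dyadic_floor_def)
qed

lemma dyadic_floor_tendsto: "(\<lambda>m. dyadic_floor s m \<tau>) \<longlonglongrightarrow> \<tau>"
proof (rule tendsto_sandwich)
  show "\<forall>\<^sub>F m in sequentially. \<tau> - (1/2)^m \<le> dyadic_floor s m \<tau>"
    using dyadic_floor_gt[of \<tau> s] by (auto intro!: always_eventually less_imp_le simp: power_divide diff_less_eq)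
  show "\<forall>\<^sub>F m in sequentially. dyadic_floor s m \<tau> \<le> \<tau>"
    using dyadic_floor_le by auto
  have "(\<lambda>m. \<tau> - (1/2)^m) \<longlonglongrightarrow> \<tau> - 0"
    by (intro tendsto_intros LIMSEQ_power_zero) simp
  then show "(\<lambda>m. \<tau> - (1/2)^m) \<longlonglongrightarrow> \<tau>" by simp
qed simp

lemma clipped_dyadic_grid:
  assumes "s \<le> t"
  defines "q \<equiv> \<lambda>m k. min t (s + real k / 2^m)"
  shows "s \<le> q m k" "q m k \<le> q m (Suc k)" "q m k \<le> t" "q m 0 = s"
proof -
  have *: "s \<le> min t (s + x)" "min t (s + x) \<le> min t (s + y)" if "0 \<le> x" "x \<le> y" for x y
    using assms(1) that by (auto simp: min_def)
  show "s \<le> q m k" "q m k \<le> q m (Suc k)"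
    unfolding q_def using *[of "real k / 2^m" "real (Suc k) / 2^m"]
    by (simp_all add: divide_right_mono)
  show "q m k \<le> t" "q m 0 = s" using assms(1) by (simp_all add: q_def)
qed


section \<open>Perturbed evolution families\<close>

text \<open>
  Absolute continuity of the integral, for intervals that shrink to their right end point.
\<close>

lemma nn_integral_shrinking_interval:
  fixes f :: "real \<Rightarrow> ennreal"
  assumes f: "f \<in> borel_measurable (lebesgue_on {s..t})" and fin: "(\<integral>\<^sup>+x. f x \<partial>lebesgue_on {s..t}) < \<infinity>"
    and a: "\<And>m. s \<le> a m" "\<And>m::nat. a m \<le> \<tau>" "a \<longlonglongrightarrow> \<tau>" and t: "\<tau> \<le> t"
  shows "(\<lambda>m. \<integral>\<^sup>+x. f x \<partial>lebesgue_on {a m..\<tau>}) \<longlonglongrightarrow> 0"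
proof -
  have eq: "(\<integral>\<^sup>+x. f x \<partial>lebesgue_on {a m..\<tau>}) = (\<integral>\<^sup>+x. f x * indicator {a m..\<tau>} x \<partial>lebesgue_on {s..t})" for m
    by (subst (1 2) nn_integral_restrict_space)
       (auto intro!: nn_integral_cong simp: indicator_def order_trans[OF a(1)] order_trans[OF _ t])
  have [measurable]: "{a m..\<tau>} \<inter> {s..t} \<in> sets (lebesgue_on {s..t})" for m
    by (subst sets_restrict_space_iff) auto
  have ind: "(\<lambda>x. indicator {a m..\<tau>} x :: ennreal) \<in> borel_measurable (lebesgue_on {s..t})" for m
    by (rule measurable_restrict_space1) (rule borel_measurable_indicator, simp)
  have "(\<lambda>m. \<integral>\<^sup>+x. f x * indicator {a m..\<tau>} x \<partial>lebesgue_on {s..t}) \<longlonglongrightarrow> (\<integral>\<^sup>+x. 0 \<partial>lebesgue_on {s..t})"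
  proof (rule nn_integral_dominated_convergence[where w=f])
    show "(\<lambda>x. f x * indicator {a m..\<tau>} x) \<in> borel_measurable (lebesgue_on {s..t})" for m
      by (rule borel_measurable_times_ennreal[OF f ind])
    show "AE x in lebesgue_on {s..t}. f x * indicator {a m..\<tau>} x \<le> f x" for m
      by (auto simp: indicator_def)
    show "AE x in lebesgue_on {s..t}. (\<lambda>m. f x * indicator {a m..\<tau>} x) \<longlonglongrightarrow> 0"
      using AE_interval_neq[where c=\<tau>]
    proof eventually_elim
      case (elim x)
      have "eventually (\<lambda>m. f x * indicator {a m..\<tau>} x = 0) sequentially"
      proof (cases "x < \<tau>")
        case True
        then have "eventually (\<lambda>m. x < a m) sequentially" using order_tendstoD(1)[OF a(3)] by blast
        then show ?thesis by eventually_elim simp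
      next
        case False
        then show ?thesis using elim by simp
      qed
      then show ?case by (rule tendsto_eventually)
    qed
  qed (simp, rule f, rule fin)
  then show ?thesis unfolding eq by simp
qed

text \<open>
  An evolution family \<open>U\<close> of positive contractions together with positive, increasingly closed
  operators \<open>B t\<close> whose action along \<open>U\<close> is paid for by the norm that \<open>U\<close> loses.
\<close>

locale perturbed_evolution =
  fixes U :: "real \<Rightarrow> real \<Rightarrow> 'a \<Rightarrow> 'a::{banach, ordered_real_vector}"
    and B :: "real \<Rightarrow> 'a \<Rightarrow> 'a"
    and D :: "real \<Rightarrow> 'a set"
  assumes cone_closed: "closed {u::'a. 0 \<le> u}"
    and cone_generating: "generating_cone TYPE('a)"
    and norm_additive: "\<And>u v::'a. 0 \<le> u \<Longrightarrow> 0 \<le> v \<Longrightarrow> norm (u + v) = norm u + norm v"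
    and evol: "evolution_family U"
    and B_linear: "\<And>t. 0 \<le> t \<Longrightarrow> linear_operator_on (D t) (B t)"
    and U_nonneg: "\<And>t s u. 0 \<le> s \<Longrightarrow> s \<le> t \<Longrightarrow> 0 \<le> u \<Longrightarrow> 0 \<le> U t s u"
    and U_contractive: "\<And>t s u. 0 \<le> s \<Longrightarrow> s \<le> t \<Longrightarrow> 0 \<le> u \<Longrightarrow> norm (U t s u) \<le> norm u"
    and B_nonneg: "\<And>t u. 0 \<le> t \<Longrightarrow> u \<in> D t \<Longrightarrow> 0 \<le> u \<Longrightarrow> 0 \<le> B t u"
    and U_dom: "\<And>s u. 0 \<le> s \<Longrightarrow> AE t in lebesgue_on {s..}. U t s u \<in> D t"
    and BU_meas: "\<And>s u. 0 \<le> s \<Longrightarrow> strongly_measurable (lebesgue_on {s..}) (\<lambda>t. B t (U t s u))"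
    and BU_bound: "\<And>t s u. 0 \<le> s \<Longrightarrow> s \<le> t \<Longrightarrow> 0 \<le> u \<Longrightarrow>
        (\<integral>\<^sup>+\<tau>. ennreal (norm (B \<tau> (U \<tau> s u))) \<partial>lebesgue_on {s..t})
          \<le> ennreal (norm u - norm (U t s u))"
    and B_closed: "\<And>t. 0 \<le> t \<Longrightarrow> increasingly_closed (D t) (B t)"
begin

lemma U_bounded_linear: "0 \<le> s \<Longrightarrow> s \<le> t \<Longrightarrow> bounded_linear (U t s)"
  using evol unfolding evolution_family_def by blast

lemma U_cocycle: "0 \<le> s \<Longrightarrow> s \<le> r \<Longrightarrow> r \<le> t \<Longrightarrow> U t r (U r s u) = U t s u"
  using evol unfolding evolution_family_def by metis

lemma U_same: "0 \<le> t \<Longrightarrow> U t t u = u"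
  using evol unfolding evolution_family_def by blast

lemma D_subspace: "0 \<le> t \<Longrightarrow> subspace (D t)"
  using B_linear unfolding linear_operator_on_def by blast

lemma B_add: "0 \<le> t \<Longrightarrow> u \<in> D t \<Longrightarrow> v \<in> D t \<Longrightarrow> B t (u + v) = B t u + B t v"
  using B_linear unfolding linear_operator_on_def by blast

lemma B_scaleR: "0 \<le> t \<Longrightarrow> u \<in> D t \<Longrightarrow> B t (c *\<^sub>R u) = c *\<^sub>R B t u"
  using B_linear unfolding linear_operator_on_def by blast

lemma B_diff: "0 \<le> t \<Longrightarrow> u \<in> D t \<Longrightarrow> v \<in> D t \<Longrightarrow> B t (u - v) = B t u - B t v"
  using B_add[of t "u - v" v] subspace_diff[OF D_subspace] by (simp add: algebra_simps)

lemma B_sum: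
  assumes "0 \<le> t" "finite I" "\<And>i. i \<in> I \<Longrightarrow> x i \<in> D t"
  shows "B t (\<Sum>i\<in>I. x i) = (\<Sum>i\<in>I. B t (x i))"
  using assms(2,3)
proof (induction I rule: finite_induct)
  case empty
  show ?case using B_scaleR[OF assms(1) subspace_0[OF D_subspace[OF assms(1)]], of 0] by simp
next
  case (insert j I)
  then show ?case using B_add[OF assms(1), of "x j" "sum x I"] subspace_sum[OF D_subspace[OF assms(1)], of I x]
    by simp
qed

lemma ex_bound_of_positive_contraction:
  "\<exists>K>0. \<forall>P::'a \<Rightarrow> 'a. linear P \<longrightarrow> (\<forall>u\<ge>0. norm (P u) \<le> norm u) \<longrightarrow> (\<forall>x. norm (P x) \<le> K * norm x)"
proof -
  obtain K where K: "0 < K" "\<forall>x::'a. \<exists>u v. 0 \<le> u \<and> 0 \<le> v \<and> x = u - v \<and>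
    norm u \<le> K * norm x \<and> norm v \<le> K * norm x"
    using generating_cone_bounded_decomposition[OF cone_closed cone_generating] by (elim exE conjE)
  have "norm (P x) \<le> (2 * K) * norm x" if P: "linear P" "\<And>u. 0 \<le> u \<Longrightarrow> norm (P u) \<le> norm u" for P :: "'a \<Rightarrow> 'a" and x
  proof -
    obtain u v where uv: "0 \<le> u" "0 \<le> v" "x = u - v" "norm u \<le> K * norm x" "norm v \<le> K * norm x"
      using K(2) by blast
    have "norm (P x) \<le> norm (P u) + norm (P v)"
      unfolding uv(3) linear_diff[OF P(1)] by (rule norm_triangle_ineq4)
    then show ?thesis using P(2)[OF uv(1)] P(2)[OF uv(2)] uv(4,5) by linarith
  qed
  then show ?thesis using K(1) by (intro exI[of _ "2 * K"]) simp
qed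

text \<open>
  A norm bound common to all linear operators that are contractions on the cone.
\<close>

definition cone_bound :: real where
  "cone_bound = (SOME K. 0 < K \<and> (\<forall>P::'a \<Rightarrow> 'a. linear P \<longrightarrow> (\<forall>u\<ge>0. norm (P u) \<le> norm u) \<longrightarrow>
    (\<forall>x. norm (P x) \<le> K * norm x)))"

lemma cone_bound_pos: "0 < cone_bound"
  using someI_ex[OF ex_bound_of_positive_contraction, folded cone_bound_def] by (rule conjunct1)

lemma positive_contraction_bound:
  fixes P :: "'a \<Rightarrow> 'a"
  assumes "linear P" "\<And>u. 0 \<le> u \<Longrightarrow> norm (P u) \<le> norm u"
  shows "norm (P x) \<le> cone_bound * norm x"
proof -
  have "linear P \<longrightarrow> (\<forall>u\<ge>0. norm (P u) \<le> norm u) \<longrightarrow> (\<forall>x. norm (P x) \<le> cone_bound * norm x)"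
    using conjunct2[OF someI_ex[OF ex_bound_of_positive_contraction, folded cone_bound_def]] by (rule spec)
  then show ?thesis using assms by simp
qed

lemma positive_contraction_bounded_linear:
  fixes P :: "'a \<Rightarrow> 'a"
  assumes "linear P" "\<And>u. 0 \<le> u \<Longrightarrow> norm (P u) \<le> norm u"
  shows "bounded_linear P"
  using assms(1) unfolding bounded_linear_def bounded_linear_axioms_def
  by (intro conjI exI[of _ cone_bound] allI)
     (use positive_contraction_bound[OF assms] in \<open>simp_all add: mult.commute\<close>)

lemma norm_U_le: "0 \<le> s \<Longrightarrow> s \<le> t \<Longrightarrow> norm (U t s x) \<le> cone_bound * norm x"
  by (rule positive_contraction_bound)
     (auto intro: U_contractive bounded_linear.linear[OF U_bounded_linear])

lemma norm_integral_nonneg: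
  fixes f :: "'b \<Rightarrow> 'a"
  assumes M: "complete_measure M" and f: "has_Bochner_int M f v" and pos: "AE x in M. 0 \<le> f x"
  shows "ennreal (norm v) = (\<integral>\<^sup>+x. ennreal (norm (f x)) \<partial>M)"
proof -
  obtain \<phi> :: "'a \<Rightarrow> real" where p: "bounded_linear \<phi>" "\<And>u. 0 \<le> u \<Longrightarrow> \<phi> u = norm u"
    using cone_norm_functional[OF cone_generating norm_additive] by blast
  have v: "0 \<le> v" by (rule has_Bochner_int_in_cone[OF M cone_closed f pos])
  have h: "has_bochner_integral M (\<lambda>x. \<phi> (f x)) (\<phi> v)"
    using has_Bochner_int_linear[OF M p(1) f] has_Bochner_int_iff[OF M] by blast
  have ae: "AE x in M. \<phi> (f x) = norm (f x)" using pos by eventually_elim (rule p(2))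
  have "(\<integral>\<^sup>+x. ennreal (norm (f x)) \<partial>M) = (\<integral>\<^sup>+x. ennreal (\<phi> (f x)) \<partial>M)"
    by (rule nn_integral_cong_AE) (use ae in eventually_elim, simp)
  also have "\<dots> = ennreal (integral\<^sup>L M (\<lambda>x. \<phi> (f x)))"
  proof (rule nn_integral_eq_integral)
    show "integrable M (\<lambda>x. \<phi> (f x))" using h by (rule integrable.intros)
    show "AE x in M. 0 \<le> \<phi> (f x)" using ae by eventually_elim simp
  qed
  also have "\<dots> = ennreal (norm v)"
    using has_bochner_integral_integral_eq[OF h] p(2)[OF v] by simp
  finally show ?thesis by simp
qed

text \<open>
  The arguments are clamped to \<open>0 \<le> s \<le> t\<close> so that \<open>U\<close> becomes continuous in all of the plane.
\<close>

lemma U_meas: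
  assumes "0 \<le> a" and h: "h \<in> borel_measurable (lebesgue_on {a..b})" "\<And>r. r \<in> {a..b} \<Longrightarrow> r \<le> h r"
  shows "strongly_measurable (lebesgue_on {a..b}) (\<lambda>r. U (h r) r x)"
proof -
  define c where "c z = (case (max (max (snd z) 0) (fst z), max (snd z) 0) of (t, s) \<Rightarrow> U t s x)" for z :: "real \<times> real"
  have "continuous_on UNIV c"
    unfolding c_def
  proof (rule continuous_on_compose2[of "{(t, s). 0 \<le> s \<and> s \<le> t}" "\<lambda>(t, s). U t s x"])
    show "continuous_on {(t, s). 0 \<le> s \<and> s \<le> t} (\<lambda>(t, s). U t s x)"
      using evol unfolding evolution_family_def by blast
    show "continuous_on UNIV (\<lambda>z::real \<times> real. (max (max (snd z) 0) (fst z), max (snd z) 0))"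
      by (intro continuous_intros)
  qed auto
  moreover have "(\<lambda>r. (h r, r)) \<in> borel_measurable (lebesgue_on {a..b})"
  proof (rule borel_measurable_Pair[OF h(1)])
    show "(\<lambda>r. r) \<in> borel_measurable (lebesgue_on {a..b})"
      by (rule measurable_restrict_space1) (rule measurable_completion, simp)
  qed
  ultimately have "strongly_measurable (lebesgue_on {a..b}) (\<lambda>r. c (h r, r))"
    by (rule strongly_measurable_borel_comp[rotated])
  then show ?thesis
  proof (rule strongly_measurable_cong_AE, intro AE_I2)
    fix r assume "r \<in> space (lebesgue_on {a..b})"
    then have "max r 0 = r" "max r (h r) = h r" using h(2)[of r] assms(1) by auto
    then show "c (h r, r) = U (h r) r x" by (simp add: c_def)
  qed
qed

lemma U_op_meas:
  assumes "0 \<le> a" and h: "h \<in> borel_measurable (lebesgue_on {a..b})" "\<And>r. r \<in> {a..b} \<Longrightarrow> r \<le> h r"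
    and g: "strongly_measurable (lebesgue_on {a..b}) g"
  shows "strongly_measurable (lebesgue_on {a..b}) (\<lambda>r. U (h r) r (g r))"
proof (rule strongly_measurable_operator_family[OF finite_interval complete_interval _ _ g])
  show "bounded_linear (U (h r) r)" if "r \<in> space (lebesgue_on {a..b})" for r
    using that assms(1) h(2)[of r] by (intro U_bounded_linear) auto
  show "strongly_measurable (lebesgue_on {a..b}) (\<lambda>r. U (h r) r x)" for x
    by (rule U_meas[OF assms(1) h])
qed

lemma U_op_integrable:
  assumes "0 \<le> a" "b \<le> t" and g: "Bochner_integrable (lebesgue_on {a..b}) g"
  shows "Bochner_integrable (lebesgue_on {a..b}) (\<lambda>r. U t r (g r))"
  unfolding Bochner_integrable_iff[OF complete_interval]
proof
  have g': "strongly_measurable (lebesgue_on {a..b}) g" "(\<integral>\<^sup>+x. ennreal (norm (g x)) \<partial>lebesgue_on {a..b}) < \<infinity>"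
    using g unfolding Bochner_integrable_iff[OF complete_interval] by auto
  show "strongly_measurable (lebesgue_on {a..b}) (\<lambda>r. U t r (g r))"
    by (rule U_op_meas[OF assms(1) _ _ g'(1)]) (use assms in auto)
  have gm: "(\<lambda>x. ennreal (norm (g x))) \<in> borel_measurable (lebesgue_on {a..b})"
    using strongly_measurable_norm[OF complete_interval g'(1)] by simp
  have "(\<integral>\<^sup>+x. ennreal (norm (U t x (g x))) \<partial>lebesgue_on {a..b}) \<le>
      (\<integral>\<^sup>+x. ennreal cone_bound * ennreal (norm (g x)) \<partial>lebesgue_on {a..b})"
    using assms cone_bound_pos
    by (intro nn_integral_mono) (auto intro!: ennreal_leI norm_U_le simp flip: ennreal_mult)
  also have "\<dots> = ennreal cone_bound * (\<integral>\<^sup>+x. ennreal (norm (g x)) \<partial>lebesgue_on {a..b})"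
    by (rule nn_integral_cmult[OF gm])
  also have "\<dots> < \<infinity>" using g'(2) by (simp add: ennreal_mult_less_top)
  finally show "(\<integral>\<^sup>+x. ennreal (norm (U t x (g x))) \<partial>lebesgue_on {a..b}) < \<infinity>" .
qed

definition duhamel :: "(real \<Rightarrow> 'a) \<Rightarrow> real \<Rightarrow> real \<Rightarrow> 'a" where
  "duhamel g s t = Bochner_int (lebesgue_on {s..t}) (\<lambda>r. U t r (g r))"

lemma has_int_duhamel:
  assumes "0 \<le> s" "Bochner_integrable (lebesgue_on {s..t}) g"
  shows "has_Bochner_int (lebesgue_on {s..t}) (\<lambda>r. U t r (g r)) (duhamel g s t)"
  unfolding duhamel_def
  by (intro has_Bochner_int_Bochner_int complete_interval U_op_integrable assms order_refl)

lemma U_duhamel: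
  assumes "0 \<le> s" "s \<le> a" "a \<le> b" and g: "Bochner_integrable (lebesgue_on {s..a}) g"
  shows "has_Bochner_int (lebesgue_on {s..a}) (\<lambda>r. U b r (g r)) (U b a (duhamel g s a))"
proof (rule has_Bochner_int_cong_AE)
  show "has_Bochner_int (lebesgue_on {s..a}) (\<lambda>r. U b a (U a r (g r))) (U b a (duhamel g s a))"
    by (rule has_Bochner_int_linear[OF complete_interval U_bounded_linear has_int_duhamel[OF _ g]])
       (use assms in auto)
  show "AE r in lebesgue_on {s..a}. U b a (U a r (g r)) = U b r (g r)"
    by (rule AE_I2, rule U_cocycle) (use assms in auto)
qed

lemma duhamel_split:
  assumes "0 \<le> s" "s \<le> a" "a \<le> b" and g: "Bochner_integrable (lebesgue_on {s..b}) g"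
  shows "duhamel g s b = U b a (duhamel g s a) + duhamel g a b"
proof -
  have "Bochner_integrable (lebesgue_on {s..a}) g" "Bochner_integrable (lebesgue_on {a..b}) g"
    by (rule Bochner_integrable_subinterval[OF g]; use assms in simp)+
  then have "has_Bochner_int (lebesgue_on {s..b}) (\<lambda>r. U b r (g r)) (U b a (duhamel g s a) + duhamel g a b)"
    by (intro has_Bochner_int_combine[OF assms(2,3) U_duhamel has_int_duhamel]) (use assms in auto)
  then show ?thesis
    using has_Bochner_int_unique[OF complete_interval] has_int_duhamel[OF assms(1) g] by blast
qed

lemma duhamel_same: "duhamel g a a = 0"
  unfolding duhamel_def using Bochner_int_eq[OF complete_interval has_Bochner_int_point] .

lemma duhamel_nonneg:
  assumes "0 \<le> s" and g: "Bochner_integrable (lebesgue_on {s..t}) g"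
    and pos: "AE r in lebesgue_on {s..t}. 0 \<le> g r"
  shows "0 \<le> duhamel g s t"
proof (rule has_Bochner_int_in_cone[OF complete_interval cone_closed has_int_duhamel[OF assms(1) g]])
  show "AE r in lebesgue_on {s..t}. 0 \<le> U t r (g r)"
    using pos AE_space by eventually_elim (use assms(1) in \<open>auto intro: U_nonneg\<close>)
qed

lemma norm_duhamel:
  assumes "0 \<le> s" and g: "Bochner_integrable (lebesgue_on {s..t}) g"
    and pos: "AE r in lebesgue_on {s..t}. 0 \<le> g r"
  shows "ennreal (norm (duhamel g s t)) = (\<integral>\<^sup>+r. ennreal (norm (U t r (g r))) \<partial>lebesgue_on {s..t})"
proof (rule norm_integral_nonneg[OF complete_interval has_int_duhamel[OF assms(1) g]])
  show "AE r in lebesgue_on {s..t}. 0 \<le> U t r (g r)"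
    using pos AE_space by eventually_elim (use assms(1) in \<open>auto intro: U_nonneg\<close>)
qed

lemma norm_duhamel_le:
  assumes "0 \<le> s" and g: "Bochner_integrable (lebesgue_on {s..t}) g"
    and pos: "AE r in lebesgue_on {s..t}. 0 \<le> g r"
  shows "ennreal (norm (duhamel g s t)) \<le> (\<integral>\<^sup>+r. ennreal (norm (g r)) \<partial>lebesgue_on {s..t})"
  unfolding norm_duhamel[OF assms]
proof (rule nn_integral_mono_AE)
  show "AE r in lebesgue_on {s..t}. ennreal (norm (U t r (g r))) \<le> ennreal (norm (g r))"
    using pos AE_space by eventually_elim (use assms(1) in \<open>auto intro!: U_contractive ennreal_leI\<close>)
qed

end

section \<open>The perturbation applied to Duhamel integrals\<close>

context perturbed_evolution
begin

lemma norm_add_mono: "0 \<le> u \<Longrightarrow> 0 \<le> v \<Longrightarrow> norm u \<le> norm (u + v :: 'a)"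
  using norm_additive[of u v] by simp

lemma U_dom_ae: "0 \<le> p \<Longrightarrow> AE \<tau> in lebesgue. p \<le> \<tau> \<longrightarrow> U \<tau> p x \<in> D \<tau>"
  using U_dom[of p x] by (subst (asm) AE_restrict_space_iff) auto

text \<open>
  The term for one cell of the step approximation used below, in a form that can be summed over the
  cells.
\<close>

lemma BU_meas_Ico:
  assumes "0 \<le> p"
  shows "strongly_measurable (lebesgue_on {s..t}) (\<lambda>\<tau>. indicat_real {p..<q} \<tau> *\<^sub>R B \<tau> (U \<tau> p x))"
proof -
  have "strongly_measurable lebesgue (\<lambda>\<tau>. indicat_real {p..} \<tau> *\<^sub>R B \<tau> (U \<tau> p x))"
    using BU_meas[OF assms, of x] by (subst (asm) strongly_measurable_restrict_iff) auto
  then have "strongly_measurable lebesgue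
      (\<lambda>\<tau>. indicat_real ({p..<q} \<inter> {s..t}) \<tau> *\<^sub>R (indicat_real {p..} \<tau> *\<^sub>R B \<tau> (U \<tau> p x)))"
    by (rule strongly_measurable_indicator) auto
  moreover have "indicat_real ({p..<q} \<inter> {s..t}) \<tau> *\<^sub>R (indicat_real {p..} \<tau> *\<^sub>R B \<tau> (U \<tau> p x)) =
      indicat_real {s..t} \<tau> *\<^sub>R (indicat_real {p..<q} \<tau> *\<^sub>R B \<tau> (U \<tau> p x))" for \<tau>
    by (auto simp: indicator_def)
  ultimately show ?thesis
    by (subst strongly_measurable_restrict_iff) (simp, simp only:)
qed

lemma BU_bound_add:
  assumes "0 \<le> s" "s \<le> t" "0 \<le> u"
  shows "(\<integral>\<^sup>+\<tau>. ennreal (norm (B \<tau> (U \<tau> s u))) \<partial>lebesgue_on {s..t}) + ennreal (norm (U t s u)) \<le> ennreal (norm u)"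
proof -
  have "(\<integral>\<^sup>+\<tau>. ennreal (norm (B \<tau> (U \<tau> s u))) \<partial>lebesgue_on {s..t}) + ennreal (norm (U t s u)) \<le>
      ennreal (norm u - norm (U t s u)) + ennreal (norm (U t s u))"
    by (rule add_right_mono[OF BU_bound[OF assms]])
  also have "\<dots> = ennreal (norm u)"
    using U_contractive[OF assms] by (simp flip: ennreal_plus)
  finally show ?thesis .
qed

end

text \<open>
  A positive integrable inhomogeneity on \<open>[s, t]\<close>.  The aim is to apply \<open>B\<close> to the Duhamel integral that
  it generates.
\<close>

locale positive_forcing = perturbed_evolution +
  fixes s t :: real and g :: "real \<Rightarrow> 'a"
  assumes s: "0 \<le> s" "s \<le> t" and g: "Bochner_integrable (lebesgue_on {s..t}) g"
    and g_nonneg: "AE r in lebesgue_on {s..t}. 0 \<le> g r"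
begin

lemma g_sub: "s \<le> a \<Longrightarrow> b \<le> t \<Longrightarrow> Bochner_integrable (lebesgue_on {a..b}) g"
  by (rule Bochner_integrable_subinterval[OF g])

lemma g_nonneg_sub: "s \<le> a \<Longrightarrow> b \<le> t \<Longrightarrow> AE r in lebesgue_on {a..b}. 0 \<le> g r"
  using g_nonneg by (rule AE_interval_subset) auto

lemma g_norm_meas: "(\<lambda>r. ennreal (norm (g r))) \<in> borel_measurable (lebesgue_on {s..t})"
  using strongly_measurable_norm[OF complete_interval, where f=g] g
  unfolding Bochner_integrable_iff[OF complete_interval] by simp

lemma g_norm_finite: "(\<integral>\<^sup>+r. ennreal (norm (g r)) \<partial>lebesgue_on {s..t}) < \<infinity>"
  using g unfolding Bochner_integrable_iff[OF complete_interval] by simp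

abbreviation J :: "real \<Rightarrow> 'a" where "J \<equiv> duhamel g s"

lemma J_nonneg: "a \<le> t \<Longrightarrow> 0 \<le> J a"
  by (intro duhamel_nonneg s(1) g_sub g_nonneg_sub order_refl)

text \<open>
  The Duhamel integral in which the forcing is switched off after the last dyadic point before \<open>\<tau>\<close>.
  On each dyadic cell it is a single orbit of \<open>U\<close>, so that all the assumptions on \<open>B \<tau> (U \<tau> p x)\<close> apply.
\<close>

definition frozen :: "nat \<Rightarrow> real \<Rightarrow> 'a" where
  "frozen m \<tau> = U \<tau> (dyadic_floor s m \<tau>) (J (dyadic_floor s m \<tau>))"

lemma U_J_split:
  assumes "s \<le> a" "a \<le> b" "b \<le> \<tau>" "\<tau> \<le> t"
  shows "U \<tau> b (J b) = U \<tau> a (J a) + U \<tau> b (duhamel g a b)"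
proof -
  have "J b = U b a (J a) + duhamel g a b"
    using assms s by (intro duhamel_split g_sub) auto
  moreover have "bounded_linear (U \<tau> b)" using assms s by (intro U_bounded_linear) auto
  ultimately show ?thesis
    using assms s by (simp add: linear_add[OF bounded_linear.linear] U_cocycle)
qed

lemma U_J_mono:
  assumes "s \<le> a" "a \<le> b" "b \<le> \<tau>" "\<tau> \<le> t"
  shows "0 \<le> U \<tau> b (J b) - U \<tau> a (J a)"
proof -
  have "0 \<le> duhamel g a b"
    using assms s by (intro duhamel_nonneg g_sub g_nonneg_sub) auto
  then have "0 \<le> U \<tau> b (duhamel g a b)" using assms s by (intro U_nonneg) auto
  then show ?thesis unfolding U_J_split[OF assms] by simp
qed

lemma frozen_incseq: "\<tau> \<in> {s..t} \<Longrightarrow> incseq (\<lambda>m. frozen m \<tau>)"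
  unfolding frozen_def
  by (rule incseq_SucI)
     (use U_J_mono[OF dyadic_floor_ge dyadic_floor_mono dyadic_floor_le, of \<tau> m for m] in simp)

lemma frozen_nonneg: "\<tau> \<in> {s..t} \<Longrightarrow> 0 \<le> frozen m \<tau>"
  unfolding frozen_def
  by (intro U_nonneg J_nonneg)
     (use s dyadic_floor_ge[of s \<tau> m] dyadic_floor_le[of s m \<tau>] in auto)

text \<open>
  The forcing that is left out lives on an interval that shrinks to a point.
\<close>

lemma frozen_tendsto:
  assumes \<tau>: "\<tau> \<in> {s..t}"
  shows "(\<lambda>m. frozen m \<tau>) \<longlonglongrightarrow> J \<tau>"
proof -
  let ?l = "\<lambda>m. dyadic_floor s m \<tau>"
  have l: "s \<le> ?l m" "?l m \<le> \<tau>" for m using \<tau> dyadic_floor_ge dyadic_floor_le by auto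
  have eq: "J \<tau> - frozen m \<tau> = duhamel g (?l m) \<tau>" for m
    using duhamel_split[OF s(1) l g_sub, of m] \<tau> by (simp add: frozen_def)
  have "(\<lambda>m. ennreal (norm (J \<tau> - frozen m \<tau>))) \<longlonglongrightarrow> 0"
  proof (rule tendsto_sandwich[OF _ _ tendsto_const])
    show "\<forall>\<^sub>F m in sequentially. ennreal (norm (J \<tau> - frozen m \<tau>)) \<le> (\<integral>\<^sup>+r. ennreal (norm (g r)) \<partial>lebesgue_on {?l m..\<tau>})"
      unfolding eq using l s \<tau>
      by (intro always_eventually allI norm_duhamel_le g_sub g_nonneg_sub) (auto intro: order_trans[OF s(1)])
    show "(\<lambda>m. \<integral>\<^sup>+r. ennreal (norm (g r)) \<partial>lebesgue_on {?l m..\<tau>}) \<longlonglongrightarrow> 0"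
      by (rule nn_integral_shrinking_interval[OF g_norm_meas g_norm_finite l dyadic_floor_tendsto])
         (use \<tau> in auto)
  qed auto
  then have "(\<lambda>m. ennreal (norm (J \<tau> - frozen m \<tau>))) \<longlonglongrightarrow> ennreal 0" by simp
  then have "(\<lambda>m. norm (J \<tau> - frozen m \<tau>)) \<longlonglongrightarrow> 0" by (subst (asm) tendsto_ennreal_iff) auto
  then have "(\<lambda>m. J \<tau> - frozen m \<tau>) \<longlonglongrightarrow> 0" by (rule tendsto_norm_zero_cancel)
  from tendsto_diff[OF tendsto_const[of "J \<tau>"] this] show ?thesis by simp
qed

lemma dyadic_floor_grid:
  assumes "s \<le> \<tau>" obtains k where "dyadic_floor s m \<tau> = s + real k / 2^m"
proof
  have "0 \<le> \<lfloor>(\<tau> - s) * 2^m\<rfloor>" using assms by simp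
  then show "dyadic_floor s m \<tau> = s + real (nat \<lfloor>(\<tau> - s) * 2^m\<rfloor>) / 2^m"
    by (simp add: dyadic_floor_def)
qed

lemma frozen_dom: "AE \<tau> in lebesgue_on {s..t}. \<forall>m. frozen m \<tau> \<in> D \<tau>"
proof -
  have "AE \<tau> in lebesgue. \<forall>m k. s + real k / 2^m \<le> \<tau> \<longrightarrow> U \<tau> (s + real k / 2^m) (J (s + real k / 2^m)) \<in> D \<tau>"
    unfolding AE_all_countable using s by (intro allI U_dom_ae) simp
  then show ?thesis unfolding AE_interval_iff
  proof eventually_elim
    case (elim \<tau>)
    show ?case
    proof (intro impI allI)
      fix m assume \<tau>: "\<tau> \<in> {s..t}"
      then obtain k where k: "dyadic_floor s m \<tau> = s + real k / 2^m"
        using dyadic_floor_grid by auto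
      then have "s + real k / 2^m \<le> \<tau>" using dyadic_floor_le[of s m \<tau>] by simp
      then show "frozen m \<tau> \<in> D \<tau>" unfolding frozen_def k using elim by blast
    qed
  qed
qed

lemma B_frozen_meas: "strongly_measurable (lebesgue_on {s..t}) (\<lambda>\<tau>. B \<tau> (frozen m \<tau>))"
proof -
  define p where "p k = s + real k / 2^m" for k
  have p: "0 \<le> p k" for k using s by (simp add: p_def)
  \<comment> \<open>enough cells to cover \<open>[s, t]\<close>\<close>
  obtain N where N: "(t - s) * 2^m < real N" using reals_Archimedean2 by blast
  have "strongly_measurable (lebesgue_on {s..t})
      (\<lambda>\<tau>. \<Sum>k<N. indicat_real {p k..<p (Suc k)} \<tau> *\<^sub>R B \<tau> (U \<tau> (p k) (J (p k))))"
    by (intro strongly_measurable_sum BU_meas_Ico p) simp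
  then show ?thesis
  proof (rule strongly_measurable_cong_AE, intro AE_I2)
    fix \<tau> assume "\<tau> \<in> space (lebesgue_on {s..t})"
    then have \<tau>: "s \<le> \<tau>" "\<tau> \<le> t" by auto
    obtain k where k: "dyadic_floor s m \<tau> = p k"
      using dyadic_floor_grid[OF \<tau>(1)] p_def by metis
    have ind: "\<tau> \<in> {p j..<p (Suc j)} \<longleftrightarrow> j = k" for j
    proof
      assume "\<tau> \<in> {p j..<p (Suc j)}"
      then have "dyadic_floor s m \<tau> = p j" using dyadic_floor_eq[of s j m \<tau>] by (simp add: p_def)
      then show "j = k" using k by (simp add: p_def)
    next
      assume "j = k"
      then show "\<tau> \<in> {p j..<p (Suc j)}"
        using dyadic_floor_le[of s m \<tau>] dyadic_floor_gt[of \<tau> s m] k by (simp add: p_def add_divide_distrib)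
    qed
    have "real k / 2^m \<le> t - s" using dyadic_floor_le[of s m \<tau>] k \<tau> by (simp add: p_def)
    then have "real k < real N" using N by (simp add: field_simps)
    then have kN: "k < N" by simp
    have "(\<Sum>j<N. indicat_real {p j..<p (Suc j)} \<tau> *\<^sub>R B \<tau> (U \<tau> (p j) (J (p j)))) =
        (\<Sum>j<N. if j = k then B \<tau> (U \<tau> (p k) (J (p k))) else 0)"
      using ind by (intro sum.cong) (auto simp: indicator_def)
    also have "\<dots> = B \<tau> (frozen m \<tau>)" using kN by (simp add: frozen_def k sum.delta)
    finally show "(\<Sum>j<N. indicat_real {p j..<p (Suc j)} \<tau> *\<^sub>R B \<tau> (U \<tau> (p j) (J (p j)))) = B \<tau> (frozen m \<tau>)" .
  qed
qed

lemma B_frozen_norm_meas: "(\<lambda>\<tau>. ennreal (norm (B \<tau> (frozen m \<tau>)))) \<in> borel_measurable (lebesgue_on {s..t})"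
  using strongly_measurable_norm[OF complete_interval B_frozen_meas] by simp

lemma borel_measurable_subinterval:
  fixes f :: "real \<Rightarrow> ennreal"
  assumes "f \<in> borel_measurable (lebesgue_on {s..t})" "s \<le> a" "b \<le> t"
  shows "f \<in> borel_measurable (lebesgue_on {a..b})"
  using measurable_restrict_mono[OF assms(1), of "{a..b}"] assms(2,3) by auto

text \<open>
  On the cell from \<open>q m k\<close> to \<open>q m (Suc k)\<close> the function \<open>B \<tau> (frozen m \<tau>)\<close> is paid for by the norm that
  \<open>U\<close> takes away from \<open>J (q m k)\<close>, while the forcing adds at most its own mass to \<open>J\<close>.  With \<open>J\<close> kept on
  the left-hand side, the induction over the cells telescopes.
\<close>

lemma B_frozen_bound_grid:
  defines "q \<equiv> \<lambda>m k. min t (s + real k / 2^m)"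
  shows "(\<integral>\<^sup>+\<tau>. ennreal (norm (B \<tau> (frozen m \<tau>))) \<partial>lebesgue_on {s..q m k}) + ennreal (norm (J (q m k))) \<le>
    (\<integral>\<^sup>+r. ennreal (norm (g r)) \<partial>lebesgue_on {s..q m k})"
proof (induction k)
  case 0
  have "(\<integral>\<^sup>+\<tau>. ennreal (norm (B \<tau> (frozen m \<tau>))) \<partial>lebesgue_on {s..s}) = (\<integral>\<^sup>+\<tau>. 0 \<partial>lebesgue_on {s..s})"
    by (rule nn_integral_cong_AE, use AE_interval_neq[where c=s] AE_space in eventually_elim) simp
  moreover have "q m 0 = s" using s by (simp add: q_def)
  ultimately show ?case by (simp add: duhamel_same)
next
  case (Suc k)
  let ?q = "q m"
  have q: "s \<le> ?q k" "?q k \<le> ?q (Suc k)" "?q (Suc k) \<le> t"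
    unfolding q_def by (rule clipped_dyadic_grid[OF s(2)])+
  show ?case
  proof (cases "?q k = t")
    case True
    then have "?q (Suc k) = ?q k" using q by simp
    then show ?thesis using Suc by simp
  next
    case False
    let ?x = "J (?q k)"
    have qk: "?q k = s + real k / 2^m" using False by (auto simp: q_def)
    have ae: "AE \<tau> in lebesgue_on {?q k..?q (Suc k)}. frozen m \<tau> = U \<tau> (?q k) ?x"
      using AE_interval_neq[where c="?q (Suc k)"] AE_space
    proof eventually_elim
      case (elim \<tau>)
      then have "?q k \<le> \<tau>" "\<tau> < s + real (Suc k) / 2^m" by (auto simp: q_def)
      then have "dyadic_floor s m \<tau> = ?q k" unfolding qk by (rule dyadic_floor_eq)
      then show ?case by (simp add: frozen_def)
    qed
    have x: "0 \<le> ?x" using q by (intro J_nonneg) auto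
    have 1: "(\<integral>\<^sup>+\<tau>. ennreal (norm (B \<tau> (frozen m \<tau>))) \<partial>lebesgue_on {?q k..?q (Suc k)}) +
        ennreal (norm (U (?q (Suc k)) (?q k) ?x)) \<le> ennreal (norm ?x)"
    proof -
      have "(\<integral>\<^sup>+\<tau>. ennreal (norm (B \<tau> (frozen m \<tau>))) \<partial>lebesgue_on {?q k..?q (Suc k)}) =
          (\<integral>\<^sup>+\<tau>. ennreal (norm (B \<tau> (U \<tau> (?q k) ?x))) \<partial>lebesgue_on {?q k..?q (Suc k)})"
        by (rule nn_integral_cong_AE) (use ae in eventually_elim, simp)
      then show ?thesis using BU_bound_add[OF _ q(2) x] q s by simp
    qed
    have "J (?q (Suc k)) = U (?q (Suc k)) (?q k) ?x + duhamel g (?q k) (?q (Suc k))"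
      using q s by (intro duhamel_split g_sub) auto
    then have "ennreal (norm (J (?q (Suc k)))) \<le>
        ennreal (norm (U (?q (Suc k)) (?q k) ?x)) + ennreal (norm (duhamel g (?q k) (?q (Suc k))))"
      by (metis ennreal_leI ennreal_plus norm_ge_zero norm_triangle_ineq)
    also have "\<dots> \<le> ennreal (norm (U (?q (Suc k)) (?q k) ?x)) +
        (\<integral>\<^sup>+r. ennreal (norm (g r)) \<partial>lebesgue_on {?q k..?q (Suc k)})"
      using q s by (intro add_left_mono norm_duhamel_le g_sub g_nonneg_sub) auto
    finally have 2: "ennreal (norm (J (?q (Suc k)))) \<le> ennreal (norm (U (?q (Suc k)) (?q k) ?x)) +
        (\<integral>\<^sup>+r. ennreal (norm (g r)) \<partial>lebesgue_on {?q k..?q (Suc k)})" .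
    have "(\<integral>\<^sup>+\<tau>. ennreal (norm (B \<tau> (frozen m \<tau>))) \<partial>lebesgue_on {s..?q (Suc k)}) + ennreal (norm (J (?q (Suc k)))) =
        (\<integral>\<^sup>+\<tau>. ennreal (norm (B \<tau> (frozen m \<tau>))) \<partial>lebesgue_on {s..?q k}) +
        (\<integral>\<^sup>+\<tau>. ennreal (norm (B \<tau> (frozen m \<tau>))) \<partial>lebesgue_on {?q k..?q (Suc k)}) + ennreal (norm (J (?q (Suc k))))"
      by (simp only: nn_integral_interval_combine[OF q(1,2) borel_measurable_subinterval[OF
            B_frozen_norm_meas order_refl q(3)]])
    also have "\<dots> \<le> (\<integral>\<^sup>+\<tau>. ennreal (norm (B \<tau> (frozen m \<tau>))) \<partial>lebesgue_on {s..?q k}) +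
        (\<integral>\<^sup>+\<tau>. ennreal (norm (B \<tau> (frozen m \<tau>))) \<partial>lebesgue_on {?q k..?q (Suc k)}) +
        (ennreal (norm (U (?q (Suc k)) (?q k) ?x)) +
        (\<integral>\<^sup>+r. ennreal (norm (g r)) \<partial>lebesgue_on {?q k..?q (Suc k)}))"
      by (rule add_left_mono[OF 2])
    also have "\<dots> = (\<integral>\<^sup>+\<tau>. ennreal (norm (B \<tau> (frozen m \<tau>))) \<partial>lebesgue_on {s..?q k}) +
        ((\<integral>\<^sup>+\<tau>. ennreal (norm (B \<tau> (frozen m \<tau>))) \<partial>lebesgue_on {?q k..?q (Suc k)}) +
        ennreal (norm (U (?q (Suc k)) (?q k) ?x))) +
        (\<integral>\<^sup>+r. ennreal (norm (g r)) \<partial>lebesgue_on {?q k..?q (Suc k)})"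
      by (simp only: add.assoc)
    also have "\<dots> \<le> (\<integral>\<^sup>+\<tau>. ennreal (norm (B \<tau> (frozen m \<tau>))) \<partial>lebesgue_on {s..?q k}) + ennreal (norm ?x) +
        (\<integral>\<^sup>+r. ennreal (norm (g r)) \<partial>lebesgue_on {?q k..?q (Suc k)})"
      by (rule add_right_mono[OF add_left_mono[OF 1]])
    also have "\<dots> \<le> (\<integral>\<^sup>+r. ennreal (norm (g r)) \<partial>lebesgue_on {s..?q k}) +
        (\<integral>\<^sup>+r. ennreal (norm (g r)) \<partial>lebesgue_on {?q k..?q (Suc k)})"
      by (rule add_right_mono[OF Suc.IH])
    also have "\<dots> = (\<integral>\<^sup>+r. ennreal (norm (g r)) \<partial>lebesgue_on {s..?q (Suc k)})"
      by (simp only: nn_integral_interval_combine[OF q(1,2) borel_measurable_subinterval[OF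
            g_norm_meas order_refl q(3)]])
    finally show ?thesis .
  qed
qed

lemma B_frozen_bound:
  "(\<integral>\<^sup>+\<tau>. ennreal (norm (B \<tau> (frozen m \<tau>))) \<partial>lebesgue_on {s..t}) + ennreal (norm (J t)) \<le>
    (\<integral>\<^sup>+r. ennreal (norm (g r)) \<partial>lebesgue_on {s..t})"
proof -
  obtain k where "(t - s) * 2^m < real k" using reals_Archimedean2 by blast
  then have "min t (s + real k / 2^m) = t" by (simp add: field_simps)
  then show ?thesis using B_frozen_bound_grid[where m=m and k=k] by simp
qed

text \<open>
  The increments of \<open>frozen\<close> are positive and lie in the domain, so \<open>B\<close> maps them to positive vectors.
\<close>

lemma B_frozen_mono: "AE \<tau> in lebesgue_on {s..t}. \<forall>m. norm (B \<tau> (frozen m \<tau>)) \<le> norm (B \<tau> (frozen (Suc m) \<tau>))"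
  using frozen_dom AE_space
proof eventually_elim
  case (elim \<tau>)
  then have \<tau>: "\<tau> \<in> {s..t}" "0 \<le> \<tau>" using s by auto
  show ?case
  proof
    fix m
    let ?d = "frozen (Suc m) \<tau> - frozen m \<tau>"
    have d: "?d \<in> D \<tau>" "0 \<le> ?d"
      using elim subspace_diff[OF D_subspace[OF \<tau>(2)]] incseq_SucD[OF frozen_incseq[OF \<tau>(1)], of m] by auto
    have "B \<tau> (frozen (Suc m) \<tau>) = B \<tau> (frozen m \<tau>) + B \<tau> ?d"
      using B_add[OF \<tau>(2), of "frozen m \<tau>" ?d] elim d by simp
    then show "norm (B \<tau> (frozen m \<tau>)) \<le> norm (B \<tau> (frozen (Suc m) \<tau>))"
      using elim d \<tau> frozen_nonneg by (auto intro!: norm_add_mono B_nonneg)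
  qed
qed

text \<open>
  By monotone convergence the norms of \<open>B \<tau> (frozen m \<tau>)\<close> are bounded in \<open>m\<close> for almost every \<open>\<tau>\<close>.
  This is what increasing closedness requires in order to pass to the limit \<open>J \<tau>\<close>.
\<close>

lemma
  shows BJ_dom: "AE \<tau> in lebesgue_on {s..t}. J \<tau> \<in> D \<tau>"
    and BJ_meas: "strongly_measurable (lebesgue_on {s..t}) (\<lambda>\<tau>. B \<tau> (J \<tau>))"
    and BJ_bound: "(\<integral>\<^sup>+\<tau>. ennreal (norm (B \<tau> (J \<tau>))) \<partial>lebesgue_on {s..t}) + ennreal (norm (J t)) \<le>
      (\<integral>\<^sup>+r. ennreal (norm (g r)) \<partial>lebesgue_on {s..t})"
proof -
  let ?M = "lebesgue_on {s..t}"
  let ?h = "\<lambda>m \<tau>. ennreal (norm (B \<tau> (frozen m \<tau>)))"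
  have mono: "AE \<tau> in ?M. ?h m \<tau> \<le> ?h (Suc m) \<tau>" for m
    using B_frozen_mono by eventually_elim (simp add: ennreal_leI)
  have sup_eq: "(\<integral>\<^sup>+\<tau>. (SUP m. ?h m \<tau>) \<partial>?M) = (SUP m. \<integral>\<^sup>+\<tau>. ?h m \<tau> \<partial>?M)"
    by (rule nn_integral_monotone_convergence_SUP_AE[where f="?h", OF mono B_frozen_norm_meas])
  have bound: "(\<integral>\<^sup>+\<tau>. (SUP m. ?h m \<tau>) \<partial>?M) + ennreal (norm (J t)) \<le> (\<integral>\<^sup>+r. ennreal (norm (g r)) \<partial>?M)"
  proof -
    have "(\<integral>\<^sup>+\<tau>. (SUP m. ?h m \<tau>) \<partial>?M) + ennreal (norm (J t)) = (SUP m. (\<integral>\<^sup>+\<tau>. ?h m \<tau> \<partial>?M) + ennreal (norm (J t)))"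
      unfolding sup_eq by (rule ennreal_SUP_add_left[symmetric]) auto
    also have "\<dots> \<le> (\<integral>\<^sup>+r. ennreal (norm (g r)) \<partial>?M)" by (rule SUP_least) (rule B_frozen_bound)
    finally show ?thesis .
  qed
  have "(\<integral>\<^sup>+\<tau>. (SUP m. ?h m \<tau>) \<partial>?M) \<le> (\<integral>\<^sup>+\<tau>. (SUP m. ?h m \<tau>) \<partial>?M) + ennreal (norm (J t))" by simp
  also note bound
  also note g_norm_finite
  finally have "(\<integral>\<^sup>+\<tau>. (SUP m. ?h m \<tau>) \<partial>?M) < \<infinity>" .
  then have "AE \<tau> in ?M. (SUP m. ?h m \<tau>) \<noteq> \<infinity>"
    by (intro nn_integral_PInf_AE borel_measurable_SUP B_frozen_norm_meas) auto
  then have key: "AE \<tau> in ?M. J \<tau> \<in> D \<tau> \<and> (\<lambda>m. B \<tau> (frozen m \<tau>)) \<longlonglongrightarrow> B \<tau> (J \<tau>)"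
    using frozen_dom AE_space
  proof eventually_elim
    case (elim \<tau>)
    then have \<tau>: "\<tau> \<in> {s..t}" "0 \<le> \<tau>" using s by auto
    obtain c where c: "(SUP m. ?h m \<tau>) = ennreal c" "0 \<le> c"
      using elim(1) by (cases "SUP m. ?h m \<tau>") auto
    have "norm (B \<tau> (frozen m \<tau>)) \<le> c" for m
    proof -
      have "?h m \<tau> \<le> ennreal c" unfolding c(1)[symmetric] by (rule SUP_upper) simp
      then show ?thesis using c(2) by simp
    qed
    then have "bdd_above (range (\<lambda>m. norm (B \<tau> (frozen m \<tau>))))" by (intro bdd_aboveI2)
    moreover have "0 \<le> J \<tau>" using \<tau>(1) by (intro J_nonneg) simp
    moreover note closed = B_closed[OF \<tau>(2), unfolded increasingly_closed_def,
        THEN spec, of "\<lambda>m. frozen m \<tau>", THEN spec, of "J \<tau>", THEN mp]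
    ultimately show ?case
      using elim(2) frozen_nonneg[OF \<tau>(1)] frozen_incseq[OF \<tau>(1)] frozen_tendsto[OF \<tau>(1)]
      by (intro closed conjI allI) simp_all
  qed
  then show "AE \<tau> in ?M. J \<tau> \<in> D \<tau>" by eventually_elim simp
  have lim: "AE \<tau> in ?M. (\<lambda>m. B \<tau> (frozen m \<tau>)) \<longlonglongrightarrow> B \<tau> (J \<tau>)" using key by eventually_elim simp
  show "strongly_measurable ?M (\<lambda>\<tau>. B \<tau> (J \<tau>))"
    by (rule strongly_measurable_lim[OF finite_interval complete_interval B_frozen_meas lim])
  have "AE \<tau> in ?M. ennreal (norm (B \<tau> (J \<tau>))) \<le> (SUP m. ?h m \<tau>)"
    using lim
  proof eventually_elim
    case (elim \<tau>)
    have "(\<lambda>m. ?h m \<tau>) \<longlonglongrightarrow> ennreal (norm (B \<tau> (J \<tau>)))"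
      by (intro tendsto_ennrealI tendsto_norm elim)
    then show ?case by (rule LIMSEQ_le_const2) (intro exI[of _ 0] allI impI SUP_upper UNIV_I)
  qed
  then have "(\<integral>\<^sup>+\<tau>. ennreal (norm (B \<tau> (J \<tau>))) \<partial>?M) \<le> (\<integral>\<^sup>+\<tau>. (SUP m. ?h m \<tau>) \<partial>?M)"
    by (rule nn_integral_mono_AE)
  then show "(\<integral>\<^sup>+\<tau>. ennreal (norm (B \<tau> (J \<tau>))) \<partial>?M) + ennreal (norm (J t)) \<le> (\<integral>\<^sup>+r. ennreal (norm (g r)) \<partial>?M)"
    using bound by (meson add_right_mono order_trans)
qed

end

section \<open>The iterates and their convolution identity\<close>

declare V.simps(2) [simp del] Vbar.simps(2) [simp del]

context perturbed_evolution
begin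

abbreviation Vb :: "nat \<Rightarrow> real \<Rightarrow> real \<Rightarrow> 'a \<Rightarrow> 'a" where
  "Vb \<equiv> Vbar U B"

abbreviation BVb_mass :: "nat \<Rightarrow> real \<Rightarrow> real \<Rightarrow> 'a \<Rightarrow> ennreal" where
  "BVb_mass n t s u \<equiv> \<integral>\<^sup>+r. ennreal (norm (B r (Vb n r s u))) \<partial>lebesgue_on {s..t}"

lemma Vb_Suc: "Vb (Suc n) t s u = duhamel (\<lambda>r. B r (Vb n r s u)) s t"
  by (simp add: Vbar.simps(2) duhamel_def)

lemma Vb_positive_forcing:
  assumes "0 \<le> s" "s \<le> t" "0 \<le> u"
    and pos: "\<And>r. s \<le> r \<Longrightarrow> r \<le> t \<Longrightarrow> 0 \<le> Vb n r s u"
    and dom: "AE r in lebesgue_on {s..t}. Vb n r s u \<in> D r"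
    and meas: "strongly_measurable (lebesgue_on {s..t}) (\<lambda>r. B r (Vb n r s u))"
    and mass: "BVb_mass n t s u \<le> ennreal (norm u)"
  shows "positive_forcing U B D s t (\<lambda>r. B r (Vb n r s u))"
proof (unfold_locales)
  show "0 \<le> s" "s \<le> t" by fact+
  have "BVb_mass n t s u < \<infinity>" using mass by (rule le_less_trans) simp
  then show "Bochner_integrable (lebesgue_on {s..t}) (\<lambda>r. B r (Vb n r s u))"
    unfolding Bochner_integrable_iff[OF complete_interval] using meas by simp
  show "AE r in lebesgue_on {s..t}. 0 \<le> B r (Vb n r s u)"
    using dom AE_space by eventually_elim (use assms(1) in \<open>auto intro!: B_nonneg pos\<close>)
qed

text \<open>
  The iterates are successive Duhamel integrals, each with \<open>B\<close> applied to the previous one as forcing.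
  The mass of these forcings decreases along the iteration, so that integrability is never lost.
\<close>

lemma Vb_nonneg_all:
  assumes "0 \<le> s" "0 \<le> u" "s \<le> t"
  shows "0 \<le> Vb n t s u \<and> (AE r in lebesgue_on {s..t}. Vb n r s u \<in> D r) \<and>
    strongly_measurable (lebesgue_on {s..t}) (\<lambda>r. B r (Vb n r s u)) \<and>
    BVb_mass n t s u \<le> ennreal (norm u)"
  using assms(3)
proof (induction n arbitrary: t)
  case 0
  have "AE r in lebesgue_on {s..t}. U r s u \<in> D r"
    using U_dom[OF assms(1)] by (rule AE_interval_subset) auto
  moreover have "strongly_measurable (lebesgue_on {s..t}) (\<lambda>r. B r (U r s u))"
    using BU_meas[OF assms(1)] by (rule strongly_measurable_interval_subset) auto
  moreover have "BVb_mass 0 t s u \<le> ennreal (norm u)"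
    using order_trans[OF _ BU_bound_add[OF assms(1) 0 assms(2)]] by simp
  ultimately show ?case using U_nonneg[OF assms(1) 0 assms(2)] by simp
next
  case (Suc n)
  have IH: "0 \<le> Vb n r s u" if "s \<le> r" for r using Suc.IH[OF that] by simp
  interpret positive_forcing U B D s t "\<lambda>r. B r (Vb n r s u)"
    using Suc.IH[OF Suc.prems] IH assms Suc.prems by (intro Vb_positive_forcing) auto
  have "BVb_mass (Suc n) t s u \<le> BVb_mass (Suc n) t s u + ennreal (norm (Vb (Suc n) t s u))" by simp
  also have "\<dots> \<le> BVb_mass n t s u" using BJ_bound unfolding Vb_Suc .
  also have "\<dots> \<le> ennreal (norm u)" using Suc.IH[OF Suc.prems] by simp
  finally show ?case
    using BJ_dom BJ_meas J_nonneg[OF order_refl] unfolding Vb_Suc by simp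
qed

lemma Vb_nonneg: "0 \<le> s \<Longrightarrow> s \<le> t \<Longrightarrow> 0 \<le> u \<Longrightarrow> 0 \<le> Vb n t s u"
  using Vb_nonneg_all by blast

lemma Vb_forcing:
  assumes "0 \<le> s" "s \<le> t" "0 \<le> u"
  shows "positive_forcing U B D s t (\<lambda>r. B r (Vb n r s u))"
  using Vb_nonneg_all[OF assms(1,3,2), of n] Vb_nonneg[OF assms(1) _ assms(3), of _ n] assms
  by (intro Vb_positive_forcing) auto

text \<open>
  The balance of mass between consecutive iterates; applied repeatedly, it bounds every later iterate by
  the mass of an earlier one.
\<close>

lemma BVb_mass_Suc:
  assumes "0 \<le> s" "s \<le> t" "0 \<le> u"
  shows "BVb_mass (Suc n) t s u + ennreal (norm (Vb (Suc n) t s u)) \<le> BVb_mass n t s u"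
  using positive_forcing.BJ_bound[OF Vb_forcing[OF assms, of n]] unfolding Vb_Suc .

lemma BVb_mass_antimono:
  assumes "0 \<le> s" "s \<le> t" "0 \<le> u" "m \<le> n"
  shows "BVb_mass n t s u \<le> BVb_mass m t s u"
proof (rule lift_Suc_antimono_le[OF _ assms(4), of "\<lambda>n. BVb_mass n t s u"])
  fix k
  have "BVb_mass (Suc k) t s u \<le> BVb_mass (Suc k) t s u + ennreal (norm (Vb (Suc k) t s u))" by simp
  also have "\<dots> \<le> BVb_mass k t s u" by (rule BVb_mass_Suc[OF assms(1-3)])
  finally show "BVb_mass (Suc k) t s u \<le> BVb_mass k t s u" .
qed

lemma norm_Vb_Suc_le_mass:
  assumes "0 \<le> s" "s \<le> t" "0 \<le> u"
  shows "ennreal (norm (Vb (Suc n) t s u)) \<le> BVb_mass n t s u"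
  by (rule order_trans[OF _ BVb_mass_Suc[OF assms]]) simp

text \<open>
  An iterate of positive order is dominated by what \<open>U\<close> loses.  In particular it is small on short
  intervals, which is used both for continuity and for the estimate of the defect.
\<close>

lemma norm_Vb_Suc:
  assumes "0 \<le> s" "s \<le> t" "0 \<le> u"
  shows "norm (Vb (Suc n) t s u) \<le> norm u - norm (U t s u)"
proof -
  have "ennreal (norm (Vb (Suc n) t s u) + norm (U t s u)) =
      ennreal (norm (Vb (Suc n) t s u)) + ennreal (norm (U t s u))" by (rule ennreal_plus) simp_all
  also have "\<dots> \<le> BVb_mass 0 t s u + ennreal (norm (U t s u))"
    by (intro add_right_mono order_trans[OF norm_Vb_Suc_le_mass[OF assms] BVb_mass_antimono[OF assms]]) simp
  also have "\<dots> \<le> ennreal (norm u)" using BU_bound_add[OF assms] by simp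
  finally have "norm (Vb (Suc n) t s u) + norm (U t s u) \<le> norm u"
    by (rule iffD1[OF ennreal_le_iff, rotated]) simp
  then show ?thesis by simp
qed

lemma norm_Vb_nonneg:
  assumes "0 \<le> s" "s \<le> t" "0 \<le> u"
  shows "norm (Vb n t s u) \<le> norm u"
proof (cases n)
  case 0
  then show ?thesis using U_contractive[OF assms] by simp
next
  case (Suc m)
  show ?thesis unfolding Suc using norm_Vb_Suc[OF assms, of m] norm_ge_zero[of "U t s u"] by linarith
qed

text \<open>
  Domain and integrability statements pass from positive to arbitrary vectors as soon as the iterate
  is known to be linear; linearity itself is proved by induction with the help of this lemma.
\<close>

lemma Vb_general_aux:
  assumes lin: "\<And>r. s \<le> r \<Longrightarrow> linear (Vb n r s)" and st: "0 \<le> s" "s \<le> t"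
  shows "AE r in lebesgue_on {s..t}. Vb n r s x \<in> D r"
    and "Bochner_integrable (lebesgue_on {s..t}) (\<lambda>r. B r (Vb n r s x))"
proof -
  obtain u v :: 'a where uv: "0 \<le> u" "0 \<le> v" "x = u - v"
    using cone_generating unfolding generating_cone_def by blast
  have fu: "positive_forcing U B D s t (\<lambda>r. B r (Vb n r s u))"
    and fv: "positive_forcing U B D s t (\<lambda>r. B r (Vb n r s v))"
    using Vb_forcing st uv by auto
  have ae: "AE r in lebesgue_on {s..t}. Vb n r s x \<in> D r \<and> B r (Vb n r s u) - B r (Vb n r s v) = B r (Vb n r s x)"
    using conjunct1[OF conjunct2[OF Vb_nonneg_all[OF st(1) uv(1) st(2), of n]]]
      conjunct1[OF conjunct2[OF Vb_nonneg_all[OF st(1) uv(2) st(2), of n]]] AE_space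
  proof eventually_elim
    case (elim r)
    then have r: "s \<le> r" "0 \<le> r" using st by auto
    show ?case
      unfolding uv(3) linear_diff[OF lin[OF r(1)]]
      using elim r by (simp add: B_diff subspace_diff[OF D_subspace])
  qed
  then show "AE r in lebesgue_on {s..t}. Vb n r s x \<in> D r" by eventually_elim simp
  have ae': "AE r in lebesgue_on {s..t}. B r (Vb n r s u) - B r (Vb n r s v) = B r (Vb n r s x)"
    using ae by eventually_elim simp
  obtain a b where ab: "has_Bochner_int (lebesgue_on {s..t}) (\<lambda>r. B r (Vb n r s u)) a"
    "has_Bochner_int (lebesgue_on {s..t}) (\<lambda>r. B r (Vb n r s v)) b"
    using positive_forcing.g[OF fu] positive_forcing.g[OF fv] unfolding Bochner_integrable_def by blast
  show "Bochner_integrable (lebesgue_on {s..t}) (\<lambda>r. B r (Vb n r s x))"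
    unfolding Bochner_integrable_def
    by (rule exI, rule has_Bochner_int_cong_AE[OF has_Bochner_int_diff[OF complete_interval ab] ae'])
qed

lemma Vb_linear: "0 \<le> s \<Longrightarrow> s \<le> t \<Longrightarrow> linear (Vb n t s)"
proof (induction n arbitrary: t)
  case 0
  then show ?case using bounded_linear.linear[OF U_bounded_linear] by simp
next
  case (Suc n)
  have lin: "linear (Vb n r s)" if "s \<le> r" for r using Suc that by simp
  have dom: "AE r in lebesgue_on {s..t}. Vb n r s x \<in> D r"
    and int: "Bochner_integrable (lebesgue_on {s..t}) (\<lambda>r. B r (Vb n r s x))" for x
    by (rule Vb_general_aux[OF lin Suc.prems], assumption)+
  note hi = has_int_duhamel[OF Suc.prems(1) int, folded Vb_Suc]
  show ?case
  proof (rule linearI)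
    fix x y :: 'a and c :: real
    have "AE r in lebesgue_on {s..t}. U t r (B r (Vb n r s x)) + U t r (B r (Vb n r s y)) =
        U t r (B r (Vb n r s (x + y)))"
      using dom[of x] dom[of y] AE_space
    proof eventually_elim
      case (elim r)
      then have r: "s \<le> r" "0 \<le> r" "r \<le> t" using Suc.prems by auto
      show ?case
        unfolding linear_add[OF lin[OF r(1)]] B_add[OF r(2) elim(1,2)]
        using linear_add[OF bounded_linear.linear[OF U_bounded_linear[OF r(2,3)]]] by simp
    qed
    from has_Bochner_int_cong_AE[OF has_Bochner_int_add[OF complete_interval hi hi] this]
    show "Vb (Suc n) t s (x + y) = Vb (Suc n) t s x + Vb (Suc n) t s y"
      by (rule has_Bochner_int_unique[OF complete_interval hi])
    have "AE r in lebesgue_on {s..t}. c *\<^sub>R U t r (B r (Vb n r s x)) = U t r (B r (Vb n r s (c *\<^sub>R x)))"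
      using dom[of x] AE_space
    proof eventually_elim
      case (elim r)
      then have r: "s \<le> r" "0 \<le> r" "r \<le> t" using Suc.prems by auto
      show ?case
        unfolding linear_scale[OF lin[OF r(1)]] B_scaleR[OF r(2) elim(1)]
        using linear_scale[OF bounded_linear.linear[OF U_bounded_linear[OF r(2,3)]]] by simp
    qed
    from has_Bochner_int_cong_AE[OF has_Bochner_int_linear[OF complete_interval
          bounded_linear_scaleR_right hi] this]
    show "Vb (Suc n) t s (c *\<^sub>R x) = c *\<^sub>R Vb (Suc n) t s x"
      by (rule has_Bochner_int_unique[OF complete_interval hi])
  qed
qed

lemma Vb_dom: "0 \<le> s \<Longrightarrow> s \<le> t \<Longrightarrow> AE r in lebesgue_on {s..t}. Vb n r s x \<in> D r"
  by (rule Vb_general_aux(1)[OF Vb_linear])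

lemma BVb_integrable:
  "0 \<le> s \<Longrightarrow> s \<le> t \<Longrightarrow> Bochner_integrable (lebesgue_on {s..t}) (\<lambda>r. B r (Vb n r s x))"
  by (rule Vb_general_aux(2)[OF Vb_linear])

lemma Vb_bounded_linear: "0 \<le> s \<Longrightarrow> s \<le> t \<Longrightarrow> bounded_linear (Vb n t s)"
  by (intro positive_contraction_bounded_linear Vb_linear norm_Vb_nonneg)

lemma norm_Vb: "0 \<le> s \<Longrightarrow> s \<le> t \<Longrightarrow> norm (Vb n t s x) \<le> cone_bound * norm x"
  by (intro positive_contraction_bound Vb_linear norm_Vb_nonneg)

lemma Vb_Suc_has_int:
  "0 \<le> s \<Longrightarrow> s \<le> t \<Longrightarrow>
    has_Bochner_int (lebesgue_on {s..t}) (\<lambda>r. U t r (B r (Vb n r s x))) (Vb (Suc n) t s x)"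
  unfolding Vb_Suc by (rule has_int_duhamel[OF _ BVb_integrable])

lemma Vb_Suc_same: "0 \<le> s \<Longrightarrow> Vb (Suc n) s s u = 0"
  unfolding Vb_Suc by (rule duhamel_same)

text \<open>
  Splitting the integral that defines \<open>Vb (Suc n) t s\<close> at \<open>r\<close>, the part before \<open>r\<close> yields the term with
  \<open>j = 0\<close>, and the induction hypothesis inside the part after \<open>r\<close> yields the others.
\<close>

lemma Vb_convolution:
  assumes "0 \<le> s" "s \<le> r" "r \<le> t"
  shows "Vb n t s u = (\<Sum>j\<le>n. Vb j t r (Vb (n - j) r s u))"
  using assms(3)
proof (induction n arbitrary: t)
  case 0
  then show ?case using assms U_cocycle by simp
next
  case (Suc n)
  let ?f = "\<lambda>\<tau>. B \<tau> (Vb n \<tau> s u)"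
  let ?x = "\<lambda>j. Vb (n - j) r s u"
  have r: "0 \<le> r" and st: "s \<le> t" using assms Suc.prems by auto
  have "Vb (Suc n) t s u = U t r (Vb (Suc n) r s u) + duhamel ?f r t"
    unfolding Vb_Suc using assms(1,2) Suc.prems by (intro duhamel_split BVb_integrable) auto
  also have "duhamel ?f r t = (\<Sum>j\<le>n. Vb (Suc j) t r (?x j))"
  proof -
    have dom: "AE \<tau> in lebesgue_on {r..t}. \<forall>j. Vb j \<tau> r (?x j) \<in> D \<tau>"
      unfolding AE_all_countable using Vb_dom[OF r Suc.prems] by blast
    have ae: "AE \<tau> in lebesgue_on {r..t}. (\<Sum>j\<le>n. U t \<tau> (B \<tau> (Vb j \<tau> r (?x j)))) = U t \<tau> (?f \<tau>)"
      using dom AE_space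
    proof eventually_elim
      case (elim \<tau>)
      then have \<tau>: "r \<le> \<tau>" "\<tau> \<le> t" "0 \<le> \<tau>" using r by auto
      have "?f \<tau> = (\<Sum>j\<le>n. B \<tau> (Vb j \<tau> r (?x j)))"
        unfolding Suc.IH[OF \<tau>(1)] using elim \<tau> by (intro B_sum) auto
      then show ?case
        by (simp add: linear_sum[OF bounded_linear.linear[OF U_bounded_linear[OF \<tau>(3,2)]]])
    qed
    have "has_Bochner_int (lebesgue_on {r..t}) (\<lambda>\<tau>. \<Sum>j\<le>n. U t \<tau> (B \<tau> (Vb j \<tau> r (?x j))))
        (\<Sum>j\<le>n. Vb (Suc j) t r (?x j))"
      by (intro has_Bochner_int_sum complete_interval Vb_Suc_has_int r Suc.prems) simp
    from has_Bochner_int_cong_AE[OF this ae] show ?thesis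
      unfolding duhamel_def by (rule Bochner_int_eq[OF complete_interval])
  qed
  also have "U t r (Vb (Suc n) r s u) + (\<Sum>j\<le>n. Vb (Suc j) t r (?x j)) =
      (\<Sum>j\<le>Suc n. Vb j t r (Vb (Suc n - j) r s u))"
    by (subst sum.atMost_Suc_shift) simp
  finally show ?case .
qed

end

section \<open>Equality of the two families of iterates\<close>

context perturbed_evolution
begin

lemma U_tendsto:
  assumes "(a \<longlongrightarrow> t) F" "(b \<longlongrightarrow> s) F" "\<And>x. 0 \<le> b x" "\<And>x. b x \<le> a x" "0 \<le> s" "s \<le> t"
  shows "((\<lambda>x. U (a x) (b x) u) \<longlongrightarrow> U t s u) F"
proof -
  have "continuous_on {(t, s). 0 \<le> s \<and> s \<le> t} (\<lambda>(t, s). U t s u)"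
    using evol unfolding evolution_family_def by blast
  from continuous_on_tendsto_compose[OF this tendsto_Pair[OF assms(1,2)]] show ?thesis
    using assms by simp
qed

text \<open>
  By the convolution identity, moving the initial time from \<open>r\<close> to \<open>r'\<close> changes \<open>Vb n t r x\<close> by terms that
  contain an iterate of positive order on \<open>[r, r']\<close>, and by the displacement of \<open>x\<close> under \<open>U\<close>.
\<close>

lemma Vb_increment:
  assumes "0 \<le> r" "r \<le> r'" "r' \<le> t" "0 \<le> x"
  shows "norm (Vb n t r x - Vb n t r' x) \<le> (real n + cone_bound) * norm (U r' r x - x)"
proof -
  let ?d = "norm x - norm (U r' r x)"
  have d: "?d \<le> norm (U r' r x - x)" by (metis norm_minus_commute norm_triangle_ineq2)
  have t: "0 \<le> r'" using assms by simp
  have "Vb n t r x = (\<Sum>j\<le>n. Vb j t r' (Vb (n - j) r' r x))"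
    by (rule Vb_convolution[OF assms(1-3)])
  also have "\<dots> = (\<Sum>j<n. Vb j t r' (Vb (n - j) r' r x)) + Vb n t r' (U r' r x)"
    by (simp add: lessThan_Suc_atMost[symmetric])
  finally have eq: "Vb n t r x - Vb n t r' x =
      (\<Sum>j<n. Vb j t r' (Vb (n - j) r' r x)) + Vb n t r' (U r' r x - x)"
    by (simp add: linear_diff[OF Vb_linear[OF t assms(3)]])
  have "norm (\<Sum>j<n. Vb j t r' (Vb (n - j) r' r x)) \<le> (\<Sum>j<n. ?d)"
  proof (rule sum_norm_le)
    fix j assume "j \<in> {..<n}"
    then obtain m where m: "n - j = Suc m" by (cases "n - j") auto
    have "norm (Vb j t r' (Vb (n - j) r' r x)) \<le> norm (Vb (n - j) r' r x)"
      by (intro norm_Vb_nonneg Vb_nonneg t assms)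
    also have "\<dots> \<le> ?d" unfolding m by (rule norm_Vb_Suc[OF assms(1,2,4)])
    finally show "norm (Vb j t r' (Vb (n - j) r' r x)) \<le> ?d" .
  qed
  also have "\<dots> = real n * ?d" by simp
  also have "\<dots> \<le> real n * norm (U r' r x - x)" using d by (rule mult_left_mono) simp
  finally have "norm (Vb n t r x - Vb n t r' x) \<le> real n * norm (U r' r x - x) + cone_bound * norm (U r' r x - x)"
    unfolding eq by (rule norm_triangle_le[OF add_mono[OF _ norm_Vb[OF t assms(3)]]])
  then show ?thesis by (simp add: distrib_right)
qed

lemma Vb_continuous_nonneg:
  assumes x: "0 \<le> x"
  shows "continuous_on {0..t} (\<lambda>r. Vb n t r x)"
  unfolding continuous_on_def
proof
  fix r0 assume r0: "r0 \<in> {0..t}"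
  let ?w = "\<lambda>r. (real n + cone_bound) * norm (U (max r0 (max 0 r)) (min r0 (max 0 r)) x - x)"
  have "((\<lambda>r. U (max r0 (max 0 r)) (min r0 (max 0 r)) x) \<longlongrightarrow> U (max r0 (max 0 r0)) (min r0 (max 0 r0)) x)
      (at r0 within {0..t})"
    using r0 by (intro U_tendsto tendsto_intros) auto
  then have "(?w \<longlongrightarrow> (real n + cone_bound) * norm (x - x)) (at r0 within {0..t})"
    using r0 by (intro tendsto_intros) (simp add: U_same)
  then have w: "(?w \<longlongrightarrow> 0) (at r0 within {0..t})" by simp
  have "((\<lambda>r. Vb n t r x - Vb n t r0 x) \<longlongrightarrow> 0) (at r0 within {0..t})"
  proof (rule Lim_null_comparison[OF _ w])
    show "\<forall>\<^sub>F r in at r0 within {0..t}. norm (Vb n t r x - Vb n t r0 x) \<le> ?w r"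
      unfolding eventually_at_filter
    proof (intro always_eventually allI impI)
      fix r assume r: "r \<in> {0..t}"
      show "norm (Vb n t r x - Vb n t r0 x) \<le> ?w r"
      proof (cases "r \<le> r0")
        case True
        then have m: "max r0 (max 0 r) = r0" "min r0 (max 0 r) = r" using r r0 by auto
        show ?thesis unfolding m using Vb_increment[of r r0 t x n] r r0 x True by simp
      next
        case False
        then have m: "max r0 (max 0 r) = r" "min r0 (max 0 r) = r0" using r r0 by auto
        show ?thesis unfolding m using Vb_increment[of r0 r t x n] r r0 x False
          by (simp add: norm_minus_commute)
      qed
    qed
  qed
  from tendsto_add[OF this tendsto_const[of "Vb n t r0 x"]]
  show "((\<lambda>r. Vb n t r x) \<longlongrightarrow> Vb n t r0 x) (at r0 within {0..t})" by simp
qed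

lemma Vb_continuous: "continuous_on {0..t} (\<lambda>r. Vb n t r x)"
proof -
  obtain u v :: 'a where uv: "0 \<le> u" "0 \<le> v" "x = u - v"
    using cone_generating unfolding generating_cone_def by blast
  have "continuous_on {0..t} (\<lambda>r. Vb n t r u - Vb n t r v)"
    by (intro continuous_on_diff Vb_continuous_nonneg uv)
  then show ?thesis
    by (rule continuous_on_eq) (simp add: uv(3) linear_diff[OF Vb_linear])
qed

text \<open>
  Continuity in the initial time provides the measurability that the recursion defining \<open>V\<close> needs.
\<close>

lemma Vb_op_integrable:
  assumes "0 \<le> s" "s \<le> b" "b \<le> t" and g: "Bochner_integrable (lebesgue_on {s..b}) g"
  shows "Bochner_integrable (lebesgue_on {s..b}) (\<lambda>r. Vb n t r (g r))"
  unfolding Bochner_integrable_iff[OF complete_interval]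
proof
  have g': "strongly_measurable (lebesgue_on {s..b}) g" "(\<integral>\<^sup>+x. ennreal (norm (g x)) \<partial>lebesgue_on {s..b}) < \<infinity>"
    using g unfolding Bochner_integrable_iff[OF complete_interval] by auto
  show "strongly_measurable (lebesgue_on {s..b}) (\<lambda>r. Vb n t r (g r))"
  proof (rule strongly_measurable_operator_family[OF finite_interval complete_interval _ _ g'(1)])
    show "bounded_linear (Vb n t r)" if "r \<in> space (lebesgue_on {s..b})" for r
      using that assms by (intro Vb_bounded_linear) auto
    fix x
    have id: "(\<lambda>r. r) \<in> borel_measurable (lebesgue_on {s..b})"
      by (rule measurable_restrict_space1) (rule measurable_completion, simp)
    \<comment> \<open>continuity is known on \<open>[0, t]\<close> only, so the initial time is clamped\<close>
    have "continuous_on UNIV (\<lambda>r. Vb n t (max 0 (min t r)) x)"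
      by (rule continuous_on_compose2[OF Vb_continuous]) (use assms in \<open>auto intro!: continuous_intros\<close>)
    from strongly_measurable_borel_comp[OF id this]
    show "strongly_measurable (lebesgue_on {s..b}) (\<lambda>r. Vb n t r x)"
    proof (rule strongly_measurable_cong_AE, intro AE_I2)
      fix r assume "r \<in> space (lebesgue_on {s..b})"
      then have "max 0 (min t r) = r" using assms by auto
      then show "Vb n t (max 0 (min t r)) x = Vb n t r x" by simp
    qed
  qed
  have gm: "(\<lambda>x. ennreal (norm (g x))) \<in> borel_measurable (lebesgue_on {s..b})"
    using strongly_measurable_norm[OF complete_interval g'(1)] by simp
  have "(\<integral>\<^sup>+r. ennreal (norm (Vb n t r (g r))) \<partial>lebesgue_on {s..b}) \<le>
      (\<integral>\<^sup>+r. ennreal cone_bound * ennreal (norm (g r)) \<partial>lebesgue_on {s..b})"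
  proof (rule nn_integral_mono)
    fix r assume "r \<in> space (lebesgue_on {s..b})"
    then have "norm (Vb n t r (g r)) \<le> cone_bound * norm (g r)" using assms by (intro norm_Vb) auto
    then show "ennreal (norm (Vb n t r (g r))) \<le> ennreal cone_bound * ennreal (norm (g r))"
      using cone_bound_pos by (simp add: ennreal_leI flip: ennreal_mult)
  qed
  also have "\<dots> = ennreal cone_bound * (\<integral>\<^sup>+x. ennreal (norm (g x)) \<partial>lebesgue_on {s..b})"
    by (rule nn_integral_cmult[OF gm])
  also have "\<dots> < \<infinity>" using g'(2) by (simp add: ennreal_mult_less_top)
  finally show "(\<integral>\<^sup>+r. ennreal (norm (Vb n t r (g r))) \<partial>lebesgue_on {s..b}) < \<infinity>" .
qed

text \<open>
  The recursion step of \<open>V\<close>, applied to \<open>Vb n\<close> in place of \<open>V n\<close>.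
\<close>

definition right_iterate :: "nat \<Rightarrow> real \<Rightarrow> real \<Rightarrow> 'a \<Rightarrow> 'a" where
  "right_iterate n t s u = Bochner_int (lebesgue_on {s..t}) (\<lambda>r. Vb n t r (B r (U r s u)))"

lemma BU_integrable:
  assumes "0 \<le> s" "s \<le> a" "b \<le> t" "a \<le> b"
  shows "Bochner_integrable (lebesgue_on {a..b}) (\<lambda>r. B r (U r s u))"
  using Bochner_integrable_subinterval[OF BVb_integrable[of s t 0 u] assms(2,3)] assms by simp

lemma right_iterate_has_int:
  assumes "0 \<le> s" "s \<le> t"
  shows "has_Bochner_int (lebesgue_on {s..t}) (\<lambda>r. Vb n t r (B r (U r s u))) (right_iterate n t s u)"
  unfolding right_iterate_def
  by (rule has_Bochner_int_Bochner_int[OF complete_interval Vb_op_integrable[OF assms order_refl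
        BU_integrable[OF assms(1) order_refl order_refl assms(2)]]])

text \<open>
  Before \<open>b\<close> the convolution identity is inserted under the integral and the bounded operators
  \<open>Vb j t b\<close> are taken out; after \<open>b\<close> the cocycle property restarts the integral at \<open>b\<close>.
\<close>

lemma right_iterate_split:
  assumes "0 \<le> s" "s \<le> b" "b \<le> t"
  shows "right_iterate n t s u = (\<Sum>j\<le>n. Vb j t b (right_iterate (n - j) b s u)) + right_iterate n t b (U b s u)"
proof -
  have b: "0 \<le> b" "s \<le> t" using assms by auto
  have 1: "has_Bochner_int (lebesgue_on {s..b}) (\<lambda>r. Vb n t r (B r (U r s u))) (\<Sum>j\<le>n. Vb j t b (right_iterate (n - j) b s u))"
  proof (rule has_Bochner_int_cong_AE)
    show "has_Bochner_int (lebesgue_on {s..b}) (\<lambda>r. \<Sum>j\<le>n. Vb j t b (Vb (n - j) b r (B r (U r s u))))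
        (\<Sum>j\<le>n. Vb j t b (right_iterate (n - j) b s u))"
    proof (rule has_Bochner_int_sum[OF complete_interval])
      fix j
      show "has_Bochner_int (lebesgue_on {s..b}) (\<lambda>r. Vb j t b (Vb (n - j) b r (B r (U r s u))))
          (Vb j t b (right_iterate (n - j) b s u))"
        by (rule has_Bochner_int_linear[OF complete_interval Vb_bounded_linear[OF b(1) assms(3)]
            right_iterate_has_int[OF assms(1,2)]])
    qed simp
    show "AE r in lebesgue_on {s..b}. (\<Sum>j\<le>n. Vb j t b (Vb (n - j) b r (B r (U r s u)))) =
        Vb n t r (B r (U r s u))"
    proof (rule AE_I2)
      fix r assume "r \<in> space (lebesgue_on {s..b})"
      then have "0 \<le> r" "r \<le> b" using assms by auto
      from Vb_convolution[OF this assms(3)]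
      show "(\<Sum>j\<le>n. Vb j t b (Vb (n - j) b r (B r (U r s u)))) = Vb n t r (B r (U r s u))" by simp
    qed
  qed
  have 2: "has_Bochner_int (lebesgue_on {b..t}) (\<lambda>r. Vb n t r (B r (U r s u))) (right_iterate n t b (U b s u))"
  proof (rule has_Bochner_int_cong_AE[OF right_iterate_has_int[OF b(1) assms(3)]], rule AE_I2)
    fix r assume "r \<in> space (lebesgue_on {b..t})"
    then show "Vb n t r (B r (U r b (U b s u))) = Vb n t r (B r (U r s u))"
      using assms by (simp add: U_cocycle)
  qed
  show ?thesis
    by (rule has_Bochner_int_unique[OF complete_interval right_iterate_has_int[OF assms(1) b(2)]
        has_Bochner_int_combine[OF assms(2,3) 1 2]])
qed

definition defect :: "nat \<Rightarrow> real \<Rightarrow> real \<Rightarrow> 'a \<Rightarrow> 'a" where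
  "defect n t s u = Vb (Suc n) t s u - right_iterate n t s u"

lemma defect_same: "0 \<le> s \<Longrightarrow> defect n s s u = 0"
  unfolding defect_def right_iterate_def
  by (simp only: Vb_Suc_same Bochner_int_eq[OF complete_interval has_Bochner_int_point] diff_self)

text \<open>
  \<open>Vb (Suc n)\<close> and \<open>right_iterate n\<close> satisfy the same splitting rule, with the same coefficients.
\<close>

lemma defect_split:
  assumes "0 \<le> s" "s \<le> b" "b \<le> t"
  shows "defect n t s u = (\<Sum>j\<le>n. Vb j t b (defect (n - j) b s u)) + defect n t b (U b s u)"
proof -
  have b: "0 \<le> b" using assms by simp
  have "Vb (Suc n) t s u = (\<Sum>j\<le>Suc n. Vb j t b (Vb (Suc n - j) b s u))"
    by (rule Vb_convolution[OF assms])
  also have "\<dots> = (\<Sum>j\<le>n. Vb j t b (Vb (Suc (n - j)) b s u)) + Vb (Suc n) t b (U b s u)"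
    by (simp add: Suc_diff_le)
  finally show ?thesis
    unfolding defect_def right_iterate_split[OF assms, of n u]
    by (simp add: linear_diff[OF Vb_linear[OF b assms(3)]] sum_subtractf)
qed

text \<open>
  For \<open>y \<ge> 0\<close>, the mass that \<open>y\<close> loses when it is transported from time \<open>r\<close> to time \<open>t\<close>.
\<close>

definition loss :: "real \<Rightarrow> real \<Rightarrow> 'a \<Rightarrow> ennreal" where
  "loss t r y = ennreal (norm y - norm (U t r y))"

text \<open>
  Both terms of the defect are at most the integrated loss.  For \<open>Vb (Suc (Suc n))\<close> this is the mass
  balance: what enters the first iterate and does not survive in it bounds all later iterates.  For the
  other term it is the estimate \<open>norm_Vb_Suc\<close> under the integral.
\<close>

lemma norm_defect_le:
  assumes "0 \<le> s" "s \<le> t" "0 \<le> u"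
  shows "ennreal (norm (defect (Suc n) t s u)) \<le> 2 * (\<integral>\<^sup>+r. loss t r (B r (U r s u)) \<partial>lebesgue_on {s..t})"
proof -
  let ?M = "lebesgue_on {s..t}"
  let ?f = "\<lambda>r. B r (U r s u)"
  have F: "positive_forcing U B D s t ?f" using Vb_forcing[OF assms, of 0] by simp
  note f = positive_forcing.g[OF F] and fpos = positive_forcing.g_nonneg[OF F]
  have fm: "(\<lambda>r. norm (?f r)) \<in> borel_measurable ?M"
    using strongly_measurable_norm[OF complete_interval, where f="?f"] f
    unfolding Bochner_integrable_iff[OF complete_interval] by blast
  have Ufm: "(\<lambda>r. norm (U t r (?f r))) \<in> borel_measurable ?M"
    using strongly_measurable_norm[OF complete_interval has_Bochner_int_measurable[OF has_int_duhamel[OF assms(1) f]]] .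
  have le: "AE r in ?M. norm (U t r (?f r)) \<le> norm (?f r)"
    using fpos AE_space by eventually_elim (use assms(1) in \<open>auto intro!: U_contractive\<close>)
  have mass: "(\<integral>\<^sup>+r. loss t r (?f r) \<partial>?M) + ennreal (norm (Vb 1 t s u)) = BVb_mass 0 t s u"
  proof -
    have "ennreal (norm (Vb 1 t s u)) = (\<integral>\<^sup>+r. ennreal (norm (U t r (?f r))) \<partial>?M)"
      using norm_duhamel[OF assms(1) f fpos] by (simp add: Vb_Suc)
    moreover have "(\<integral>\<^sup>+r. loss t r (?f r) \<partial>?M) + (\<integral>\<^sup>+r. ennreal (norm (U t r (?f r))) \<partial>?M) =
        (\<integral>\<^sup>+r. loss t r (?f r) + ennreal (norm (U t r (?f r))) \<partial>?M)"
      unfolding loss_def using fm Ufm by (intro nn_integral_add[symmetric]) auto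
    moreover have "\<dots> = BVb_mass 0 t s u"
    proof (rule nn_integral_cong_AE)
      show "AE r in ?M. loss t r (?f r) + ennreal (norm (U t r (?f r))) = ennreal (norm (B r (Vb 0 r s u)))"
        using le by eventually_elim (simp add: loss_def flip: ennreal_plus)
    qed
    ultimately show ?thesis by simp
  qed
  have "ennreal (norm (Vb (Suc (Suc n)) t s u)) + ennreal (norm (Vb 1 t s u)) \<le>
      BVb_mass 1 t s u + ennreal (norm (Vb 1 t s u))"
    by (intro add_right_mono order_trans[OF norm_Vb_Suc_le_mass[OF assms] BVb_mass_antimono[OF assms]]) simp
  also have "\<dots> \<le> BVb_mass 0 t s u" using BVb_mass_Suc[OF assms, of 0] by simp
  also note mass[symmetric]
  finally have 1: "ennreal (norm (Vb (Suc (Suc n)) t s u)) \<le> (\<integral>\<^sup>+r. loss t r (?f r) \<partial>?M)"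
    by (simp add: add.commute[of _ "ennreal (norm (Vb 1 t s u))"] ennreal_add_left_cancel_le)
  have "ennreal (norm (right_iterate (Suc n) t s u)) \<le> (\<integral>\<^sup>+r. ennreal (norm (Vb (Suc n) t r (?f r))) \<partial>?M)"
    by (rule has_Bochner_int_norm_bound[OF complete_interval right_iterate_has_int[OF assms(1,2)]])
  also have "\<dots> \<le> (\<integral>\<^sup>+r. loss t r (?f r) \<partial>?M)"
  proof (rule nn_integral_mono_AE)
    show "AE r in ?M. ennreal (norm (Vb (Suc n) t r (?f r))) \<le> loss t r (?f r)"
      using fpos AE_space
      by eventually_elim (use assms(1) in \<open>auto simp: loss_def intro!: norm_Vb_Suc ennreal_leI\<close>)
  qed
  finally have 2: "ennreal (norm (right_iterate (Suc n) t s u)) \<le> (\<integral>\<^sup>+r. loss t r (?f r) \<partial>?M)" .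
  have "ennreal (norm (defect (Suc n) t s u)) \<le>
      ennreal (norm (Vb (Suc (Suc n)) t s u)) + ennreal (norm (right_iterate (Suc n) t s u))"
    unfolding defect_def by (metis ennreal_leI ennreal_plus norm_ge_zero norm_triangle_ineq4)
  also have "\<dots> \<le> (\<integral>\<^sup>+r. loss t r (?f r) \<partial>?M) + (\<integral>\<^sup>+r. loss t r (?f r) \<partial>?M)"
    by (rule add_mono[OF 1 2])
  finally show ?thesis by (simp add: mult_2)
qed

text \<open>
  The right end point of the cell that contains \<open>r\<close>, in the dyadic partition clipped to \<open>[s, t]\<close>.
\<close>

definition dyadic_next :: "real \<Rightarrow> real \<Rightarrow> nat \<Rightarrow> real \<Rightarrow> real" where
  "dyadic_next s t m r = min t (dyadic_floor s m r + 1 / 2^m)"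

text \<open>
  If the lower defects vanish, \<open>defect_split\<close> reduces to its first and last terms.  Transporting the
  defect at each partition point to the final time \<open>t\<close> makes the first of them telescope, so that only
  the losses on the cells accumulate, each with the factor \<open>cone_bound\<close> because defects need not be
  positive.
\<close>

lemma defect_grid_bound:
  assumes IH: "\<And>m t s. m < Suc n \<Longrightarrow> 0 \<le> s \<Longrightarrow> s \<le> t \<Longrightarrow> defect m t s u = 0"
    and st: "0 \<le> s" "s \<le> t" and u: "0 \<le> u"
  defines "q \<equiv> \<lambda>m k. min t (s + real k / 2^m)"
    and "\<delta> \<equiv> \<lambda>m r. loss (dyadic_next s t m r) r (B r (U r s u))"
  assumes dm: "\<And>m. \<delta> m \<in> borel_measurable (lebesgue_on {s..t})"
  shows "ennreal (norm (U t (q m k) (defect (Suc n) (q m k) s u))) \<le>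
    ennreal (2 * cone_bound) * (\<integral>\<^sup>+r. \<delta> m r \<partial>lebesgue_on {s..q m k})"
proof (induction k)
  case 0
  have "q m 0 = s" using st by (simp add: q_def)
  then show ?case using linear_0[OF bounded_linear.linear[OF U_bounded_linear[OF st]]] st
    by (simp add: defect_same)
next
  case (Suc k)
  let ?q = "q m"
  have q: "s \<le> ?q k" "?q k \<le> ?q (Suc k)" "?q (Suc k) \<le> t"
    unfolding q_def by (rule clipped_dyadic_grid[OF st(2)])+
  have q0: "0 \<le> ?q k" "0 \<le> ?q (Suc k)" using q st by linarith+
  show ?case
  proof (cases "?q k = t")
    case True
    then have "?q (Suc k) = ?q k" using q by simp
    then show ?thesis using Suc by simp
  next
    case False
    then have qk: "?q k = s + real k / 2^m" by (auto simp: q_def)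
    let ?q' = "?q (Suc k)" and ?x = "U (?q k) s u"
    have x: "0 \<le> ?x" using st q u by (intro U_nonneg) auto
    have "defect (Suc n) ?q' s u = (\<Sum>j\<le>Suc n. Vb j ?q' (?q k) (defect (Suc n - j) (?q k) s u)) + defect (Suc n) ?q' (?q k) ?x"
      by (rule defect_split[OF st(1) q(1,2)])
    also have "(\<Sum>j\<le>Suc n. Vb j ?q' (?q k) (defect (Suc n - j) (?q k) s u)) = U ?q' (?q k) (defect (Suc n) (?q k) s u)"
      using IH[OF _ st(1) q(1)] linear_0[OF Vb_linear[OF q0(1) q(2)]]
      by (subst sum.atMost_Suc_shift) simp
    finally have "U t ?q' (defect (Suc n) ?q' s u) =
        U t (?q k) (defect (Suc n) (?q k) s u) + U t ?q' (defect (Suc n) ?q' (?q k) ?x)"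
      using linear_add[OF bounded_linear.linear[OF U_bounded_linear[OF q0(2) q(3)]]] U_cocycle[OF q0(1) q(2,3)]
      by simp
    then have "norm (U t ?q' (defect (Suc n) ?q' s u)) \<le>
        norm (U t (?q k) (defect (Suc n) (?q k) s u)) + cone_bound * norm (defect (Suc n) ?q' (?q k) ?x)"
      using norm_triangle_le[OF add_mono[OF order_refl norm_U_le[OF q0(2) q(3)]]] by simp
    then have "ennreal (norm (U t ?q' (defect (Suc n) ?q' s u))) \<le>
        ennreal (norm (U t (?q k) (defect (Suc n) (?q k) s u))) + ennreal cone_bound * ennreal (norm (defect (Suc n) ?q' (?q k) ?x))"
      using cone_bound_pos by (simp add: ennreal_leI flip: ennreal_mult ennreal_plus)
    also have "\<dots> \<le> ennreal (2 * cone_bound) * (\<integral>\<^sup>+r. \<delta> m r \<partial>lebesgue_on {s..?q k}) +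
        ennreal cone_bound * (2 * (\<integral>\<^sup>+r. loss ?q' r (B r (U r (?q k) ?x)) \<partial>lebesgue_on {?q k..?q'}))"
      by (intro add_mono Suc.IH mult_left_mono norm_defect_le q0 q x) simp
    also have "(\<integral>\<^sup>+r. loss ?q' r (B r (U r (?q k) ?x)) \<partial>lebesgue_on {?q k..?q'}) =
        (\<integral>\<^sup>+r. \<delta> m r \<partial>lebesgue_on {?q k..?q'})"
    proof (rule nn_integral_cong_AE)
      show "AE r in lebesgue_on {?q k..?q'}. loss ?q' r (B r (U r (?q k) ?x)) = \<delta> m r"
        using AE_interval_neq[where c="?q'"] AE_space
      proof eventually_elim
        case (elim r)
        then have r: "?q k \<le> r" "r < s + real (Suc k) / 2^m" by (auto simp: q_def)
        have "dyadic_floor s m r = ?q k"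
          using dyadic_floor_eq[of s k m r] r unfolding qk by simp
        then have "dyadic_next s t m r = ?q'"
          unfolding dyadic_next_def qk by (simp add: q_def add_divide_distrib add.assoc add.commute)
        then show ?case unfolding \<delta>_def using U_cocycle[OF st(1) q(1) r(1)] by simp
      qed
    qed
    also have "ennreal (2 * cone_bound) * (\<integral>\<^sup>+r. \<delta> m r \<partial>lebesgue_on {s..?q k}) +
        ennreal cone_bound * (2 * (\<integral>\<^sup>+r. \<delta> m r \<partial>lebesgue_on {?q k..?q'})) =
        ennreal (2 * cone_bound) * ((\<integral>\<^sup>+r. \<delta> m r \<partial>lebesgue_on {s..?q k}) + (\<integral>\<^sup>+r. \<delta> m r \<partial>lebesgue_on {?q k..?q'}))"
      using cone_bound_pos by (simp add: ennreal_mult distrib_left mult_ac)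
    also have "(\<integral>\<^sup>+r. \<delta> m r \<partial>lebesgue_on {s..?q k}) + (\<integral>\<^sup>+r. \<delta> m r \<partial>lebesgue_on {?q k..?q'}) =
        (\<integral>\<^sup>+r. \<delta> m r \<partial>lebesgue_on {s..?q'})"
    proof (rule nn_integral_interval_combine[OF q(1,2), symmetric])
      show "\<delta> m \<in> borel_measurable (lebesgue_on {s..?q'})"
        using measurable_restrict_mono[OF dm, of "{s..?q'}"] q by auto
    qed
    finally show ?thesis .
  qed
qed

text \<open>
  As the partition is refined, the end point of the cell of \<open>r\<close> tends to \<open>r\<close> and the loss up to it
  tends to \<open>0\<close>, dominated by the norm of \<open>B r (U r s u)\<close>.
\<close>

lemma defect_zero_Suc:
  assumes IH: "\<And>m t s. m < Suc n \<Longrightarrow> 0 \<le> s \<Longrightarrow> s \<le> t \<Longrightarrow> defect m t s u = 0"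
    and st: "0 \<le> s" "s \<le> t" and u: "0 \<le> u"
  shows "defect (Suc n) t s u = 0"
proof -
  let ?M = "lebesgue_on {s..t}"
  let ?f = "\<lambda>r. B r (U r s u)"
  let ?\<delta> = "\<lambda>m r. loss (dyadic_next s t m r) r (?f r)"
  have F: "positive_forcing U B D s t ?f" using Vb_forcing[OF st u, of 0] by simp
  note f = positive_forcing.g[OF F] and fpos = positive_forcing.g_nonneg[OF F]
  have fm: "strongly_measurable ?M ?f" and ff: "(\<integral>\<^sup>+r. ennreal (norm (?f r)) \<partial>?M) < \<infinity>"
    using f unfolding Bochner_integrable_iff[OF complete_interval] by auto
  have fnm: "(\<lambda>r. norm (?f r)) \<in> borel_measurable ?M"
    by (rule strongly_measurable_norm[OF complete_interval fm])
  have next_ge: "r \<le> dyadic_next s t m r" if "r \<le> t" for r m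
    using that dyadic_floor_gt[of r s m] by (simp add: dyadic_next_def)
  have next_meas: "dyadic_next s t m \<in> borel_measurable ?M" for m
  proof (rule measurable_restrict_space1, rule measurable_completion)
    show "dyadic_next s t m \<in> borel_measurable lborel"
      unfolding dyadic_next_def[abs_def] dyadic_floor_def[abs_def] by measurable
  qed
  have next_lim: "(\<lambda>m. dyadic_next s t m r) \<longlonglongrightarrow> r" if "r \<le> t" for r
  proof -
    have "(\<lambda>m. dyadic_floor s m r + (1/2)^m) \<longlonglongrightarrow> r + 0"
      by (intro tendsto_add dyadic_floor_tendsto LIMSEQ_power_zero) simp
    then have "(\<lambda>m. min t (dyadic_floor s m r + (1/2)^m)) \<longlonglongrightarrow> min t r"
      by (intro tendsto_min tendsto_const) simp
    then show ?thesis using that by (simp add: dyadic_next_def power_divide)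
  qed
  have dm: "?\<delta> m \<in> borel_measurable ?M" for m
  proof -
    have "(\<lambda>r. norm (U (dyadic_next s t m r) r (?f r))) \<in> borel_measurable ?M"
      by (rule strongly_measurable_norm[OF complete_interval U_op_meas[OF st(1) next_meas _ fm]])
         (use next_ge in auto)
    then show ?thesis unfolding loss_def using fnm by auto
  qed
  have lim: "(\<lambda>m. \<integral>\<^sup>+r. ?\<delta> m r \<partial>?M) \<longlonglongrightarrow> (\<integral>\<^sup>+r. 0 \<partial>?M)"
  proof (rule nn_integral_dominated_convergence[where w="\<lambda>r. ennreal (norm (?f r))"])
    show "AE r in ?M. ?\<delta> m r \<le> ennreal (norm (?f r))" for m
      by (intro AE_I2) (auto simp: loss_def intro!: ennreal_leI)
    show "AE r in ?M. (\<lambda>m. ?\<delta> m r) \<longlonglongrightarrow> 0"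
    proof (rule AE_I2)
      fix r assume "r \<in> space ?M"
      then have r: "0 \<le> r" "r \<le> t" using st by auto
      have "(\<lambda>m. U (dyadic_next s t m r) r (?f r)) \<longlonglongrightarrow> U r r (?f r)"
        using r next_ge by (intro U_tendsto next_lim tendsto_const) auto
      then have "(\<lambda>m. norm (?f r) - norm (U (dyadic_next s t m r) r (?f r))) \<longlonglongrightarrow> norm (?f r) - norm (?f r)"
        by (intro tendsto_intros) (simp add: U_same r)
      then have "(\<lambda>m. ennreal (norm (?f r) - norm (U (dyadic_next s t m r) r (?f r)))) \<longlonglongrightarrow> ennreal (norm (?f r) - norm (?f r))"
        by (rule tendsto_ennrealI)
      then show "(\<lambda>m. ?\<delta> m r) \<longlonglongrightarrow> 0" by (simp add: loss_def)
    qed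
  qed (use dm fnm ff in simp_all)
  have bound: "ennreal (norm (defect (Suc n) t s u)) \<le> ennreal (2 * cone_bound) * (\<integral>\<^sup>+r. ?\<delta> m r \<partial>?M)" for m
  proof -
    obtain k where "(t - s) * 2^m < real k" using reals_Archimedean2 by blast
    then have "min t (s + real k / 2^m) = t" by (simp add: field_simps)
    moreover have "ennreal (norm (U t (min t (s + real k / 2^m)) (defect (Suc n) (min t (s + real k / 2^m)) s u))) \<le>
        ennreal (2 * cone_bound) * (\<integral>\<^sup>+r. ?\<delta> m r \<partial>lebesgue_on {s..min t (s + real k / 2^m)})"
      by (rule defect_grid_bound[OF _ st u dm]) (rule IH; assumption)
    ultimately show ?thesis using st by (simp add: U_same)
  qed
  have "(\<lambda>m. ennreal (2 * cone_bound) * (\<integral>\<^sup>+r. ?\<delta> m r \<partial>?M)) \<longlonglongrightarrow> ennreal (2 * cone_bound) * 0"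
    using lim by (intro ennreal_tendsto_cmult) simp_all
  then have "ennreal (norm (defect (Suc n) t s u)) \<le> ennreal (2 * cone_bound) * 0"
    by (rule LIMSEQ_le_const) (intro exI[of _ 0] allI impI bound)
  then show ?thesis by simp
qed

lemma defect_zero: "0 \<le> u \<Longrightarrow> 0 \<le> s \<Longrightarrow> s \<le> t \<Longrightarrow> defect n t s u = 0"
proof (induction n arbitrary: t s rule: less_induct)
  case (less n)
  show ?case
  proof (cases n)
    case 0
    then show ?thesis by (simp add: defect_def right_iterate_def Vb_Suc duhamel_def)
  next
    case (Suc m)
    show ?thesis unfolding Suc
      by (rule defect_zero_Suc) (use less Suc in auto)
  qed
qed

lemma Vb_Suc_eq_right_integral:
  assumes st: "0 \<le> s" "s \<le> t"
  shows "Vb (Suc n) t s x = Bochner_int (lebesgue_on {s..t}) (\<lambda>r. Vb n t r (B r (U r s x)))"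
proof -
  obtain u v :: 'a where uv: "0 \<le> u" "0 \<le> v" "x = u - v"
    using cone_generating unfolding generating_cone_def by blast
  have hi: "has_Bochner_int (lebesgue_on {s..t}) (\<lambda>r. Vb n t r (B r (U r s w))) (Vb (Suc n) t s w)" if "0 \<le> w" for w
    using right_iterate_has_int[OF st, of n w] defect_zero[OF that st, of n] by (simp add: defect_def)
  have ae: "AE r in lebesgue_on {s..t}. Vb n t r (B r (U r s u)) - Vb n t r (B r (U r s v)) =
      Vb n t r (B r (U r s x))"
    using Vb_dom[OF st, of 0 u] Vb_dom[OF st, of 0 v] AE_space
  proof eventually_elim
    case (elim r)
    then have r: "0 \<le> r" "r \<le> t" "s \<le> r" using st by auto
    have "U r s x = U r s u - U r s v"
      unfolding uv(3) by (rule linear_diff[OF bounded_linear.linear[OF U_bounded_linear[OF st(1) r(3)]]])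
    then have "B r (U r s x) = B r (U r s u) - B r (U r s v)"
      using elim by (simp add: B_diff[OF r(1)])
    then show ?case by (simp add: linear_diff[OF Vb_linear[OF r(1,2)]])
  qed
  have "Vb (Suc n) t s x = Vb (Suc n) t s u - Vb (Suc n) t s v"
    unfolding uv(3) by (rule linear_diff[OF Vb_linear[OF st]])
  also have "\<dots> = Bochner_int (lebesgue_on {s..t}) (\<lambda>r. Vb n t r (B r (U r s x)))"
    by (rule Bochner_int_eq[OF complete_interval has_Bochner_int_cong_AE[OF
          has_Bochner_int_diff[OF complete_interval hi[OF uv(1)] hi[OF uv(2)]] ae], symmetric])
  finally show ?thesis .
qed

theorem V_eq_Vbar: "0 \<le> s \<Longrightarrow> s \<le> t \<Longrightarrow> V U B n t s x = Vb n t s x"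
proof (induction n arbitrary: s x)
  case 0
  show ?case by simp
next
  case (Suc n)
  have "V U B (Suc n) t s x = Bochner_int (lebesgue_on {s..t}) (\<lambda>r. V U B n t r (B r (U r s x)))"
    by (simp add: V.simps(2))
  also have "\<dots> = Vb (Suc n) t s x"
  proof (rule Bochner_int_eq[OF complete_interval], rule has_Bochner_int_cong_AE)
    show "has_Bochner_int (lebesgue_on {s..t}) (\<lambda>r. Vb n t r (B r (U r s x))) (Vb (Suc n) t s x)"
      unfolding Vb_Suc_eq_right_integral[OF Suc.prems] right_iterate_def[symmetric] by (rule right_iterate_has_int[OF Suc.prems])
    show "AE r in lebesgue_on {s..t}. Vb n t r (B r (U r s x)) = V U B n t r (B r (U r s x))"
      by (rule AE_I2, rule Suc.IH[symmetric]) (use Suc.prems in auto)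
  qed
  finally show ?case .
qed

end

theorem proposition4p14:
  fixes U :: "real \<Rightarrow> real \<Rightarrow> 'a \<Rightarrow> 'a::{banach, ordered_real_vector}"
    and B :: "real \<Rightarrow> 'a \<Rightarrow> 'a"
    and D :: "real \<Rightarrow> 'a set"
    and n :: nat and t :: real
  assumes cone_closed: "closed {u::'a. 0 \<le> u}"
    and cone_generating: "generating_cone TYPE('a)"
    and norm_additive: "\<And>u v::'a. 0 \<le> u \<Longrightarrow> 0 \<le> v \<Longrightarrow> norm (u + v) = norm u + norm v"
    and evol: "evolution_family U"
    and B_linear: "\<And>t. 0 \<le> t \<Longrightarrow> linear_operator_on (D t) (B t)"
    and i: "\<And>t s u. 0 \<le> s \<Longrightarrow> s \<le> t \<Longrightarrow> 0 \<le> u \<Longrightarrow> 0 \<le> U t s u"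
    and ii: "\<And>t s u. 0 \<le> s \<Longrightarrow> s \<le> t \<Longrightarrow> 0 \<le> u \<Longrightarrow> norm (U t s u) \<le> norm u"
    and iii: "\<And>t u. 0 \<le> t \<Longrightarrow> u \<in> D t \<Longrightarrow> 0 \<le> u \<Longrightarrow> 0 \<le> B t u"
    and iv_dom: "\<And>s u. 0 \<le> s \<Longrightarrow> AE t in lebesgue_on {s..}. U t s u \<in> D t"
    and iv_meas: "\<And>s u. 0 \<le> s \<Longrightarrow> strongly_measurable (lebesgue_on {s..}) (\<lambda>t. B t (U t s u))"
    and iv_bound: "\<And>t s u. 0 \<le> s \<Longrightarrow> s \<le> t \<Longrightarrow> 0 \<le> u \<Longrightarrow>
        (\<integral>\<^sup>+\<tau>. ennreal (norm (B \<tau> (U \<tau> s u))) \<partial>lebesgue_on {s..t})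
          \<le> ennreal (norm u - norm (U t s u))"
    and v_dom: "\<And>f. f \<in> L1 (lebesgue_on {0..}) \<Longrightarrow>
        AE (t, s) in lebesgue_on Delta. U t s (f s) \<in> D t"
    and v_meas: "\<And>f. f \<in> L1 (lebesgue_on {0..}) \<Longrightarrow>
        strongly_measurable (lebesgue_on Delta) (\<lambda>(t, s). B t (U t s (f s)))"
    and vi: "\<And>t. 0 \<le> t \<Longrightarrow> increasingly_closed (D t) (B t)"
    and vii: "\<And>f. f \<in> L1 (lebesgue_on Delta) \<Longrightarrow>
        strongly_measurable (lebesgue_on Delta2) (\<lambda>(t, s, r). B t (U t s (f (s, r))))"
    and t_nonneg: "0 \<le> t"
  shows "\<forall>f \<in> L1 (lebesgue_on {0..}).
           AE r in lebesgue_on {0..}. T U B n t f r = Tbar U B n t f r"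
proof -
  interpret perturbed_evolution U B D
    by (unfold_locales; fact assms)
  (* For r < t both sides vanish through the indicator. *)
  have "T U B n t f r = Tbar U B n t f r" for f r
    using t_nonneg by (auto simp: T_def Tbar_def indicator_def V_eq_Vbar)
  then show ?thesis by simp
qed

end
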